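(* Let $\alpha_1,\alpha_2>0$ and $1\le p_1,q_1,p_2,q_2\le\infty$ with $\alpha_l+1/2-1/p_l>0$ for $l=1,2$, and let $C>0$. There exists a constant $c>0$ (depending only on $C$ and on $\alpha_l,p_l,q_l$, $l=1,2$) such that the following holds for all integers $m\ge1$, all $\sigma>0$ and all $M_1,M_2\ge\sigma$. If $M_1\le C\sigma m^{2\alpha_1+\frac12}$ and $\hat\theta$ is a distributed estimator satisfying $$\sup_{\theta\in\mathcal{B}^{\alpha_l}_{p_l,q_l}(M_l)}\mathbb{E}\|\hat\theta-\theta\|^2\le C\,M_l^{\frac{2}{2\alpha_l+1}}\left(\frac{\sigma^2}{m}\right)^{\frac{2\alpha_l}{2\alpha_l+1}}\quad\text{for } l=1,2,$$ then $$\sup_{\theta\in\mathcal{B}^{\alpha_2}_{p_2,q_2}(M_2)}\mathbb{E}L(\hat\theta)\ge c\left(\left(\frac{M_1}{\sigma}\right)^{\frac{2}{2\alpha_1+1}}m^{\frac{2\alpha_1+2}{2\alpha_1+1}}+\left(\frac{M_2}{\sigma}\right)^{\frac{2}{2\alpha_2+1}}m^{\frac{2\alpha_2+2}{2\alpha_2+1}}\right).$$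
   Context: Distributed Gaussian sequence model: there are $m$ local machines; machine $i\in\{1,\dots,m\}$ observes only $X_i=(X_{i,jk})_{j\ge0,\,1\le k\le 2^j}$, where $X_{i,jk}=\theta_{jk}+\sigma z_{i,jk}$, the $z_{i,jk}$ are i.i.d. $N(0,1)$ over all $i,j,k$, $\sigma>0$ is known, and $\theta=(\theta_{jk})_{j\ge0,1\le k\le2^j}$ is the unknown real sequence. Besov ball: with $s=\alpha+1/2-1/p$, $\mathcal{B}^{\alpha}_{p,q}(M)=\{\theta:|\theta|_{b^{\alpha}_{p,q}}\le M\}$, where $|\theta|_{b^{\alpha}_{p,q}}=\Big(\sum_{j\ge0}\big(2^{js}(\sum_{k=1}^{2^j}|\theta_{jk}|^p)^{1/p}\big)^q\Big)^{1/q}$, with the usual replacement by suprema when $p=\infty$ or $q=\infty$. Distributed estimator: machine $i$ produces a transcript $Z_i=Z_i(X_i)$, a (possibly randomized, with randomization independent across machines) function of its own data $X_i$ only, taking values in a uniquely decodable set of finite binary strings of length at least $1$. The central machine outputs $\hat\theta=\hat\theta(Z_1,\dots,Z_m)$, a real sequence. $|Z_i|_l$ is the length (number of bits) of $Z_i$, and $L(\hat\theta)=\sum_{i=1}^m|Z_i|_l$ is the total communication cost. Also $\|\hat\theta-\theta\|^2=\sum_{j\ge0}\sum_{k=1}^{2^j}(\hat\theta_{jk}-\theta_{jk})^2$, and expectations are over the data and the randomization. *)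

theory Defs
  imports "HOL-Probability.Probability" "HOL-Probability.Product_PMF"
begin

definition coef_index :: "(nat \<times> nat) set" where
  "coef_index = (SIGMA j:UNIV. {1..2 ^ j})"

text \<open>
  Coefficient sequences are functions \<open>nat \<Rightarrow> nat \<Rightarrow> real\<close> of which only the values at
  \<open>(j, k)\<close> in \<^const>\<open>coef_index\<close> are ever used.  The exponents \<open>p, q\<close> range over
  \<open>[1, \<infinity>]\<close>; since \<open>1 / \<infinity> = 0\<close> in \<^typ>\<open>ereal\<close>, the smoothness index \<open>s\<close> below has the
  usual meaning also for \<open>p = \<infinity>\<close>.
\<close>

definition besov_s :: "real \<Rightarrow> ereal \<Rightarrow> real" where
  "besov_s \<alpha> p = \<alpha> + 1 / 2 - real_of_ereal (1 / p)"

definition level_norm :: "ereal \<Rightarrow> (nat \<Rightarrow> nat \<Rightarrow> real) \<Rightarrow> nat \<Rightarrow> real" where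
  "level_norm p \<theta> j =
     (if p = \<infinity> then Max ((\<lambda>k. \<bar>\<theta> j k\<bar>) ` {1..2 ^ j})
      else (\<Sum>k = 1..2 ^ j. \<bar>\<theta> j k\<bar> powr real_of_ereal p) powr (1 / real_of_ereal p))"

definition besov_norm :: "real \<Rightarrow> ereal \<Rightarrow> ereal \<Rightarrow> (nat \<Rightarrow> nat \<Rightarrow> real) \<Rightarrow> ennreal" where
  "besov_norm \<alpha> p q \<theta> =
     (let a = (\<lambda>j. 2 powr (real j * besov_s \<alpha> p) * level_norm p \<theta> j) in
      if q = \<infinity> then (SUP j. ennreal (a j))
      else if summable (\<lambda>j. a j powr real_of_ereal q)
        then ennreal ((\<Sum>j. a j powr real_of_ereal q) powr (1 / real_of_ereal q))
        else \<infinity>)"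

definition besov_ball :: "real \<Rightarrow> ereal \<Rightarrow> ereal \<Rightarrow> real \<Rightarrow> (nat \<Rightarrow> nat \<Rightarrow> real) set" where
  "besov_ball \<alpha> p q M = {\<theta>. besov_norm \<alpha> p q \<theta> \<le> ennreal M}"

definition obs_space :: "(nat \<times> nat \<Rightarrow> real) measure" where
  "obs_space = (\<Pi>\<^sub>M jk\<in>coef_index. borel)"

definition noise_dist :: "(nat \<times> nat \<Rightarrow> real) measure" where
  "noise_dist = (\<Pi>\<^sub>M jk\<in>coef_index. density lborel (\<lambda>x. ennreal (std_normal_density x)))"

definition obs_dist :: "real \<Rightarrow> (nat \<Rightarrow> nat \<Rightarrow> real) \<Rightarrow> (nat \<times> nat \<Rightarrow> real) measure" where
  "obs_dist \<sigma> \<theta> =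
     distr noise_dist obs_space (\<lambda>z. \<lambda>(j, k)\<in>coef_index. \<theta> j k + \<sigma> * z (j, k))"

definition data_dist ::
    "nat \<Rightarrow> real \<Rightarrow> (nat \<Rightarrow> nat \<Rightarrow> real) \<Rightarrow> (nat \<Rightarrow> nat \<times> nat \<Rightarrow> real) measure" where
  "data_dist m \<sigma> \<theta> = (\<Pi>\<^sub>M i\<in>{1..m}. obs_dist \<sigma> \<theta>)"

definition uniquely_decodable :: "bool list set \<Rightarrow> bool" where
  "uniquely_decodable S \<longleftrightarrow> inj_on concat (lists S)"

text \<open>
  A randomized transcript of machine \<open>i\<close> is a Markov kernel \<open>K i\<close>: given its observation \<open>x\<close>,
  the machine sends a random string with law \<open>K i x\<close>.  The code may differ between machines.
\<close>

definition transcript_scheme :: "nat \<Rightarrow> (nat \<Rightarrow> (nat \<times> nat \<Rightarrow> real) \<Rightarrow> bool list pmf) \<Rightarrow> bool" where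
  "transcript_scheme m K \<longleftrightarrow>
     (\<forall>i\<in>{1..m}.
        (\<lambda>x. measure_pmf (K i x)) \<in> obs_space \<rightarrow>\<^sub>M prob_algebra (count_space UNIV) \<and>
        (\<exists>S. uniquely_decodable S \<and> (\<forall>w\<in>S. length w \<ge> 1) \<and>
             (\<forall>x\<in>space obs_space. set_pmf (K i x) \<subseteq> S)))"

text \<open>
  Given the data \<open>X\<close>, the transcripts are independent with laws \<open>K i (X i)\<close>; the default
  value \<open>[]\<close> of the product only concerns indices outside \<open>{1..m}\<close>, so that a function of
  \<open>Z\<close> is a function of \<open>Z 1, \<dots>, Z m\<close>.
\<close>

definition transcript_expectation ::
    "nat \<Rightarrow> real \<Rightarrow> (nat \<Rightarrow> nat \<Rightarrow> real) \<Rightarrow> (nat \<Rightarrow> (nat \<times> nat \<Rightarrow> real) \<Rightarrow> bool list pmf) \<Rightarrow>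
     ((nat \<Rightarrow> bool list) \<Rightarrow> ennreal) \<Rightarrow> ennreal" where
  "transcript_expectation m \<sigma> \<theta> K f =
     (\<integral>\<^sup>+X. (\<integral>\<^sup>+Z. f Z \<partial>measure_pmf (Pi_pmf {1..m} [] (\<lambda>i. K i (X i)))) \<partial>data_dist m \<sigma> \<theta>)"

definition sq_loss :: "(nat \<Rightarrow> nat \<Rightarrow> real) \<Rightarrow> (nat \<Rightarrow> nat \<Rightarrow> real) \<Rightarrow> ennreal" where
  "sq_loss \<eta> \<theta> = (\<Sum>j. ennreal (\<Sum>k = 1..2 ^ j. (\<eta> j k - \<theta> j k)\<^sup>2))"

definition risk ::
    "nat \<Rightarrow> real \<Rightarrow> (nat \<Rightarrow> (nat \<times> nat \<Rightarrow> real) \<Rightarrow> bool list pmf) \<Rightarrow>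
     ((nat \<Rightarrow> bool list) \<Rightarrow> nat \<Rightarrow> nat \<Rightarrow> real) \<Rightarrow> (nat \<Rightarrow> nat \<Rightarrow> real) \<Rightarrow> ennreal" where
  "risk m \<sigma> K \<theta>hat \<theta> = transcript_expectation m \<sigma> \<theta> K (\<lambda>Z. sq_loss (\<theta>hat Z) \<theta>)"

definition expected_cost ::
    "nat \<Rightarrow> real \<Rightarrow> (nat \<Rightarrow> (nat \<times> nat \<Rightarrow> real) \<Rightarrow> bool list pmf) \<Rightarrow>
     (nat \<Rightarrow> nat \<Rightarrow> real) \<Rightarrow> ennreal" where
  "expected_cost m \<sigma> K \<theta> =
     transcript_expectation m \<sigma> \<theta> K (\<lambda>Z. of_nat (\<Sum>i = 1..m. length (Z i)))"

end

theory Submission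
  imports Defs
begin

text \<open>
  Write \<open>D\<^sub>l = (M\<^sub>l\<^sup>2 m / \<sigma>\<^sup>2) powr (1 / (2 \<alpha>\<^sub>l + 1))\<close>.  The allowed risk on the ball \<open>l\<close> is
  \<open>C D\<^sub>l \<sigma>\<^sup>2 / m\<close> and the bound to prove on the number of bits is a constant times
  \<open>m D\<^sub>1 + m D\<^sub>2\<close>.

  A ball of radius \<open>M\<close> contains all signals living on one level \<open>J\<close> with coefficients
  \<open>\<sigma> a\<^sub>k\<close>, \<open>\<bar>a\<^sub>k\<bar> \<le> \<beta>\<close>, where \<open>d = 2 ^ J\<close> is a small multiple of \<open>D\<close> and \<open>\<beta>\<^sup>2\<close> is a large
  multiple of \<open>1 / m\<close>.  A product prior on this cube turns the risk bound into a Bayes risk bound,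
  and the van Trees inequality (\<open>van_trees_transcripts\<close>) says that a small Bayes risk forces the
  transcripts to carry Fisher information of order \<open>m d\<close> about \<open>a\<close>.  Fisher information adds up over
  the independent machines (\<open>second_moment_sum_Pi_pmf\<close>), so machines carry information of order \<open>d\<close> on
  average.  On the other hand, a transcript \<open>z\<close> sent with probability \<open>p\<close> reveals a score vector of
  squared length at most \<open>2 ln (1 / p)\<close> (\<open>sum_dprob_of_le_entropy\<close>), and the entropy of a short string
  is at most of the order of its length.  Hence one machine with strings no longer than \<open>t\<close>
  carries only \<open>O(t)\<close> units of information; longer strings count only as far as they are
  probable, because the full data of a machine carry a score of squared length about \<open>d\<close>
  (\<open>fisher_information_le\<close>).  The outcome is \<open>accuracy_needs_long_transcripts\<close>: averaged over
  prior and machines, strings longer than a constant times \<open>d\<close> have probability bounded below.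
  This gives expected cost of order \<open>m d\<close> somewhere on the ball.

  The contribution \<open>m D\<^sub>1\<close> must be paid inside the second ball although the difficult signals of the
  first ball need not belong to it.  The zero signal belongs to both balls, and a single machine
  cannot reliably tell it from the mixture over the prior: the second moment of the mixture likelihood
  ratio is at most \<open>exp (d \<beta>\<^sup>4 exp (\<beta>\<^sup>2))\<close>, which is bounded as \<open>\<beta>\<^sup>2\<close> is of order \<open>1 / m\<close> and
  \<open>d\<close> of order at most \<open>m\<^sup>2\<close>; the latter is the meaning of \<open>M\<^sub>1 \<le> C \<sigma> m powr (2 \<alpha>\<^sub>1 + 1 / 2)\<close>.
  So strings that are long under the prior are long with comparable probability at the zero signal
  (\<open>mixture_prob_le\<close>, \<open>cost_at_zero_ge\<close>).

  All facts about Gaussian data are drawn from one identity: the likelihood ratio of a shift by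
  \<open>a\<close> has expectation 1 for every \<open>a\<close>.  This is the assumption of the locale
  \<open>gaussian_experiment\<close>.
\<close>

section \<open>Shifting finitely many coordinates of Gaussian noise\<close>

abbreviation std_normal :: "real measure" where
  "std_normal \<equiv> density lborel (\<lambda>x. ennreal (std_normal_density x))"

lemma prob_space_std_normal: "prob_space std_normal"
  by (rule prob_space_normal_density) simp

lemma std_normal_shift:
  fixes g :: "real \<Rightarrow> ennreal"
  assumes [measurable]: "g \<in> borel_measurable borel"
  shows "(\<integral>\<^sup>+z. g (a + z) \<partial>std_normal) = (\<integral>\<^sup>+z. g z * ennreal (exp (a * z - a\<^sup>2 / 2)) \<partial>std_normal)"
proof -
  have tilt: "std_normal_density (z - a) = std_normal_density z * exp (a * z - a\<^sup>2 / 2)" for z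
    by (simp add: std_normal_density_def exp_add[symmetric] power2_eq_square field_simps)
  have "(\<integral>\<^sup>+z. g (a + z) \<partial>std_normal)
      = (\<integral>\<^sup>+z. ennreal (std_normal_density z) * g (a + z) \<partial>lborel)"
    by (subst nn_integral_density) auto
  also have "\<dots> = (\<integral>\<^sup>+z. ennreal (std_normal_density (z - a)) * g z \<partial>lborel)"
    by (subst nn_integral_real_affine[of "\<lambda>z. ennreal (std_normal_density (z - a)) * g z" 1 a]) auto
  also have "\<dots> = (\<integral>\<^sup>+z. ennreal (std_normal_density z) * (g z * ennreal (exp (a * z - a\<^sup>2 / 2))) \<partial>lborel)"
    unfolding tilt by (intro nn_integral_cong) (simp add: ennreal_mult' mult_ac)
  also have "\<dots> = (\<integral>\<^sup>+z. g z * ennreal (exp (a * z - a\<^sup>2 / 2)) \<partial>std_normal)"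
    by (subst nn_integral_density) auto
  finally show ?thesis .
qed

lemma nn_integral_prod_components:
  fixes f :: "'i \<Rightarrow> 'a \<Rightarrow> ennreal"
  assumes M: "\<And>i. prob_space (M i)" and J: "finite J" "J \<subseteq> I"
    and f: "\<And>j. j \<in> J \<Longrightarrow> f j \<in> borel_measurable (M j)"
  shows "(\<integral>\<^sup>+z. (\<Prod>j\<in>J. f j (z j)) \<partial>Pi\<^sub>M I M) = (\<Prod>j\<in>J. integral\<^sup>N (M j) (f j))"
proof -
  interpret product_prob_space M I
    using M by (simp add: product_prob_space_def product_prob_space_axioms_def product_sigma_finite_def
        prob_space_imp_sigma_finite)
  have meas: "(\<lambda>z. \<Prod>j\<in>J. f j (z j)) \<in> borel_measurable (Pi\<^sub>M J M)"
  proof (rule borel_measurable_prod_ennreal)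
    fix j assume j: "j \<in> J"
    show "(\<lambda>z. f j (z j)) \<in> borel_measurable (Pi\<^sub>M J M)"
      by (rule measurable_compose[OF measurable_component_singleton[of j J M, OF j] f[OF j]])
  qed
  have "(\<integral>\<^sup>+z. (\<Prod>j\<in>J. f j (z j)) \<partial>Pi\<^sub>M I M)
      = (\<integral>\<^sup>+z. (\<Prod>j\<in>J. f j (restrict z J j)) \<partial>Pi\<^sub>M I M)"
    by (intro nn_integral_cong prod.cong) auto
  also have "\<dots> = (\<integral>\<^sup>+z. (\<Prod>j\<in>J. f j (z j)) \<partial>distr (Pi\<^sub>M I M) (Pi\<^sub>M J M) (\<lambda>x. restrict x J))"
    using meas J by (subst nn_integral_distr) (auto intro!: measurable_restrict_subset)
  also have "\<dots> = (\<integral>\<^sup>+z. (\<Prod>j\<in>J. f j (z j)) \<partial>Pi\<^sub>M J M)"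
    by (simp add: distr_PiM_restrict_finite[OF J])
  also have "\<dots> = (\<Prod>j\<in>J. integral\<^sup>N (M j) (f j))"
    by (rule product_nn_integral_prod[OF J(1) f])
  finally show ?thesis .
qed

lemma prob_space_noise_dist: "prob_space noise_dist"
  unfolding noise_dist_def by (intro prob_space_PiM prob_space_std_normal)

lemma signal_measurable [measurable]:
  "(\<lambda>z. \<lambda>(j, k)\<in>coef_index. \<theta> j k + \<sigma> * z (j, k)) \<in> noise_dist \<rightarrow>\<^sub>M obs_space"
proof -
  have "(\<lambda>z. \<lambda>jk\<in>coef_index. \<theta> (fst jk) (snd jk) + \<sigma> * z jk) \<in> noise_dist \<rightarrow>\<^sub>M obs_space"
    unfolding obs_space_def
  proof (rule measurable_restrict)
    fix i assume "i \<in> coef_index"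
    then have [measurable]: "(\<lambda>z. z i) \<in> noise_dist \<rightarrow>\<^sub>M borel"
      using measurable_component_singleton[of i coef_index "\<lambda>_. std_normal"]
      by (simp add: noise_dist_def)
    show "(\<lambda>z. \<theta> (fst i) (snd i) + \<sigma> * z i) \<in> noise_dist \<rightarrow>\<^sub>M borel"
      by measurable
  qed
  moreover have "(\<lambda>z. \<lambda>jk\<in>coef_index. \<theta> (fst jk) (snd jk) + \<sigma> * z jk)
      = (\<lambda>z. \<lambda>(j, k)\<in>coef_index. \<theta> j k + \<sigma> * z (j, k))"
    by (auto simp: fun_eq_iff restrict_def)
  ultimately show ?thesis by simp
qed

lemma prob_space_obs_dist: "prob_space (obs_dist \<sigma> \<theta>)"
  unfolding obs_dist_def
  by (rule prob_space.prob_space_distr[OF prob_space_noise_dist signal_measurable])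

lemma sets_obs_dist [measurable_cong, simp]: "sets (obs_dist \<sigma> \<theta>) = sets obs_space"
  by (simp add: obs_dist_def)

lemma space_obs_dist [simp]: "space (obs_dist \<sigma> \<theta>) = space obs_space"
  by (simp add: obs_dist_def)

lemma component_obs_space [measurable]:
  "jk \<in> coef_index \<Longrightarrow> (\<lambda>x. x jk) \<in> obs_space \<rightarrow>\<^sub>M borel"
  unfolding obs_space_def by (rule measurable_component_singleton)

lemma nn_integral_obs_dist_prod:
  fixes f :: "nat \<times> nat \<Rightarrow> real \<Rightarrow> ennreal"
  assumes J: "finite J" "J \<subseteq> coef_index"
    and f: "\<And>j. j \<in> J \<Longrightarrow> f j \<in> borel_measurable borel"
  shows "(\<integral>\<^sup>+x. (\<Prod>j\<in>J. f j (x j)) \<partial>obs_dist \<sigma> \<theta>)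
       = (\<Prod>j\<in>J. \<integral>\<^sup>+z. f j (\<theta> (fst j) (snd j) + \<sigma> * z) \<partial>std_normal)"
proof -
  have [measurable]: "(\<lambda>x. \<Prod>j\<in>J. f j (x j)) \<in> borel_measurable obs_space"
    using J by (intro borel_measurable_prod_ennreal)
      (auto intro!: measurable_compose[OF component_obs_space f])
  have "(\<integral>\<^sup>+x. (\<Prod>j\<in>J. f j (x j)) \<partial>obs_dist \<sigma> \<theta>)
      = (\<integral>\<^sup>+z. (\<Prod>j\<in>J. f j (\<theta> (fst j) (snd j) + \<sigma> * z j)) \<partial>noise_dist)"
    unfolding obs_dist_def using J
    by (subst nn_integral_distr) (auto intro!: nn_integral_cong prod.cong simp: case_prod_beta subset_eq)
  also have "\<dots> = (\<Prod>j\<in>J. \<integral>\<^sup>+z. f j (\<theta> (fst j) (snd j) + \<sigma> * z) \<partial>std_normal)"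
    unfolding noise_dist_def
    using J by (subst nn_integral_prod_components[where f="\<lambda>j x. f j (\<theta> (fst j) (snd j) + \<sigma> * x)"])
      (auto intro!: measurable_compose[OF _ f] prob_space_std_normal)
  finally show ?thesis .
qed

text \<open>
  Two measures on the sequence space agree if they agree on cylinders.  A cylinder and the
  likelihood ratio together involve finitely many coordinates, so both sides factor into
  one-dimensional integrals, and each factor is a shift of the standard normal law.
\<close>

lemma obs_dist_density:
  assumes S: "finite S" "S \<subseteq> coef_index" and \<sigma>: "\<sigma> > 0"
  shows "obs_dist \<sigma> (\<lambda>j k. if (j, k) \<in> S then \<sigma> * a (j, k) else 0)
       = density (obs_dist \<sigma> (\<lambda>_ _. 0))
           (\<lambda>x. ennreal (\<Prod>s\<in>S. exp (a s * (x s / \<sigma>) - (a s)\<^sup>2 / 2)))"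
    (is "?P = density ?Q ?L")
proof (rule measure_eqI_PiM_infinite[where I=coef_index and M="\<lambda>_. borel"])
  show "sets ?P = sets (Pi\<^sub>M coef_index (\<lambda>_. borel))"
    "sets (density ?Q ?L) = sets (Pi\<^sub>M coef_index (\<lambda>_. borel))"
    subgoal by (simp add: obs_space_def) subgoal by (simp add: obs_space_def) done
  show "finite_measure ?P"
    using prob_space_obs_dist by (simp add: prob_space.finite_measure)
  fix A :: "nat \<times> nat \<Rightarrow> real set" and J
  assume J: "finite J" "J \<subseteq> coef_index" and A: "\<And>i. i \<in> J \<Longrightarrow> A i \<in> sets borel"
  let ?X = "prod_emb coef_index (\<lambda>_. borel) J (Pi\<^sub>E J A)"
  have X: "?X \<in> sets obs_space"
    unfolding obs_space_def using J A by (intro sets_PiM_I) auto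
  have L: "(\<lambda>x. ?L x) \<in> borel_measurable obs_space"
  proof (intro measurable_compose[OF _ measurable_ennreal] borel_measurable_prod)
    fix s assume "s \<in> S"
    then have [measurable]: "(\<lambda>x. x s) \<in> obs_space \<rightarrow>\<^sub>M borel" using S by (intro component_obs_space) auto
    show "(\<lambda>x. exp (a s * (x s / \<sigma>) - (a s)\<^sup>2 / 2)) \<in> borel_measurable obs_space" by measurable
  qed
  \<comment> \<open>Padding by the trivial event lets both sides be products over the same set \<open>J \<union> S\<close>.\<close>
  define B where "B i = (if i \<in> J then A i else UNIV)" for i
  have B: "B i \<in> sets borel" for i using A by (auto simp: B_def)
  have indB: "indicator ?X x = (\<Prod>j\<in>J \<union> S. indicator (B j) (x j) :: ennreal)" if "x \<in> space obs_space" for x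
  proof -
    have "x \<in> ?X \<longleftrightarrow> (\<forall>j\<in>J \<union> S. x j \<in> B j)"
      using that J by (auto simp: prod_emb_def space_PiM obs_space_def B_def PiE_iff)
    moreover have "(\<Prod>j\<in>J \<union> S. indicator (B j) (x j) :: ennreal) = of_bool (\<forall>j\<in>J \<union> S. x j \<in> B j)"
      using J S by (auto simp: indicator_def prod_zero_iff)
    ultimately show ?thesis by (auto simp: indicator_def)
  qed
  have one: "(\<integral>\<^sup>+z. indicator (B j) ((if j \<in> S then \<sigma> * a j else 0) + \<sigma> * z) \<partial>std_normal)
     = (\<integral>\<^sup>+z. indicator (B j) (\<sigma> * z) * ennreal (if j \<in> S then exp (a j * z - (a j)\<^sup>2 / 2) else 1) \<partial>std_normal)" for j
  proof -
    have [measurable]: "B j \<in> sets borel" by (rule B)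
    show ?thesis
      using std_normal_shift[of "\<lambda>z. indicator (B j) (\<sigma> * z)" "a j"] by (simp add: distrib_left)
  qed
  have "emeasure ?P ?X = (\<integral>\<^sup>+x. indicator ?X x \<partial>?P)"
    using X by simp
  also have "\<dots> = (\<integral>\<^sup>+x. (\<Prod>j\<in>J \<union> S. indicator (B j) (x j)) \<partial>?P)"
    by (intro nn_integral_cong) (simp add: indB)
  also have "\<dots> = (\<Prod>j\<in>J \<union> S. \<integral>\<^sup>+z. indicator (B j) ((if j \<in> S then \<sigma> * a j else 0) + \<sigma> * z) \<partial>std_normal)"
    using J S B by (subst nn_integral_obs_dist_prod) (auto cong: if_cong)
  also have "\<dots> = (\<Prod>j\<in>J \<union> S. \<integral>\<^sup>+z. indicator (B j) (0 + \<sigma> * z) *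
      ennreal (if j \<in> S then exp (a j * ((0 + \<sigma> * z) / \<sigma>) - (a j)\<^sup>2 / 2) else 1) \<partial>std_normal)"
    unfolding one using \<sigma> by (simp cong: if_cong)
  also have "\<dots> = (\<integral>\<^sup>+x. (\<Prod>j\<in>J \<union> S. indicator (B j) (x j) *
      ennreal (if j \<in> S then exp (a j * (x j / \<sigma>) - (a j)\<^sup>2 / 2) else 1)) \<partial>?Q)"
  proof -
    have [measurable]: "B j \<in> sets borel" for j by (rule B)
    show ?thesis
      using J S by (subst nn_integral_obs_dist_prod[where f="\<lambda>j x. indicator (B j) x *
        ennreal (if j \<in> S then exp (a j * (x / \<sigma>) - (a j)\<^sup>2 / 2) else 1)"]) auto
  qed
  also have "\<dots> = (\<integral>\<^sup>+x. ?L x * indicator ?X x \<partial>?Q)"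
  proof (intro nn_integral_cong)
    fix x assume x: "x \<in> space ?Q"
    have "(\<Prod>j\<in>J \<union> S. ennreal (if j \<in> S then exp (a j * (x j / \<sigma>) - (a j)\<^sup>2 / 2) else 1)) = ?L x"
      using J S by (subst prod.mono_neutral_right[of _ S]) (auto simp: prod_ennreal)
    then show "(\<Prod>j\<in>J \<union> S. indicator (B j) (x j) *
      ennreal (if j \<in> S then exp (a j * (x j / \<sigma>) - (a j)\<^sup>2 / 2) else 1)) = ?L x * indicator ?X x"
      using x by (simp add: indB prod.distrib mult.commute)
  qed
  also have "\<dots> = emeasure (density ?Q ?L) ?X"
    using X L by (subst emeasure_density) (auto simp: measurable_cong_sets[OF sets_obs_dist refl])
  finally show "emeasure ?P ?X = emeasure (density ?Q ?L) ?X" .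
qed

section \<open>Differentiating exponential moments\<close>

lemma exp_taylor_bound: "\<bar>exp u - 1 - u\<bar> \<le> u\<^sup>2 * exp \<bar>u\<bar>" for u :: real
proof -
  have 1: "1 + u \<le> exp u" by (rule exp_ge_add_one_self)
  have "1 - u \<le> exp (-u)" using exp_ge_add_one_self[of "-u"] by simp
  then have "exp u * (1 - u) \<le> exp u * exp (- u)" by (intro mult_left_mono) auto
  then have 2: "exp u - 1 \<le> u * exp u" by (simp add: exp_minus algebra_simps)
  show ?thesis
  proof (cases "u \<ge> 0")
    case True
    have "exp u - 1 - u \<le> u * (exp u - 1)" using 2 by (simp add: algebra_simps)
    also have "\<dots> \<le> u * (u * exp u)" using 2 True by (intro mult_left_mono) auto
    finally have "exp u - 1 - u \<le> u * (u * exp u)" .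
    moreover have "\<bar>exp u - 1 - u\<bar> = exp u - 1 - u" using 1 by linarith
    ultimately show ?thesis using True by (simp add: power2_eq_square mult.assoc)
  next
    case False
    have "exp u - 1 - u \<le> (-u) * (1 - exp u)" using 2 by (simp add: algebra_simps)
    also have "\<dots> \<le> (-u) * (-u)"
      using 1 False by (intro mult_left_mono; linarith)
    also have "\<dots> = u\<^sup>2 * 1" by (simp add: power2_eq_square)
    also have "\<dots> \<le> u\<^sup>2 * exp \<bar>u\<bar>" by (intro mult_left_mono) auto
    finally show ?thesis using 1 by linarith
  qed
qed

lemma exp_abs_le_sum: "exp \<bar>u\<bar> \<le> exp u + exp (- u)" for u :: real
  by (cases "u \<ge> 0") (auto simp: abs_if)

lemma abs_power_le_exp: "\<bar>u\<bar> ^ n \<le> fact n * (exp u + exp (- u))" for u :: real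
proof -
  have "\<bar>u\<bar> ^ n / fact n \<le> (\<Sum>i\<le>n. \<bar>u\<bar> ^ i / fact i)"
    by (rule member_le_sum) auto
  also have "\<dots> \<le> exp \<bar>u\<bar>"
    using sum_le_suminf[of "\<lambda>i. \<bar>u\<bar> ^ i / fact i" "{..n}"] summable_exp[of "\<bar>u\<bar>"]
    by (auto simp: exp_def divide_inverse mult.commute)
  finally have "\<bar>u\<bar> ^ n \<le> fact n * exp \<bar>u\<bar>"
    by (simp add: field_simps)
  also have "\<dots> \<le> fact n * (exp u + exp (- u))"
    by (intro mult_left_mono exp_abs_le_sum) auto
  finally show ?thesis .
qed

text \<open>
  A weight all of whose exponential moments in the direction \<open>Y\<close> are finite: its moment generating
  function can be differentiated under the integral.
\<close>

context
  fixes M :: "'x measure" and W Y :: "'x \<Rightarrow> real"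
  assumes W: "\<And>x. W x \<ge> 0" and [measurable]: "W \<in> borel_measurable M" "Y \<in> borel_measurable M"
    and int: "\<And>t. integrable M (\<lambda>x. W x * exp (t * Y x))"
begin

lemma integrable_exp_moment: "integrable M (\<lambda>x. W x * \<bar>Y x\<bar> ^ n * exp (t * Y x))"
proof (rule Bochner_Integration.integrable_bound)
  show "integrable M (\<lambda>x. fact n * (W x * exp ((t + 1) * Y x) + W x * exp ((t - 1) * Y x)))"
    using int by auto
  have "W x * \<bar>Y x\<bar> ^ n * exp (t * Y x)
      \<le> W x * (fact n * (exp (Y x) + exp (- Y x))) * exp (t * Y x)" for x
    using W by (intro mult_right_mono mult_left_mono abs_power_le_exp) auto
  also have "W x * (fact n * (exp (Y x) + exp (- Y x))) * exp (t * Y x)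
      = fact n * (W x * exp ((t + 1) * Y x) + W x * exp ((t - 1) * Y x))" for x
    by (simp add: algebra_simps exp_add exp_diff exp_minus divide_inverse)
  finally show "AE x in M. norm (W x * \<bar>Y x\<bar> ^ n * exp (t * Y x))
     \<le> norm (fact n * (W x * exp ((t + 1) * Y x) + W x * exp ((t - 1) * Y x)))"
    using W by (auto simp: abs_mult)
qed simp

lemma integrable_exp_moment': "integrable M (\<lambda>x. W x * Y x ^ n * exp (t * Y x))"
  by (rule Bochner_Integration.integrable_bound[OF integrable_exp_moment[of n t]])
     (auto simp: abs_mult power_abs)

lemma exp_moment_has_derivative:
  "((\<lambda>t. \<integral>x. W x * Y x ^ n * exp (t * Y x) \<partial>M) has_real_derivative
     (\<integral>x. W x * Y x ^ Suc n * exp (t * Y x) \<partial>M)) (at t)"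
proof -
  define K where "K = (\<integral>x. W x * \<bar>Y x\<bar> ^ (n + 2) * exp ((t + 1) * Y x) \<partial>M)
                    + (\<integral>x. W x * \<bar>Y x\<bar> ^ (n + 2) * exp ((t - 1) * Y x) \<partial>M)"
  let ?F = "\<lambda>t. \<integral>x. W x * Y x ^ n * exp (t * Y x) \<partial>M"
  let ?D = "\<integral>x. W x * Y x ^ Suc n * exp (t * Y x) \<partial>M"
  note [intro] = integrable_exp_moment integrable_exp_moment'
  have bound: "norm ((?F (t + h) - ?F t) / h - ?D) \<le> \<bar>h\<bar> * K" if h: "h \<noteq> 0" "\<bar>h\<bar> \<le> 1" for h
  proof -
    have "?F (t + h) - ?F t - h * ?D
       = (\<integral>x. W x * Y x ^ n * exp ((t + h) * Y x) - W x * Y x ^ n * exp (t * Y x)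
            - h * (W x * Y x ^ Suc n * exp (t * Y x)) \<partial>M)"
      using integrable_exp_moment'[of n "t + h"] integrable_exp_moment'[of n t]
        integrable_exp_moment'[of "Suc n" t]
      by (subst Bochner_Integration.integral_diff; (subst Bochner_Integration.integral_diff)?)
         (auto intro!: Bochner_Integration.integrable_diff integrable_mult_right)
    also have "\<dots> = (\<integral>x. W x * Y x ^ n * exp (t * Y x) * (exp (h * Y x) - 1 - h * Y x) \<partial>M)"
      by (intro Bochner_Integration.integral_cong) (simp_all add: algebra_simps exp_add)
    finally have eq: "?F (t + h) - ?F t - h * ?D
      = (\<integral>x. W x * Y x ^ n * exp (t * Y x) * (exp (h * Y x) - 1 - h * Y x) \<partial>M)" .
    have "\<bar>?F (t + h) - ?F t - h * ?D\<bar>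
       \<le> (\<integral>x. h\<^sup>2 * (W x * \<bar>Y x\<bar> ^ (n + 2) * exp ((t + 1) * Y x)
                  + W x * \<bar>Y x\<bar> ^ (n + 2) * exp ((t - 1) * Y x)) \<partial>M)"
      unfolding eq
    proof (rule integral_abs_bound[THEN order_trans], rule integral_mono')
      show "integrable M (\<lambda>x. h\<^sup>2 * (W x * \<bar>Y x\<bar> ^ (n + 2) * exp ((t + 1) * Y x)
                  + W x * \<bar>Y x\<bar> ^ (n + 2) * exp ((t - 1) * Y x)))"
        by (intro integrable_mult_right Bochner_Integration.integrable_add integrable_exp_moment)
      fix x
      have "\<bar>exp (h * Y x) - 1 - h * Y x\<bar> \<le> (h * Y x)\<^sup>2 * exp \<bar>h * Y x\<bar>"
        by (rule exp_taylor_bound)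
      also have "\<dots> \<le> (h * Y x)\<^sup>2 * exp \<bar>Y x\<bar>"
        using h by (intro mult_left_mono) (auto simp: abs_mult intro!: mult_left_le_one_le)
      also have "\<dots> \<le> (h * Y x)\<^sup>2 * (exp (Y x) + exp (- Y x))"
        by (intro mult_left_mono exp_abs_le_sum) auto
      finally have "W x * \<bar>Y x\<bar> ^ n * exp (t * Y x) * \<bar>exp (h * Y x) - 1 - h * Y x\<bar>
         \<le> W x * \<bar>Y x\<bar> ^ n * exp (t * Y x) * ((h * Y x)\<^sup>2 * (exp (Y x) + exp (- Y x)))"
        using W by (intro mult_left_mono) auto
      also have "\<dots> = W x * (\<bar>Y x\<bar> ^ n * \<bar>Y x\<bar>\<^sup>2) * exp (t * Y x) * (h\<^sup>2 * (exp (Y x) + exp (- Y x)))"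
        by (simp add: power_mult_distrib mult_ac)
      also have "\<dots> = h\<^sup>2 * (W x * \<bar>Y x\<bar> ^ (n + 2) * exp ((t + 1) * Y x)
                  + W x * \<bar>Y x\<bar> ^ (n + 2) * exp ((t - 1) * Y x))"
        unfolding power_add[symmetric]
        by (simp add: algebra_simps exp_add exp_diff exp_minus divide_inverse)
      finally show "\<bar>W x * Y x ^ n * exp (t * Y x) * (exp (h * Y x) - 1 - h * Y x)\<bar>
         \<le> h\<^sup>2 * (W x * \<bar>Y x\<bar> ^ (n + 2) * exp ((t + 1) * Y x)
                  + W x * \<bar>Y x\<bar> ^ (n + 2) * exp ((t - 1) * Y x))"
        using W by (simp add: abs_mult power_abs)
    qed (use W in auto)
    also have "\<dots> = h\<^sup>2 * K"
      unfolding K_def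
      by (subst integral_mult_right_zero,
          subst Bochner_Integration.integral_add[OF integrable_exp_moment integrable_exp_moment]) (rule refl)
    finally have "\<bar>?F (t + h) - ?F t - h * ?D\<bar> \<le> h\<^sup>2 * K" .
    moreover have "(?F (t + h) - ?F t) / h - ?D = (?F (t + h) - ?F t - h * ?D) / h"
      using h by (simp add: field_simps)
    ultimately have "\<bar>(?F (t + h) - ?F t) / h - ?D\<bar> \<le> h\<^sup>2 * K / \<bar>h\<bar>"
      using h by (simp add: divide_right_mono)
    also have "\<dots> = \<bar>h\<bar> * K" using h by (simp add: power2_eq_square abs_if)
    finally show ?thesis by simp
  qed
  have "((\<lambda>h. (?F (t + h) - ?F t) / h - ?D) \<longlongrightarrow> 0) (at 0)"
  proof (rule Lim_null_comparison)
    have "\<forall>\<^sub>F h in at (0::real). h \<noteq> 0 \<and> \<bar>h\<bar> \<le> 1"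
      unfolding eventually_at by (rule exI[of _ 1]) auto
    then show "\<forall>\<^sub>F h in at 0. norm ((?F (t + h) - ?F t) / h - ?D) \<le> \<bar>h\<bar> * K"
      by eventually_elim (use bound in auto)
    show "((\<lambda>h. \<bar>h\<bar> * K) \<longlongrightarrow> 0) (at 0)"
      by (auto intro!: tendsto_eq_intros)
  qed
  then show ?thesis
    unfolding DERIV_def by (simp add: LIM_zero_iff)
qed

end

section \<open>Gaussian shift experiments\<close>

text \<open>
  Data whose law under the parameter \<open>a\<close> has the density \<open>exp (\<Sum>k\<in>I. a k * Y k - (a k)\<^sup>2 / 2)\<close>
  with respect to \<open>P0\<close>.  That these densities have total mass 1 for all \<open>a\<close> amounts to the
  coordinates \<open>Y k\<close> being independent standard normal under \<open>P0\<close>; the rest of the data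
  is arbitrary.
\<close>

locale gaussian_experiment = prob_space P0 for P0 :: "'x measure" +
  fixes I :: "'k set" and Y :: "'k \<Rightarrow> 'x \<Rightarrow> real"
  assumes finite_I: "finite I"
    and Y_measurable [measurable]: "\<And>k. k \<in> I \<Longrightarrow> Y k \<in> borel_measurable P0"
    and lik_total: "\<And>a :: 'k \<Rightarrow> real.
      (\<integral>\<^sup>+x. ennreal (exp (\<Sum>k\<in>I. a k * Y k x - (a k)\<^sup>2 / 2)) \<partial>P0) = 1"
begin

definition lik :: "('k \<Rightarrow> real) \<Rightarrow> 'x \<Rightarrow> real" where
  "lik a x = exp (\<Sum>k\<in>I. a k * Y k x - (a k)\<^sup>2 / 2)"

lemma lik_pos [simp]: "lik a x > 0" and lik_nonneg [simp]: "lik a x \<ge> 0"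
  by (simp_all add: lik_def)

lemma lik_measurable [measurable]: "lik a \<in> borel_measurable P0"
  unfolding lik_def by measurable

lemma integrable_lik: "integrable P0 (lik a)"
  and integral_lik: "(\<integral>x. lik a x \<partial>P0) = 1"
proof -
  have "(\<integral>\<^sup>+x. ennreal (lik a x) \<partial>P0) = ennreal 1"
    using lik_total[of a] by (simp add: lik_def)
  then have "has_bochner_integral P0 (lik a) 1"
    by (intro has_bochner_integral_nn_integral) auto
  then show "integrable P0 (lik a)" "(\<integral>x. lik a x \<partial>P0) = 1"
    by (auto simp: has_bochner_integral_iff)
qed

text \<open>
  Exponential tilts of a Gaussian law are again shifts.  This replaces all computations of
  Gaussian moments: exponential moments of the score are integrals of another likelihood.
\<close>

lemma lik_tilt:
  "exp (\<Sum>k\<in>I. u k * (Y k x - a k)) * lik a x = exp (\<Sum>k\<in>I. (u k)\<^sup>2 / 2) * lik (\<lambda>k. a k + u k) x"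
  unfolding lik_def exp_add[symmetric] sum.distrib[symmetric]
  by (intro arg_cong[where f=exp] sum.cong) (auto simp: power2_eq_square algebra_simps field_simps)

lemma lik_tilt_single:
  assumes "k \<in> I"
  shows "exp (t * (Y k x - a k)) * lik a x = exp (t\<^sup>2 / 2) * lik (a(k := a k + t)) x"
proof -
  have "(\<lambda>l. a l + (if l = k then t else 0)) = a(k := a k + t)" by auto
  moreover have "(\<Sum>l\<in>I. (if l = k then t else 0) * (Y l x - a l)) = t * (Y k x - a k)"
    "(\<Sum>l\<in>I. (if l = k then t else 0)\<^sup>2 / 2) = t\<^sup>2 / 2"
    using assms finite_I by (auto simp: if_distrib[where f="\<lambda>t. t * _"] if_distrib[where f="\<lambda>t. t\<^sup>2 / 2"]
        sum.delta cong: if_cong)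
  ultimately show ?thesis
    using lik_tilt[of "\<lambda>l. if l = k then t else 0" x a] by simp
qed

lemma lik_mult: "lik a x * lik b x = exp (\<Sum>k\<in>I. a k * b k) * lik (\<lambda>k. a k + b k) x"
  unfolding lik_def exp_add[symmetric] sum.distrib[symmetric]
  by (intro arg_cong[where f=exp] sum.cong) (auto simp: power2_eq_square algebra_simps field_simps)

text \<open>
  A weight is a randomized event: \<open>w x\<close> is the probability that it occurs when the data are \<open>x\<close>.
\<close>

definition weight :: "('x \<Rightarrow> real) \<Rightarrow> bool" where
  "weight w \<longleftrightarrow> w \<in> borel_measurable P0 \<and> (\<forall>x. 0 \<le> w x \<and> w x \<le> 1)"

lemma weightD [dest]:
  assumes "weight w"
  shows "w \<in> borel_measurable P0" "\<And>x. 0 \<le> w x" "\<And>x. w x \<le> 1"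
  using assms by (auto simp: weight_def)

text \<open>
  Powers are dominated by \<open>exp\<close> and \<open>exp \<circ> uminus\<close>, and the two tilts are likelihoods of shifted parameters.
\<close>

lemma score_power_le:
  assumes "k \<in> I"
  shows "\<bar>Y k x - a k\<bar> ^ n * lik a x
     \<le> fact n * exp (1/2) * (lik (a(k := a k + 1)) x + lik (a(k := a k - 1)) x)"
proof -
  have "\<bar>Y k x - a k\<bar> ^ n * lik a x
      \<le> fact n * (exp (Y k x - a k) + exp (- (Y k x - a k))) * lik a x"
    by (intro mult_right_mono abs_power_le_exp) auto
  also have "\<dots> = fact n * (exp (1 * (Y k x - a k)) * lik a x + exp ((-1) * (Y k x - a k)) * lik a x)"
    by (simp add: algebra_simps)
  also have "\<dots> = fact n * exp (1/2) * (lik (a(k := a k + 1)) x + lik (a(k := a k - 1)) x)"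
    unfolding lik_tilt_single[OF assms] by (simp add: algebra_simps)
  finally show ?thesis .
qed

lemma integrable_weight_score:
  assumes w: "weight w" and k: "k \<in> I"
  shows "integrable P0 (\<lambda>x. w x * (Y k x - a k) ^ n * lik a x)"
proof (rule Bochner_Integration.integrable_bound)
  have [measurable]: "w \<in> borel_measurable P0" using w by auto
  show "(\<lambda>x. w x * (Y k x - a k) ^ n * lik a x) \<in> borel_measurable P0"
    using k by measurable
  show "integrable P0 (\<lambda>x. fact n * exp (1/2) * (lik (a(k := a k + 1)) x + lik (a(k := a k - 1)) x))"
    by (intro integrable_mult_right Bochner_Integration.integrable_add integrable_lik)
  have "norm (w x * (Y k x - a k) ^ n * lik a x)
      \<le> norm (fact n * exp (1/2) * (lik (a(k := a k + 1)) x + lik (a(k := a k - 1)) x))" for x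
  proof -
    have "norm (w x * (Y k x - a k) ^ n * lik a x) = w x * (\<bar>Y k x - a k\<bar> ^ n * lik a x)"
      using w by (auto simp: abs_mult power_abs weight_def)
    also have "\<dots> \<le> 1 * (\<bar>Y k x - a k\<bar> ^ n * lik a x)"
      using w by (intro mult_right_mono) auto
    also have "\<dots> \<le> fact n * exp (1/2) * (lik (a(k := a k + 1)) x + lik (a(k := a k - 1)) x)"
      using score_power_le[OF k] by simp
    finally show ?thesis by simp
  qed
  then show "AE x in P0. norm (w x * (Y k x - a k) ^ n * lik a x)
      \<le> norm (fact n * exp (1/2) * (lik (a(k := a k + 1)) x + lik (a(k := a k - 1)) x))" by simp
qed

lemma integrable_weight_lik:
  assumes w: "weight w" shows "integrable P0 (\<lambda>x. w x * lik a x)"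
proof (rule Bochner_Integration.integrable_bound[OF integrable_lik[of a]])
  have [measurable]: "w \<in> borel_measurable P0" using w by auto
  show "(\<lambda>x. w x * lik a x) \<in> borel_measurable P0" by measurable
  show "AE x in P0. norm (w x * lik a x) \<le> norm (lik a x)"
    using w by (auto simp: abs_mult weight_def intro!: mult_left_le_one_le)
qed

text \<open>
  The probability of a randomized event under the parameter \<open>a\<close>, and its partial derivative in the
  direction \<open>k\<close>; the latter is justified by \<open>prob_of_has_derivative\<close>.
\<close>

definition prob_of :: "('x \<Rightarrow> real) \<Rightarrow> ('k \<Rightarrow> real) \<Rightarrow> real" where
  "prob_of w a = (\<integral>x. w x * lik a x \<partial>P0)"

definition dprob_of :: "('x \<Rightarrow> real) \<Rightarrow> ('k \<Rightarrow> real) \<Rightarrow> 'k \<Rightarrow> real" where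
  "dprob_of w a k = (\<integral>x. w x * (Y k x - a k) * lik a x \<partial>P0)"

lemma prob_of_nonneg: "weight w \<Longrightarrow> prob_of w a \<ge> 0"
  unfolding prob_of_def by (intro Bochner_Integration.integral_nonneg) (auto simp: weight_def)

lemma weight_eq_0_AE:
  assumes w: "weight w" and 0: "prob_of w a = 0"
  shows "AE x in P0. w x = 0"
proof -
  have "AE x in P0. w x * lik a x = 0"
    using integral_nonneg_eq_0_iff_AE[OF integrable_weight_lik[OF w]] 0 w
    by (auto simp: prob_of_def weight_def)
  then show ?thesis by eventually_elim (use lik_pos[of a] in \<open>auto simp: less_le\<close>)
qed

lemma dprob_of_eq_0:
  assumes w: "weight w" and 0: "prob_of w a = 0"
  shows "dprob_of w a k = 0"
  unfolding dprob_of_def using weight_eq_0_AE[OF assms]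
  by (intro integral_eq_zero_AE) auto

text \<open>
  Isolating one coordinate: up to the factor \<open>exp (- t\<^sup>2 / 2)\<close>, the probability is the moment
  generating function of \<open>Y k\<close> under the weight \<open>W\<close> that collects the other coordinates.
\<close>

lemma prob_of_upd:
  fixes a :: "'k \<Rightarrow> real"
  assumes w: "weight w" and k: "k \<in> I"
    and W_def: "W = (\<lambda>x. w x * exp (\<Sum>l\<in>I - {k}. a l * Y l x - (a l)\<^sup>2 / 2))"
  shows "\<And>x. W x \<ge> 0" "W \<in> borel_measurable P0"
    "\<And>x t. w x * lik (a(k := t)) x = exp (- t\<^sup>2 / 2) * (W x * exp (t * Y k x))"
    "\<And>t. integrable P0 (\<lambda>x. W x * exp (t * Y k x))"
proof -
  have [measurable]: "w \<in> borel_measurable P0" using w by auto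
  show "\<And>x. W x \<ge> 0" using w by (auto simp: W_def weight_def)
  show "W \<in> borel_measurable P0" unfolding W_def by measurable
  have lik: "lik (a(k := t)) x = exp (- t\<^sup>2 / 2) * (exp (\<Sum>l\<in>I - {k}. a l * Y l x - (a l)\<^sup>2 / 2) * exp (t * Y k x))" for x t
  proof -
    have "(\<Sum>l\<in>I. (a(k := t)) l * Y l x - ((a(k := t)) l)\<^sup>2 / 2)
        = t * Y k x - t\<^sup>2 / 2 + (\<Sum>l\<in>I - {k}. a l * Y l x - (a l)\<^sup>2 / 2)"
      using k finite_I by (subst sum.remove[of _ k]) auto
    then show ?thesis by (simp add: lik_def exp_add[symmetric] algebra_simps)
  qed
  show eq: "\<And>x t. w x * lik (a(k := t)) x = exp (- t\<^sup>2 / 2) * (W x * exp (t * Y k x))"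
    unfolding lik W_def by simp
  show "integrable P0 (\<lambda>x. W x * exp (t * Y k x))" for t
    using integrable_weight_lik[OF w, of "a(k := t)"] unfolding eq by simp
qed

lemma prob_of_has_derivative:
  assumes w: "weight w" and k: "k \<in> I"
  shows "((\<lambda>t. prob_of w (a(k := t))) has_real_derivative dprob_of w (a(k := t)) k) (at t)"
    and "continuous_on UNIV (\<lambda>t. dprob_of w (a(k := t)) k)"
proof -
  define W where "W = (\<lambda>x. w x * exp (\<Sum>l\<in>I - {k}. a l * Y l x - (a l)\<^sup>2 / 2))"
  note W = prob_of_upd[OF w k W_def]
  note D = exp_moment_has_derivative[OF W(1,2) Y_measurable[OF k] W(4)]
  note int = integrable_exp_moment'[OF W(1,2) Y_measurable[OF k] W(4)]
  define E where "E n t = (\<integral>x. W x * Y k x ^ n * exp (t * Y k x) \<partial>P0)" for n t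
  have E: "(E n has_real_derivative E (Suc n) t) (at t)" for n t
    using D[of n t] by (simp add: E_def[abs_def])
  have p: "prob_of w (a(k := t)) = exp (- t\<^sup>2 / 2) * E 0 t" for t
    unfolding prob_of_def W(3) E_def by simp
  have d: "dprob_of w (a(k := t)) k = exp (- t\<^sup>2 / 2) * (E 1 t - t * E 0 t)" for t
  proof -
    have "dprob_of w (a(k := t)) k
       = (\<integral>x. (Y k x - t) * (w x * lik (a(k := t)) x) \<partial>P0)"
      unfolding dprob_of_def by (simp add: mult_ac)
    also have "\<dots> = exp (- t\<^sup>2 / 2) * (\<integral>x. W x * Y k x ^ 1 * exp (t * Y k x) - t * (W x * Y k x ^ 0 * exp (t * Y k x)) \<partial>P0)"
      unfolding W(3) integral_mult_right_zero[symmetric]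
      by (intro Bochner_Integration.integral_cong) (simp_all add: algebra_simps)
    also have "\<dots> = exp (- t\<^sup>2 / 2) * (E 1 t - t * E 0 t)"
      unfolding E_def using int[of 1 t] int[of 0 t]
      by (subst Bochner_Integration.integral_diff) auto
    finally show ?thesis .
  qed
  show "((\<lambda>t. prob_of w (a(k := t))) has_real_derivative dprob_of w (a(k := t)) k) (at t)"
  proof -
    have "((\<lambda>t. exp (- t\<^sup>2 / 2)) has_real_derivative (- t * exp (- t\<^sup>2 / 2))) (at t)"
      by (auto intro!: derivative_eq_intros)
    from DERIV_mult[OF this E[of 0 t]] show ?thesis
      unfolding p d by (simp add: algebra_simps)
  qed
  have "continuous_on UNIV (E n)" for n
    by (intro continuous_at_imp_continuous_on ballI DERIV_isCont[OF E])
  then show "continuous_on UNIV (\<lambda>t. dprob_of w (a(k := t)) k)"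
    unfolding d by (intro continuous_intros) auto
qed

text \<open>
  The conditional mean \<open>u\<close> of the score given an event of probability \<open>p\<close> satisfies
  \<open>\<bar>u\<bar>\<^sup>2 \<le> 2 ln (1 / p)\<close>: Jensen's inequality for \<open>exp\<close> gives
  \<open>exp (\<bar>u\<bar>\<^sup>2)\<close> as a lower bound for the conditional exponential moment in the direction \<open>u\<close>, and
  the unconditional one is \<open>exp (\<bar>u\<bar>\<^sup>2 / 2)\<close>.  The bound does not depend on the dimension, which is
  what makes the information of a transcript proportional to its length.
\<close>

lemma sum_dprob_of_le_entropy:
  assumes w: "weight w"
  shows "(\<Sum>k\<in>I. (dprob_of w a k)\<^sup>2) \<le> 2 * (prob_of w a)\<^sup>2 * ln (1 / prob_of w a)"
proof (cases "prob_of w a = 0")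
  case True
  then show ?thesis using dprob_of_eq_0[OF w] by simp
next
  case False
  define p where "p = prob_of w a"
  have p: "p > 0" using prob_of_nonneg[OF w, of a] False by (simp add: p_def)
  define u where "u k = dprob_of w a k / p" for k
  define U where "U = (\<Sum>k\<in>I. (u k)\<^sup>2)"
  have [measurable]: "w \<in> borel_measurable P0" using w by auto
  let ?v = "\<lambda>x. \<Sum>k\<in>I. u k * (Y k x - a k)"
  have int1: "integrable P0 (\<lambda>x. w x * (Y k x - a k) * lik a x)" if "k \<in> I" for k
    using integrable_weight_score[OF w that, of a 1] by simp
  have vint: "integrable P0 (\<lambda>x. \<Sum>k\<in>I. u k * (w x * (Y k x - a k) * lik a x))"
    by (intro Bochner_Integration.integrable_sum integrable_mult_right int1)
  have "(\<integral>x. (\<Sum>k\<in>I. u k * (w x * (Y k x - a k) * lik a x)) \<partial>P0) = (\<Sum>k\<in>I. u k * dprob_of w a k)"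
    unfolding dprob_of_def using int1 by (subst Bochner_Integration.integral_sum) auto
  also have "\<dots> = p * U"
    unfolding U_def sum_distrib_left u_def using p by (intro sum.cong) (auto simp: power2_eq_square)
  finally have v: "(\<integral>x. (\<Sum>k\<in>I. u k * (w x * (Y k x - a k) * lik a x)) \<partial>P0) = p * U" .
  have tilt: "exp (?v x) * lik a x = exp (U / 2) * lik (\<lambda>k. a k + u k) x" for x
    unfolding lik_tilt U_def by (simp add: sum_divide_distrib)
  have "exp U * p = (\<integral>x. exp U * ((1 - U) * (w x * lik a x) + (\<Sum>k\<in>I. u k * (w x * (Y k x - a k) * lik a x))) \<partial>P0)"
    unfolding integral_mult_right_zero
    by (subst Bochner_Integration.integral_add[OF integrable_mult_right[OF integrable_weight_lik[OF w]] vint])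
       (simp add: v, simp add: prob_of_def[symmetric] p_def algebra_simps)
  also have "\<dots> \<le> (\<integral>x. exp (U / 2) * lik (\<lambda>k. a k + u k) x \<partial>P0)"
  proof (rule integral_mono)
    show "integrable P0 (\<lambda>x. exp U * ((1 - U) * (w x * lik a x) + (\<Sum>k\<in>I. u k * (w x * (Y k x - a k) * lik a x))))"
      by (intro integrable_mult_right Bochner_Integration.integrable_add vint integrable_weight_lik w)
    show "integrable P0 (\<lambda>x. exp (U / 2) * lik (\<lambda>k. a k + u k) x)"
      by (intro integrable_mult_right integrable_lik)
    fix x
    have "(1 - U) * (w x * lik a x) + (\<Sum>k\<in>I. u k * (w x * (Y k x - a k) * lik a x))
        = w x * lik a x * (1 + (?v x - U))"
      by (simp add: sum_distrib_left sum_distrib_right algebra_simps)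
    \<comment> \<open>Jensen in pointwise form: the tangent of \<open>exp\<close> at the conditional mean \<open>U\<close> of \<open>?v\<close>.\<close>
    also have "exp U * \<dots> \<le> exp U * (w x * lik a x * exp (?v x - U))"
      using w by (intro mult_left_mono exp_ge_add_one_self) (auto intro!: mult_nonneg_nonneg)
    also have "\<dots> = w x * (exp (?v x) * lik a x)" by (simp add: exp_diff)
    also have "\<dots> \<le> 1 * (exp (?v x) * lik a x)"
      using w by (intro mult_right_mono) auto
    also have "\<dots> = exp (U / 2) * lik (\<lambda>k. a k + u k) x" by (simp add: tilt)
    finally show "exp U * ((1 - U) * (w x * lik a x) + (\<Sum>k\<in>I. u k * (w x * (Y k x - a k) * lik a x)))
       \<le> exp (U / 2) * lik (\<lambda>k. a k + u k) x" .
  qed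
  also have "\<dots> = exp (U / 2)" by (simp add: integral_lik)
  finally have "ln (exp U * p) \<le> ln (exp (U / 2))" using p by (subst ln_le_cancel_iff) auto
  then have "U \<le> 2 * ln (1 / p)" using p by (simp add: ln_mult ln_div)
  then have "p\<^sup>2 * U \<le> p\<^sup>2 * (2 * ln (1 / p))" by (intro mult_left_mono) auto
  also have "p\<^sup>2 * U = (\<Sum>k\<in>I. (dprob_of w a k)\<^sup>2)"
    unfolding U_def u_def sum_distrib_left using p by (simp add: power_divide)
  finally show ?thesis by (simp add: p_def mult_ac)
qed

text \<open>
  The squared conditional mean of the score is at most its conditional second moment.
\<close>

lemma dprob_of_sq_le:
  assumes w: "weight w" and k: "k \<in> I"
  shows "(dprob_of w a k)\<^sup>2 \<le> prob_of w a * (\<integral>x. w x * (Y k x - a k)\<^sup>2 * lik a x \<partial>P0)"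
proof (cases "prob_of w a = 0")
  case True
  then show ?thesis using dprob_of_eq_0[OF w] by simp
next
  case False
  define p where "p = prob_of w a"
  have p: "p > 0" using prob_of_nonneg[OF w, of a] False by (simp add: p_def)
  define d where "d = dprob_of w a k"
  have i: "integrable P0 (\<lambda>x. w x * (Y k x - a k)\<^sup>2 * lik a x)"
    "integrable P0 (\<lambda>x. w x * (Y k x - a k) * lik a x)" "integrable P0 (\<lambda>x. w x * lik a x)"
    using integrable_weight_score[OF w k, of a 2] integrable_weight_score[OF w k, of a 1]
      integrable_weight_lik[OF w] by simp_all
  have "0 \<le> (\<integral>x. w x * ((Y k x - a k) - d / p)\<^sup>2 * lik a x \<partial>P0)"
    using w by (intro Bochner_Integration.integral_nonneg) (auto intro!: mult_nonneg_nonneg)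
  also have "\<dots> = (\<integral>x. (w x * (Y k x - a k)\<^sup>2 * lik a x - 2 * (d / p) * (w x * (Y k x - a k) * lik a x))
       + (d / p)\<^sup>2 * (w x * lik a x) \<partial>P0)"
    by (intro Bochner_Integration.integral_cong) (auto simp: power2_eq_square algebra_simps)
  also have "\<dots> = (\<integral>x. w x * (Y k x - a k)\<^sup>2 * lik a x \<partial>P0) - 2 * (d / p) * d + (d / p)\<^sup>2 * p"
    using i by (simp add: d_def dprob_of_def p_def prob_of_def)
  also have "\<dots> = (\<integral>x. w x * (Y k x - a k)\<^sup>2 * lik a x \<partial>P0) - d\<^sup>2 / p"
    using p by (simp add: power2_eq_square field_simps)
  finally show ?thesis using p by (simp add: field_simps d_def[symmetric] p_def[symmetric])
qed

lemma fourth_moment_le: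
  assumes k: "k \<in> I"
  shows "(\<integral>x. (Y k x - a k) ^ 4 * lik a x \<partial>P0) \<le> 96"
proof -
  have "(\<integral>x. (Y k x - a k) ^ 4 * lik a x \<partial>P0)
     \<le> (\<integral>x. fact 4 * exp (1/2) * (lik (a(k := a k + 1)) x + lik (a(k := a k - 1)) x) \<partial>P0)"
  proof (rule integral_mono)
    show "integrable P0 (\<lambda>x. (Y k x - a k) ^ 4 * lik a x)"
      using integrable_weight_score[OF _ k, of "\<lambda>_. 1" a 4] by (simp add: weight_def)
    show "integrable P0 (\<lambda>x. fact 4 * exp (1/2) * (lik (a(k := a k + 1)) x + lik (a(k := a k - 1)) x))"
      by (intro integrable_mult_right Bochner_Integration.integrable_add integrable_lik)
    show "(Y k x - a k) ^ 4 * lik a x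
      \<le> fact 4 * exp (1/2) * (lik (a(k := a k + 1)) x + lik (a(k := a k - 1)) x)" for x
      using score_power_le[OF k, of x a 4] by (simp only: power_even_abs even_numeral)
  qed
  also have "\<dots> = 48 * exp (1/2)"
    by (subst integral_mult_right_zero, subst Bochner_Integration.integral_add[OF integrable_lik integrable_lik])
       (simp add: integral_lik fact_numeral)
  also have "exp (1/2 :: real) \<le> 2"
  proof -
    have "exp (1/2 :: real) ^ 2 \<le> 2 ^ 2"
      using exp_le by (simp add: exp_of_nat_mult[symmetric] power2_eq_square exp_add[symmetric])
    then show ?thesis by (rule power2_le_imp_le) simp
  qed
  finally show ?thesis by simp
qed

text \<open>
  An event of probability \<open>p\<close> catches at most about \<open>card I * sqrt p\<close> of the squared length of the
  score, by Cauchy-Schwarz and the fourth moments.  The arithmetic-geometric mean form with a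
  free \<open>\<epsilon>\<close> is linear in \<open>p\<close> and can therefore be averaged over a prior.
\<close>

lemma weighted_energy_le:
  fixes \<epsilon> :: real
  assumes w: "weight w" and e: "\<epsilon> > 0" and d: "I \<noteq> {}"
  shows "(\<integral>x. w x * (\<Sum>k\<in>I. (Y k x - a k)\<^sup>2) * lik a x \<partial>P0)
     \<le> 48 * \<epsilon> * card I + card I / (2 * \<epsilon>) * prob_of w a"
proof -
  define n where "n = real (card I)"
  have n: "n > 0" using d finite_I by (simp add: n_def card_gt_0_iff)
  have i4: "integrable P0 (\<lambda>x. (Y k x - a k) ^ 4 * lik a x)" if "k \<in> I" for k
    using integrable_weight_score[OF _ that, of "\<lambda>_. 1" a 4] by (simp add: weight_def)
  have i2: "integrable P0 (\<lambda>x. w x * (Y k x - a k)\<^sup>2 * lik a x)" if "k \<in> I" for k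
    using integrable_weight_score[OF w that, of a 2] by simp
  have "(\<integral>x. w x * (\<Sum>k\<in>I. (Y k x - a k)\<^sup>2) * lik a x \<partial>P0)
    \<le> (\<integral>x. \<epsilon> / 2 * (\<Sum>k\<in>I. (Y k x - a k) ^ 4 * lik a x) + n / (2 * \<epsilon>) * (w x * lik a x) \<partial>P0)"
  proof (rule integral_mono)
    show "integrable P0 (\<lambda>x. w x * (\<Sum>k\<in>I. (Y k x - a k)\<^sup>2) * lik a x)"
      using i2 unfolding sum_distrib_left sum_distrib_right by auto
    show "integrable P0 (\<lambda>x. \<epsilon> / 2 * (\<Sum>k\<in>I. (Y k x - a k) ^ 4 * lik a x) + n / (2 * \<epsilon>) * (w x * lik a x))"
      by (intro integrable_mult_right Bochner_Integration.integrable_add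
          Bochner_Integration.integrable_sum i4 integrable_weight_lik w)
    fix x
    have pt: "w x * y\<^sup>2 \<le> \<epsilon> / 2 * y ^ 4 + 1 / (2 * \<epsilon>) * w x" for y :: real
    proof -
      have w01: "w x \<ge> 0" "w x \<le> 1" using w by auto
      have "w x * w x \<le> w x * 1" using w01 by (intro mult_left_mono) auto
      moreover have "0 \<le> (\<epsilon> * y\<^sup>2 - w x)\<^sup>2" by simp
      then have "2 * \<epsilon> * (w x * y\<^sup>2) \<le> \<epsilon>\<^sup>2 * y ^ 4 + w x * w x"
        by (simp add: power2_eq_square power4_eq_xxxx algebra_simps)
      ultimately have "2 * \<epsilon> * (w x * y\<^sup>2) \<le> \<epsilon>\<^sup>2 * y ^ 4 + w x" by simp
      then have "w x * y\<^sup>2 \<le> (\<epsilon>\<^sup>2 * y ^ 4 + w x) / (2 * \<epsilon>)" using e by (simp add: field_simps)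
      also have "\<dots> = \<epsilon> / 2 * y ^ 4 + 1 / (2 * \<epsilon>) * w x" using e by (simp add: field_simps power2_eq_square)
      finally show ?thesis .
    qed
    have "w x * (\<Sum>k\<in>I. (Y k x - a k)\<^sup>2) = (\<Sum>k\<in>I. w x * (Y k x - a k)\<^sup>2)"
      by (simp add: sum_distrib_left)
    also have "\<dots> \<le> (\<Sum>k\<in>I. \<epsilon> / 2 * (Y k x - a k) ^ 4 + 1 / (2 * \<epsilon>) * w x)"
      by (intro sum_mono pt)
    also have "\<dots> = \<epsilon> / 2 * (\<Sum>k\<in>I. (Y k x - a k) ^ 4) + n / (2 * \<epsilon>) * w x"
      by (simp add: sum.distrib sum_distrib_left n_def)
    finally have "w x * (\<Sum>k\<in>I. (Y k x - a k)\<^sup>2) * lik a x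
       \<le> (\<epsilon> / 2 * (\<Sum>k\<in>I. (Y k x - a k) ^ 4) + n / (2 * \<epsilon>) * w x) * lik a x"
      by (intro mult_right_mono) auto
    then show "w x * (\<Sum>k\<in>I. (Y k x - a k)\<^sup>2) * lik a x
      \<le> \<epsilon> / 2 * (\<Sum>k\<in>I. (Y k x - a k) ^ 4 * lik a x) + n / (2 * \<epsilon>) * (w x * lik a x)"
      unfolding sum_distrib_right[symmetric] by (simp only: distrib_right mult.assoc)
  qed
  also have "\<dots> = \<epsilon> / 2 * (\<Sum>k\<in>I. \<integral>x. (Y k x - a k) ^ 4 * lik a x \<partial>P0) + n / (2 * \<epsilon>) * prob_of w a"
    using i4 by (subst Bochner_Integration.integral_add)
      (auto simp: prob_of_def intro!: integrable_weight_lik w)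
  also have "\<dots> \<le> \<epsilon> / 2 * (\<Sum>k\<in>I. 96) + n / (2 * \<epsilon>) * prob_of w a"
    using e by (intro add_right_mono mult_left_mono sum_mono fourth_moment_le) auto
  finally show ?thesis by (simp add: n_def)
qed

end

section \<open>Fisher information of a transcript\<close>

context gaussian_experiment begin

lemma weight_1: "weight (\<lambda>_. 1)"
  by (simp add: weight_def)

lemma prob_of_1: "prob_of (\<lambda>_. 1) a = 1"
  by (simp add: prob_of_def integral_lik)

text \<open>
  The score has mean zero since the total probability is constant in the parameter.
\<close>

lemma dprob_of_1:
  assumes "k \<in> I" shows "dprob_of (\<lambda>_. 1) a k = 0"
proof -
  have "((\<lambda>t. prob_of (\<lambda>_. 1) (a(k := t))) has_real_derivative
      dprob_of (\<lambda>_. 1) (a(k := a k)) k) (at (a k))"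
    by (rule prob_of_has_derivative(1)[OF weight_1 assms])
  then have "((\<lambda>t. 1 :: real) has_real_derivative dprob_of (\<lambda>_. 1) a k) (at (a k))"
    by (simp add: prob_of_1)
  then show ?thesis by (rule DERIV_unique) simp
qed

lemma ennreal_prob_of:
  assumes "weight w"
  shows "ennreal (prob_of w a) = (\<integral>\<^sup>+x. ennreal (w x * lik a x) \<partial>P0)"
  unfolding prob_of_def
  by (rule nn_integral_eq_integral[symmetric])
     (use assms in \<open>auto intro!: integrable_weight_lik simp: weight_def\<close>)

definition kernel :: "('x \<Rightarrow> 'z :: countable pmf) \<Rightarrow> bool" where
  "kernel \<kappa> \<longleftrightarrow> (\<lambda>x. measure_pmf (\<kappa> x)) \<in> P0 \<rightarrow>\<^sub>M subprob_algebra (count_space UNIV)"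

lemma kernel_emeasure_measurable:
  "kernel \<kappa> \<Longrightarrow> (\<lambda>x. emeasure (measure_pmf (\<kappa> x)) A) \<in> borel_measurable P0"
  unfolding kernel_def by (rule measurable_emeasure_kernel) auto

lemma weight_event: "kernel \<kappa> \<Longrightarrow> weight (\<lambda>x. measure_pmf.prob (\<kappa> x) A)"
  using kernel_emeasure_measurable[of \<kappa> A]
  by (auto simp: weight_def measure_def intro!: borel_measurable_enn2real)
     (metis measure_def measure_pmf.prob_le_1)

lemma weight_pmf: "kernel \<kappa> \<Longrightarrow> weight (\<lambda>x. pmf (\<kappa> x) z)"
  using weight_event[of \<kappa> "{z}"] by (simp add: measure_pmf_single)

lemma sum_over_outcomes:
  assumes \<kappa>: "kernel \<kappa>" and [measurable]: "h \<in> borel_measurable P0"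
  shows "(\<integral>\<^sup>+z. (\<integral>\<^sup>+x. ennreal (pmf (\<kappa> x) z) * h x \<partial>P0) \<partial>count_space A)
       = (\<integral>\<^sup>+x. emeasure (measure_pmf (\<kappa> x)) A * h x \<partial>P0)"
proof -
  have [measurable]: "(\<lambda>x. pmf (\<kappa> x) z) \<in> borel_measurable P0" for z
    using weight_pmf[OF \<kappa>] by auto
  have "(\<integral>\<^sup>+z. (\<integral>\<^sup>+x. ennreal (pmf (\<kappa> x) z) * h x \<partial>P0) \<partial>count_space A)
      = (\<integral>\<^sup>+x. (\<integral>\<^sup>+z. ennreal (pmf (\<kappa> x) z) * h x \<partial>count_space A) \<partial>P0)"
    by (rule nn_integral_count_space_nn_integral[symmetric]) auto
  also have "\<dots> = (\<integral>\<^sup>+x. emeasure (measure_pmf (\<kappa> x)) A * h x \<partial>P0)"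
    by (intro nn_integral_cong) (simp add: nn_integral_multc nn_integral_pmf)
  finally show ?thesis .
qed

lemma nn_integral_prob_of_outcomes:
  assumes \<kappa>: "kernel \<kappa>"
  shows "(\<integral>\<^sup>+z. ennreal (prob_of (\<lambda>x. pmf (\<kappa> x) z) a) \<partial>count_space A)
       = ennreal (prob_of (\<lambda>x. measure_pmf.prob (\<kappa> x) A) a)"
  unfolding ennreal_prob_of[OF weight_pmf[OF \<kappa>]] ennreal_prob_of[OF weight_event[OF \<kappa>]]
  using sum_over_outcomes[OF \<kappa>, of "\<lambda>x. ennreal (lik a x)" A]
  by (simp add: ennreal_mult' measure_pmf.emeasure_eq_measure)

text \<open>
  The distribution of a transcript when the data are integrated out; by
  \<open>nn_integral_prob_of_outcomes\<close> the masses add up to 1.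
\<close>

definition law :: "('x \<Rightarrow> 'z :: countable pmf) \<Rightarrow> ('k \<Rightarrow> real) \<Rightarrow> 'z pmf" where
  "law \<kappa> a = embed_pmf (\<lambda>z. prob_of (\<lambda>x. pmf (\<kappa> x) z) a)"

lemma pmf_law: "kernel \<kappa> \<Longrightarrow> pmf (law \<kappa> a) z = prob_of (\<lambda>x. pmf (\<kappa> x) z) a"
  unfolding law_def
  by (rule pmf_embed_pmf)
     (auto intro!: prob_of_nonneg weight_pmf simp: nn_integral_prob_of_outcomes prob_of_1)

lemma prob_law: "kernel \<kappa> \<Longrightarrow> measure_pmf.prob (law \<kappa> a) A = prob_of (\<lambda>x. measure_pmf.prob (\<kappa> x) A) a"
  using nn_integral_prob_of_outcomes[where \<kappa>=\<kappa> and a=a and A=A] nn_integral_pmf[where p="law \<kappa> a" and A=A]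
    prob_of_nonneg[OF weight_event, of \<kappa> A a]
  by (simp add: pmf_law measure_pmf.emeasure_eq_measure)

text \<open>
  The derivative of the log-probability of \<open>z\<close> in the direction \<open>k\<close>.  For a \<open>z\<close> of probability zero
  the value is 0 by convention, and the product rule \<open>pmf_law_score\<close> still holds.
\<close>

definition score :: "('x \<Rightarrow> 'z :: countable pmf) \<Rightarrow> ('k \<Rightarrow> real) \<Rightarrow> 'k \<Rightarrow> 'z \<Rightarrow> real" where
  "score \<kappa> a k z = dprob_of (\<lambda>x. pmf (\<kappa> x) z) a k / pmf (law \<kappa> a) z"

lemma pmf_law_score:
  assumes \<kappa>: "kernel \<kappa>"
  shows "pmf (law \<kappa> a) z * score \<kappa> a k z = dprob_of (\<lambda>x. pmf (\<kappa> x) z) a k"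
  using dprob_of_eq_0[OF weight_pmf[OF \<kappa>], of z a k]
  by (auto simp: score_def pmf_law[OF \<kappa>])

lemma integrable_weight_energy:
  assumes w: "weight w"
  shows "integrable P0 (\<lambda>x. w x * (\<Sum>k\<in>I. (Y k x - a k)\<^sup>2) * lik a x)"
  unfolding sum_distrib_left sum_distrib_right
  using integrable_weight_score[OF w, of _ a 2] by auto

text \<open>
  Compressing the data to a transcript can only decrease Fisher information, also on a part
  \<open>A\<close> of the possible transcripts.
\<close>

lemma score_energy_on_le:
  assumes \<kappa>: "kernel \<kappa>"
  shows "(\<integral>\<^sup>+z. ennreal (pmf (law \<kappa> a) z * (\<Sum>k\<in>I. (score \<kappa> a k z)\<^sup>2)) \<partial>count_space A)
       \<le> ennreal (\<integral>x. measure_pmf.prob (\<kappa> x) A * (\<Sum>k\<in>I. (Y k x - a k)\<^sup>2) * lik a x \<partial>P0)"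
proof -
  let ?w = "\<lambda>z x. pmf (\<kappa> x) z"
  let ?h = "\<lambda>x. (\<Sum>k\<in>I. (Y k x - a k)\<^sup>2) * lik a x"
  have h: "?h x \<ge> 0" for x by (intro mult_nonneg_nonneg sum_nonneg) auto
  have pt: "pmf (law \<kappa> a) z * (\<Sum>k\<in>I. (score \<kappa> a k z)\<^sup>2) \<le> (\<integral>x. ?w z x * (\<Sum>k\<in>I. (Y k x - a k)\<^sup>2) * lik a x \<partial>P0)" for z
  proof -
    have le: "pmf (law \<kappa> a) z * (score \<kappa> a k z)\<^sup>2 \<le> (\<integral>x. ?w z x * (Y k x - a k)\<^sup>2 * lik a x \<partial>P0)" if k: "k \<in> I" for k
    proof (cases "pmf (law \<kappa> a) z = 0")
      case True
      then show ?thesis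
        by (auto intro!: Bochner_Integration.integral_nonneg mult_nonneg_nonneg)
    next
      case False
      then have p: "pmf (law \<kappa> a) z > 0" by (simp add: pmf_pos)
      have "pmf (law \<kappa> a) z * (pmf (law \<kappa> a) z * (score \<kappa> a k z)\<^sup>2) = (dprob_of (?w z) a k)\<^sup>2"
        by (simp add: pmf_law_score[OF \<kappa>, symmetric] power2_eq_square mult_ac)
      also have "\<dots> \<le> pmf (law \<kappa> a) z * (\<integral>x. ?w z x * (Y k x - a k)\<^sup>2 * lik a x \<partial>P0)"
        using dprob_of_sq_le[OF weight_pmf[OF \<kappa>] k] by (simp add: pmf_law[OF \<kappa>])
      finally show ?thesis using p by simp
    qed
    have "pmf (law \<kappa> a) z * (\<Sum>k\<in>I. (score \<kappa> a k z)\<^sup>2) \<le> (\<Sum>k\<in>I. \<integral>x. ?w z x * (Y k x - a k)\<^sup>2 * lik a x \<partial>P0)"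
      unfolding sum_distrib_left by (intro sum_mono le)
    also have "\<dots> = (\<integral>x. ?w z x * (\<Sum>k\<in>I. (Y k x - a k)\<^sup>2) * lik a x \<partial>P0)"
      unfolding sum_distrib_left sum_distrib_right
      using integrable_weight_score[OF weight_pmf[OF \<kappa>], of _ z a 2]
      by (subst Bochner_Integration.integral_sum) auto
    finally show ?thesis .
  qed
  have int: "ennreal (\<integral>x. w x * (\<Sum>k\<in>I. (Y k x - a k)\<^sup>2) * lik a x \<partial>P0)
     = (\<integral>\<^sup>+x. ennreal (w x) * ennreal (?h x) \<partial>P0)" if w: "weight w" for w
  proof -
    have "ennreal (\<integral>x. w x * (\<Sum>k\<in>I. (Y k x - a k)\<^sup>2) * lik a x \<partial>P0)
      = (\<integral>\<^sup>+x. ennreal (w x * (\<Sum>k\<in>I. (Y k x - a k)\<^sup>2) * lik a x) \<partial>P0)"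
      using w by (intro nn_integral_eq_integral[symmetric] integrable_weight_energy)
        (auto intro!: mult_nonneg_nonneg sum_nonneg)
    also have "\<dots> = (\<integral>\<^sup>+x. ennreal (w x) * ennreal (?h x) \<partial>P0)"
      using w h by (intro nn_integral_cong) (auto simp: ennreal_mult[symmetric] weight_def mult.assoc)
    finally show ?thesis .
  qed
  have "(\<integral>\<^sup>+z. ennreal (pmf (law \<kappa> a) z * (\<Sum>k\<in>I. (score \<kappa> a k z)\<^sup>2)) \<partial>count_space A)
     \<le> (\<integral>\<^sup>+z. ennreal (\<integral>x. ?w z x * (\<Sum>k\<in>I. (Y k x - a k)\<^sup>2) * lik a x \<partial>P0) \<partial>count_space A)"
    by (intro nn_integral_mono ennreal_leI pt)
  also have "\<dots> = (\<integral>\<^sup>+z. (\<integral>\<^sup>+x. ennreal (?w z x) * ennreal (?h x) \<partial>P0) \<partial>count_space A)"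
    by (intro nn_integral_cong int weight_pmf \<kappa>)
  also have "\<dots> = (\<integral>\<^sup>+x. emeasure (measure_pmf (\<kappa> x)) A * ennreal (?h x) \<partial>P0)"
    by (rule sum_over_outcomes[OF \<kappa>]) measurable
  also have "\<dots> = ennreal (\<integral>x. measure_pmf.prob (\<kappa> x) A * (\<Sum>k\<in>I. (Y k x - a k)\<^sup>2) * lik a x \<partial>P0)"
    by (subst int[OF weight_event[OF \<kappa>]]) (simp add: measure_pmf.emeasure_eq_measure)
  finally show ?thesis .
qed

lemma score_sq_integrable:
  assumes \<kappa>: "kernel \<kappa>" and k: "k \<in> I"
  shows "integrable (measure_pmf (law \<kappa> a)) (\<lambda>z. (score \<kappa> a k z)\<^sup>2)"
proof (rule integrableI_bounded)
  have "(\<integral>\<^sup>+z. ennreal (norm ((score \<kappa> a k z)\<^sup>2)) \<partial>measure_pmf (law \<kappa> a))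
     = (\<integral>\<^sup>+z. ennreal (pmf (law \<kappa> a) z * (score \<kappa> a k z)\<^sup>2) \<partial>count_space UNIV)"
    by (simp add: nn_integral_measure_pmf ennreal_mult')
  also have "\<dots> \<le> (\<integral>\<^sup>+z. ennreal (pmf (law \<kappa> a) z * (\<Sum>k\<in>I. (score \<kappa> a k z)\<^sup>2)) \<partial>count_space UNIV)"
    using k finite_I by (intro nn_integral_mono ennreal_leI mult_left_mono member_le_sum) auto
  also have "\<dots> < \<infinity>"
    using score_energy_on_le[OF \<kappa>, where a=a and A=UNIV] by (rule order_le_less_trans) simp
  finally show "(\<integral>\<^sup>+z. ennreal (norm ((score \<kappa> a k z)\<^sup>2)) \<partial>measure_pmf (law \<kappa> a)) < \<infinity>" .
qed simp

text \<open>
  Summation over transcripts and integration over data are exchanged; what remains is the mean of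
  the score of the data.
\<close>

lemma expectation_score:
  fixes \<kappa> :: "'x \<Rightarrow> 'z :: countable pmf"
  assumes \<kappa>: "kernel \<kappa>" and k: "k \<in> I"
  shows "measure_pmf.expectation (law \<kappa> a) (score \<kappa> a k) = 0"
proof -
  have [measurable]: "(\<lambda>x. pmf (\<kappa> x) z) \<in> borel_measurable P0" for z
    using weight_pmf[OF \<kappa>] by auto
  have [measurable]: "Y k \<in> borel_measurable P0" using k by simp
  let ?C = "count_space (UNIV :: 'z set)"
  let ?f = "\<lambda>z x. pmf (\<kappa> x) z * (Y k x - a k) * lik a x"
  interpret pair_sigma_finite ?C P0
    by (auto simp: pair_sigma_finite_def sigma_finite_measure_count_space
        intro: prob_space_imp_sigma_finite prob_space_axioms)
  have meas [measurable]: "case_prod ?f \<in> borel_measurable (?C \<Otimes>\<^sub>M P0)"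
    by (rule measurable_pair_measure_countable1) auto
  have abs_int: "integrable P0 (\<lambda>x. \<bar>Y k x - a k\<bar> * lik a x)"
    using integrable_norm[OF integrable_weight_score[OF weight_1 k, of a 1]] by (simp add: abs_mult)
  have int: "integrable (?C \<Otimes>\<^sub>M P0) (case_prod ?f)"
  proof (rule integrableI_bounded[OF meas])
    have "(\<integral>\<^sup>+y. ennreal (norm (case y of (z, x) \<Rightarrow> ?f z x)) \<partial>(?C \<Otimes>\<^sub>M P0))
        = (\<integral>\<^sup>+z. (\<integral>\<^sup>+x. ennreal (norm (?f z x)) \<partial>P0) \<partial>?C)"
      using sigma_finite_measure.nn_integral_fst[OF prob_space_imp_sigma_finite[OF prob_space_axioms],
          of "\<lambda>y. ennreal (norm (case_prod ?f y))" ?C] by simp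
    also have "\<dots> = (\<integral>\<^sup>+z. (\<integral>\<^sup>+x. ennreal (pmf (\<kappa> x) z) * ennreal (\<bar>Y k x - a k\<bar> * lik a x) \<partial>P0) \<partial>?C)"
      by (intro nn_integral_cong) (simp add: abs_mult ennreal_mult mult.assoc)
    also have "\<dots> = (\<integral>\<^sup>+x. emeasure (measure_pmf (\<kappa> x)) UNIV * ennreal (\<bar>Y k x - a k\<bar> * lik a x) \<partial>P0)"
      by (rule sum_over_outcomes[OF \<kappa>]) measurable
    also have "\<dots> < \<infinity>"
      using abs_int by (simp add: integrable_iff_bounded abs_mult)
    finally show "(\<integral>\<^sup>+y. ennreal (norm (case y of (z, x) \<Rightarrow> ?f z x)) \<partial>(?C \<Otimes>\<^sub>M P0)) < \<infinity>" .
  qed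
  have "measure_pmf.expectation (law \<kappa> a) (score \<kappa> a k) = (\<integral>z. pmf (law \<kappa> a) z * score \<kappa> a k z \<partial>?C)"
    by (simp add: measure_pmf_eq_density integral_density)
  also have "\<dots> = (\<integral>z. (\<integral>x. ?f z x \<partial>P0) \<partial>?C)"
    by (simp add: pmf_law_score[OF \<kappa>] dprob_of_def)
  also have "\<dots> = (\<integral>x. (\<integral>z. ?f z x \<partial>?C) \<partial>P0)"
    by (rule Fubini_integral[OF int, symmetric])
  also have "\<dots> = (\<integral>x. 1 * (Y k x - a k) * lik a x \<partial>P0)"
  proof (intro Bochner_Integration.integral_cong refl)
    fix x
    have "(\<integral>z. pmf (\<kappa> x) z \<partial>?C) = 1"
      by (simp add: integral_pmf)
    then show "(\<integral>z. ?f z x \<partial>?C) = 1 * (Y k x - a k) * lik a x"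
      by (simp add: mult.assoc)
  qed
  also have "\<dots> = 0" using dprob_of_1[OF k, of a] by (simp add: dprob_of_def)
  finally show ?thesis .
qed

end

text \<open>
  There are \<open>2 ^ n\<close> strings of length \<open>n\<close>, so \<open>4 ^ (- length z)\<close> is a summable weight on strings.
  In \<open>entropy_term_le\<close> it is compared with the law of a transcript, as in Gibbs' inequality.
\<close>

lemma sum_codewords_quarter:
  "(\<integral>\<^sup>+z. ennreal ((1/4) ^ length z) \<partial>count_space (UNIV :: bool list set)) = 2"
proof -
  have "(\<integral>\<^sup>+z. ennreal ((1/4) ^ length z) \<partial>count_space (UNIV :: bool list set))
     = (\<integral>\<^sup>+z. (\<integral>\<^sup>+n. ennreal ((1/4) ^ n) * indicator {z. length z = n} z \<partial>count_space UNIV) \<partial>count_space (UNIV :: bool list set))"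
  proof (intro nn_integral_cong)
    fix z :: "bool list"
    have "(\<integral>\<^sup>+n. ennreal ((1/4) ^ n) * indicator {z. length z = n} z \<partial>count_space UNIV)
       = (\<integral>\<^sup>+n. ennreal ((1/4) ^ n) * indicator {length z} n \<partial>count_space UNIV)"
      by (intro nn_integral_cong) (auto simp: indicator_def)
    also have "\<dots> = ennreal ((1/4) ^ length z)"
      by (subst nn_integral_indicator_singleton) auto
    finally show "ennreal ((1/4) ^ length z) = (\<integral>\<^sup>+n. ennreal ((1/4) ^ n) * indicator {z. length z = n} z \<partial>count_space UNIV)" ..
  qed
  also have "\<dots> = (\<integral>\<^sup>+n. (\<integral>\<^sup>+z. ennreal ((1/4) ^ n) * indicator {z. length z = n} z \<partial>count_space (UNIV :: bool list set)) \<partial>count_space UNIV)"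
    by (rule nn_integral_count_space_nn_integral) auto
  also have "\<dots> = (\<integral>\<^sup>+n. ennreal ((1/2) ^ n) \<partial>count_space UNIV)"
  proof (intro nn_integral_cong)
    fix n :: nat
    have card: "card {z :: bool list. length z = n} = 2 ^ n" and fin: "finite {z :: bool list. length z = n}"
      using card_lists_length_eq[of "UNIV :: bool set" n] finite_lists_length_eq[of "UNIV :: bool set" n]
      by (simp_all add: UNIV_bool[symmetric])
    have "(\<integral>\<^sup>+z. ennreal ((1/4) ^ n) * indicator {z. length z = n} z \<partial>count_space (UNIV :: bool list set))
       = ennreal ((1/4) ^ n) * of_nat (2 ^ n)"
      using fin by (subst nn_integral_cmult_indicator) (auto simp: emeasure_count_space card)
    also have "\<dots> = ennreal ((1/2) ^ n)"
      by (simp add: ennreal_of_nat_eq_real_of_nat ennreal_mult[symmetric] power_mult_distrib[symmetric])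
    finally show "(\<integral>\<^sup>+z. ennreal ((1/4) ^ n) * indicator {z. length z = n} z \<partial>count_space (UNIV :: bool list set))
       = ennreal ((1/2) ^ n)" .
  qed
  also have "\<dots> = (\<Sum>n. ennreal ((1/2) ^ n))"
    by (rule nn_integral_count_space_nat)
  also have "\<dots> = ennreal (\<Sum>n. (1/2) ^ n)"
    by (rule suminf_ennreal2) auto
  also have "\<dots> = 2" by (simp add: suminf_geometric)
  finally show ?thesis .
qed

lemma entropy_term_le:
  fixes p :: real
  assumes p: "p \<ge> 0"
  shows "p * ln (1 / p) \<le> n * ln 4 * p + (1/4) ^ n"
proof (cases "p = 0")
  case False
  with p have p: "p > 0" by simp
  have "ln ((1/4) ^ n / p) \<le> (1/4) ^ n / p - 1"
    using p by (intro ln_le_minus_one) auto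
  then have "p * ln ((1/4) ^ n / p) \<le> p * ((1/4) ^ n / p - 1)"
    using p by (intro mult_left_mono) auto
  also have "\<dots> \<le> (1/4) ^ n" using p by (simp add: algebra_simps)
  also have "ln ((1/4) ^ n / p) = ln (1 / p) - n * ln 4"
    using p by (simp add: ln_div ln_realpow)
  finally show ?thesis by (simp add: algebra_simps)
qed auto

context gaussian_experiment begin

text \<open>
  Strings of length at most \<open>t\<close> contribute at most a multiple of their entropy, hence \<open>O(t + 1)\<close>.
  The remaining strings are treated as if the whole data were known on them.
\<close>

lemma fisher_information_le:
  fixes \<kappa> :: "'x \<Rightarrow> bool list pmf" and t \<epsilon> :: real
  assumes \<kappa>: "kernel \<kappa>" and t: "t \<ge> 0" and e: "\<epsilon> > 0" and I: "I \<noteq> {}"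
  shows "(\<integral>\<^sup>+z. ennreal (\<Sum>k\<in>I. (score \<kappa> a k z)\<^sup>2) \<partial>measure_pmf (law \<kappa> a))
      \<le> ennreal (4 * t + 4 + 48 * \<epsilon> * card I
           + card I / (2 * \<epsilon>) * measure_pmf.prob (law \<kappa> a) {z. real (length z) > t})"
proof -
  let ?A = "{z :: bool list. real (length z) > t}"
  let ?p = "pmf (law \<kappa> a)"
  let ?g = "\<lambda>z. ?p z * (\<Sum>k\<in>I. (score \<kappa> a k z)\<^sup>2)"
  have ln4: "ln 4 \<le> (2 :: real)"
    using ln_le_minus_one[of "2 :: real"] ln_mult[of 2 "2 :: real"] by simp
  have short: "ennreal (?g z) \<le> ennreal (4 * t) * ennreal (?p z) + 2 * ennreal ((1/4) ^ length z)"
    if z: "z \<notin> ?A" for z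
  proof -
    have g: "?g z \<le> 2 * (?p z * ln (1 / ?p z))"
    proof (cases "?p z = 0")
      case False
      then have p: "?p z > 0" by (simp add: pmf_pos)
      have "?p z * ?g z = (\<Sum>k\<in>I. (dprob_of (\<lambda>x. pmf (\<kappa> x) z) a k)\<^sup>2)"
        by (simp add: pmf_law_score[OF \<kappa>, symmetric] power_mult_distrib sum_distrib_left power2_eq_square mult_ac)
      also have "\<dots> \<le> ?p z * (2 * (?p z * ln (1 / ?p z)))"
        using sum_dprob_of_le_entropy[OF weight_pmf[OF \<kappa>, of z], of a]
        by (simp add: pmf_law[OF \<kappa>] power2_eq_square mult_ac)
      finally show ?thesis using p by (simp only: mult_le_cancel_left_pos)
    qed auto
    also have "\<dots> \<le> 2 * (length z * ln 4 * ?p z + (1/4) ^ length z)"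
      by (intro mult_left_mono entropy_term_le) auto
    also have "\<dots> \<le> 2 * (t * 2 * ?p z + (1/4) ^ length z)"
      using z ln4 t by (intro mult_left_mono add_right_mono mult_right_mono mult_mono) auto
    finally have "?g z \<le> 4 * t * ?p z + 2 * (1/4) ^ length z" by simp
    then have "ennreal (?g z) \<le> ennreal (4 * t * ?p z + 2 * (1/4) ^ length z)" by (rule ennreal_leI)
    also have "\<dots> = ennreal (4 * t) * ennreal (?p z) + 2 * ennreal ((1/4) ^ length z)"
      using t by (simp add: ennreal_plus ennreal_mult)
    finally show ?thesis .
  qed
  have "(\<integral>\<^sup>+z. ennreal (\<Sum>k\<in>I. (score \<kappa> a k z)\<^sup>2) \<partial>measure_pmf (law \<kappa> a))
     = (\<integral>\<^sup>+z. ennreal (?g z) \<partial>count_space UNIV)"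
    by (simp add: nn_integral_measure_pmf ennreal_mult')
  also have "\<dots> \<le> (\<integral>\<^sup>+z. (ennreal (4 * t) * ennreal (?p z) + 2 * ennreal ((1/4) ^ length z))
      + ennreal (?g z) * indicator ?A z \<partial>count_space UNIV)"
    using short by (intro nn_integral_mono) (auto simp: indicator_def)
  also have "\<dots> = ennreal (4 * t) + 4 + (\<integral>\<^sup>+z. ennreal (?g z) \<partial>count_space ?A)"
    by (simp add: nn_integral_add nn_integral_cmult nn_integral_pmf sum_codewords_quarter
        nn_integral_count_space_indicator[symmetric])
  also have "\<dots> \<le> ennreal (4 * t) + 4 + ennreal (48 * \<epsilon> * card I
           + card I / (2 * \<epsilon>) * measure_pmf.prob (law \<kappa> a) ?A)"
    unfolding prob_law[OF \<kappa>]
    by (intro add_left_mono order_trans[OF score_energy_on_le[OF \<kappa>]] ennreal_leI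
        weighted_energy_le weight_event \<kappa> e I)
  also have "\<dots> = ennreal (4 * t + 4 + 48 * \<epsilon> * card I
           + card I / (2 * \<epsilon>) * measure_pmf.prob (law \<kappa> a) ?A)"
  proof -
    have "ennreal (4 * t) + 4 = ennreal (4 * t + 4)" using t by (simp add: ennreal_plus)
    then show ?thesis
      using t e by (simp only:) (subst ennreal_plus[symmetric], auto simp: add.assoc)
  qed
  finally show ?thesis .
qed

end

section \<open>A smooth prior and the van Trees inequality\<close>

text \<open>
  A probability density on \<open>[- \<beta>, \<beta>]\<close> that vanishes at the end points together with its derivative,
  so that integration by parts leaves no boundary terms and the Fisher information is finite.
\<close>

definition bump :: "real \<Rightarrow> real \<Rightarrow> real" where
  "bump \<beta> t = (if \<bar>t\<bar> \<le> \<beta> then 15 / (16 * \<beta>) * (1 - (t / \<beta>)\<^sup>2)\<^sup>2 else 0)"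

text \<open>
  The logarithmic derivative of \<open>bump \<beta>\<close> inside \<open>(- \<beta>, \<beta>)\<close>.
\<close>

definition bump_score :: "real \<Rightarrow> real \<Rightarrow> real" where
  "bump_score \<beta> t = - 4 * t / (\<beta>\<^sup>2 - t\<^sup>2)"

definition bump_prior :: "real \<Rightarrow> real measure" where
  "bump_prior \<beta> = density lborel (\<lambda>t. ennreal (bump \<beta> t))"

lemma bump_measurable [measurable]: "bump \<beta> \<in> borel_measurable borel"
  unfolding bump_def by measurable

lemma bump_score_measurable [measurable]: "bump_score \<beta> \<in> borel_measurable borel"
  unfolding bump_score_def by measurable

lemma sets_bump_prior [simp, measurable_cong]: "sets (bump_prior \<beta>) = sets borel"
  and space_bump_prior [simp]: "space (bump_prior \<beta>) = UNIV"
  by (simp_all add: bump_prior_def)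

lemma bump_nonneg: "\<beta> > 0 \<Longrightarrow> bump \<beta> t \<ge> 0"
  by (simp add: bump_def)

lemma nn_integral_bump_prior:
  assumes \<beta>: "\<beta> > 0" and [measurable]: "f \<in> borel_measurable borel"
  shows "(\<integral>\<^sup>+t. f t \<partial>bump_prior \<beta>) = (\<integral>\<^sup>+t. ennreal (bump \<beta> t) * f t \<partial>lborel)"
  unfolding bump_prior_def by (subst nn_integral_density) auto

lemma prob_space_bump_prior:
  assumes \<beta>: "\<beta> > 0"
  shows "prob_space (bump_prior \<beta>)"
proof
  let ?B = "\<lambda>t. 15 / (16 * \<beta>) * (1 - (t / \<beta>)\<^sup>2)\<^sup>2"
  let ?F = "\<lambda>t. 15 / (16 * \<beta>) * (t - 2 * t ^ 3 / (3 * \<beta>\<^sup>2) + t ^ 5 / (5 * \<beta> ^ 4))"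
  have "emeasure (bump_prior \<beta>) (space (bump_prior \<beta>)) = (\<integral>\<^sup>+t. ennreal (bump \<beta> t) \<partial>lborel)"
    by (simp add: bump_prior_def emeasure_density)
  also have "\<dots> = (\<integral>\<^sup>+t. ennreal (?B t) * indicator {-\<beta>..\<beta>} t \<partial>lborel)"
    by (intro nn_integral_cong) (auto simp: bump_def indicator_def)
  also have "\<dots> = ?F \<beta> - ?F (- \<beta>)"
  proof (rule nn_integral_FTC_Icc)
    fix t
    show "(?F has_real_derivative ?B t) (at t)"
      using \<beta> by (auto intro!: derivative_eq_intros) (simp add: field_simps power2_eq_square power4_eq_xxxx power3_eq_cube eval_nat_numeral)
  qed (use \<beta> in auto)
  also have "?F \<beta> - ?F (- \<beta>) = 1"
    using \<beta> by (simp add: field_simps eval_nat_numeral)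
  finally show "emeasure (bump_prior \<beta>) (space (bump_prior \<beta>)) = 1" by simp
qed

lemma AE_bump_prior:
  assumes \<beta>: "\<beta> > 0"
  shows "AE t in bump_prior \<beta>. \<bar>t\<bar> \<le> \<beta>"
  unfolding bump_prior_def by (subst AE_density) (auto simp: bump_def)

lemma bump_score_sq: 
  assumes \<beta>: "\<beta> > 0" and t: "\<bar>t\<bar> < \<beta>"
  shows "bump \<beta> t * (bump_score \<beta> t)\<^sup>2 = 15 * t\<^sup>2 / \<beta> ^ 5"
proof -
  have "t\<^sup>2 < \<beta>\<^sup>2" using t \<beta> abs_le_square_iff[of \<beta> t] by auto
  then have "\<beta>\<^sup>2 - t\<^sup>2 > 0" by simp
  moreover have "bump \<beta> t = 15 / (16 * \<beta> ^ 5) * (\<beta>\<^sup>2 - t\<^sup>2)\<^sup>2"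
    using \<beta> t by (simp add: bump_def field_simps eval_nat_numeral)
  ultimately show ?thesis
    unfolding bump_score_def by (simp add: power_divide power_mult_distrib)
qed

lemma bump_prior_information:
  assumes \<beta>: "\<beta> > 0"
  shows "(\<integral>\<^sup>+t. ennreal ((bump_score \<beta> t)\<^sup>2) \<partial>bump_prior \<beta>) \<le> ennreal (10 / \<beta>\<^sup>2)"
proof -
  have "(\<integral>\<^sup>+t. ennreal ((bump_score \<beta> t)\<^sup>2) \<partial>bump_prior \<beta>)
      = (\<integral>\<^sup>+t. ennreal (bump \<beta> t) * ennreal ((bump_score \<beta> t)\<^sup>2) \<partial>lborel)"
    by (rule nn_integral_bump_prior[OF \<beta>]) auto
  also have "\<dots> \<le> (\<integral>\<^sup>+t. ennreal (15 * t\<^sup>2 / \<beta> ^ 5) * indicator {-\<beta>..\<beta>} t \<partial>lborel)"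
  proof (rule nn_integral_mono)
    fix t
    show "ennreal (bump \<beta> t) * ennreal ((bump_score \<beta> t)\<^sup>2) \<le> ennreal (15 * t\<^sup>2 / \<beta> ^ 5) * indicator {-\<beta>..\<beta>} t"
    proof (cases "\<bar>t\<bar> < \<beta>")
      case True
      then show ?thesis
        using bump_score_sq[OF \<beta> True] \<beta> by (simp add: ennreal_mult[symmetric] bump_nonneg indicator_def abs_if split: if_splits)
    next
      case False
      then have "bump \<beta> t = 0" using \<beta> by (auto simp: bump_def abs_if split: if_splits)
      then show ?thesis by simp
    qed
  qed
  also have "\<dots> = 5 * \<beta> ^ 3 / \<beta> ^ 5 - 5 * (- \<beta>) ^ 3 / \<beta> ^ 5"
    by (rule nn_integral_FTC_Icc)
      (use \<beta> in \<open>auto intro!: derivative_eq_intros simp: field_simps power_add[symmetric]\<close>)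
  also have "5 * \<beta> ^ 3 / \<beta> ^ 5 - 5 * (- \<beta>) ^ 3 / \<beta> ^ 5 = 10 / \<beta>\<^sup>2"
    using \<beta> by (simp add: field_simps eval_nat_numeral)
  finally show ?thesis .
qed

lemma product_sum_le_squares:
  fixes c x y z :: real
  assumes c: "c > 0"
  shows "x * (y + z) \<le> c / 2 * x\<^sup>2 + y\<^sup>2 / c + z\<^sup>2 / c"
proof -
  have "0 \<le> (c * x - (y + z))\<^sup>2 + (y - z)\<^sup>2" by simp
  also have "\<dots> = c\<^sup>2 * x\<^sup>2 - 2 * c * (x * (y + z)) + 2 * y\<^sup>2 + 2 * z\<^sup>2"
    by (simp add: power2_eq_square algebra_simps)
  also have "\<dots> = 2 * c * (c / 2 * x\<^sup>2 + y\<^sup>2 / c + z\<^sup>2 / c - x * (y + z))"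
    using c by (simp add: power2_eq_square field_simps)
  finally show ?thesis using c by (simp add: zero_le_mult_iff)
qed

text \<open>
  The van Trees inequality for one fixed transcript with probability \<open>p t\<close> under the parameter \<open>t\<close>.
  Integrating \<open>((t - T) * bump \<beta> t * p t)'\<close> over the interval gives 0, hence the integral of \<open>p\<close> under
  the prior is that of \<open>(T - t) * (bump_score \<beta> t + S t) * p t\<close>.  Bounding this product by squares instead
  of applying the Cauchy-Schwarz inequality yields a pointwise estimate with nonnegative terms,
  which can be summed over countably many transcripts in the extended reals.
\<close>

lemma van_trees_1d:
  fixes p p' S :: "real \<Rightarrow> real"
  assumes \<beta>: "\<beta> > 0" and c: "c > 0"
    and p: "\<And>t. p t \<ge> 0" and p': "\<And>t. (p has_real_derivative p' t) (at t)"
    and cont: "continuous_on UNIV p'" and S: "\<And>t. p' t = S t * p t"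
    and [measurable]: "S \<in> borel_measurable borel"
  shows "(\<integral>\<^sup>+t. ennreal (p t) \<partial>bump_prior \<beta>)
    \<le> (\<integral>\<^sup>+t. ennreal ((c / 2 * (T - t)\<^sup>2 + (bump_score \<beta> t)\<^sup>2 / c + (S t)\<^sup>2 / c) * p t) \<partial>bump_prior \<beta>)"
proof -
  let ?B = "\<lambda>t. 15 / (16 * \<beta>) * (1 - (t / \<beta>)\<^sup>2)\<^sup>2"
  let ?B' = "\<lambda>t. - 15 / (4 * \<beta> ^ 3) * t * (1 - (t / \<beta>)\<^sup>2)"
  let ?G = "\<lambda>t. (t - T) * (?B t * p t)"
  let ?G' = "\<lambda>t. ?B t * p t + (t - T) * (?B' t * p t + ?B t * p' t)"
  let ?I = "indicator {-\<beta>..\<beta>} :: real \<Rightarrow> real"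
  have contp: "continuous_on UNIV p"
    by (intro continuous_at_imp_continuous_on ballI DERIV_isCont[OF p'])
  have [measurable]: "p \<in> borel_measurable borel" "p' \<in> borel_measurable borel"
    using contp cont by (auto intro: borel_measurable_continuous_onI)
  have isc: "isCont p t" "isCont p' t" for t
    using contp cont by (auto simp: continuous_on_eq_continuous_at)
  have dB: "(?B has_real_derivative ?B' t) (at t)" for t
    using \<beta> by (auto intro!: derivative_eq_intros) (simp add: field_simps eval_nat_numeral)
  have dG: "(?G has_real_derivative ?G' t) (at t)" for t
    by (rule derivative_eq_intros dB p' refl)+ (simp add: algebra_simps)
  have G: "has_bochner_integral lborel (\<lambda>t. ?G' t * ?I t) (?G \<beta> - ?G (-\<beta>))"
    using \<beta> by (intro has_bochner_integral_FTC_Icc_real dG)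
      (auto intro!: continuous_intros isc)
  have "?G \<beta> - ?G (-\<beta>) = 0" using \<beta> by simp
  with G have intG: "integrable lborel (\<lambda>t. ?G' t * ?I t)" and G0: "(\<integral>t. ?G' t * ?I t \<partial>lborel) = 0"
    by (auto simp: has_bochner_integral_iff)
  have intB: "integrable lborel (\<lambda>t. (?B t * p t) * ?I t)"
    using \<beta> by (intro borel_integrable_atLeastAtMost) (auto intro!: continuous_intros isc)
  let ?R = "\<lambda>t. (c / 2 * (T - t)\<^sup>2 + (bump_score \<beta> t)\<^sup>2 / c + (S t)\<^sup>2 / c) * p t"
  have R: "?R t \<ge> 0" for t using c p by (intro mult_nonneg_nonneg add_nonneg_nonneg) auto
  have key: "(?B t * p t - ?G' t) * ?I t \<le> bump \<beta> t * ?R t" for t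
  proof (cases "\<bar>t\<bar> < \<beta>")
    case True
    then have b: "bump \<beta> t = ?B t" by (simp add: bump_def)
    have "t\<^sup>2 < \<beta>\<^sup>2" using True \<beta> abs_le_square_iff[of \<beta> t] by auto
    then have B': "?B' t = bump_score \<beta> t * ?B t"
      using \<beta> by (simp add: bump_score_def field_simps eval_nat_numeral)
    have alg: "b * q - (b * q + (t - T) * (s * b * q + b * (r * q))) = b * q * ((T - t) * (s + r))"
      for b q s r :: real
      by (simp add: algebra_simps)
    have eq: "?B t * p t - ?G' t = ?B t * p t * ((T - t) * (bump_score \<beta> t + S t))"
      unfolding B' S by (rule alg)
    let ?x = "T - t" and ?y = "bump_score \<beta> t" and ?z = "S t"
    have "?x * (?y + ?z) \<le> c / 2 * ?x\<^sup>2 + ?y\<^sup>2 / c + ?z\<^sup>2 / c"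
      by (rule product_sum_le_squares[OF c])
    then have "?B t * p t * (?x * (?y + ?z)) \<le> ?B t * p t * (c / 2 * ?x\<^sup>2 + ?y\<^sup>2 / c + ?z\<^sup>2 / c)"
      using \<beta> p by (intro mult_left_mono) auto
    then show ?thesis using True unfolding eq b by (simp add: mult_ac indicator_def abs_if split: if_splits)
  next
    case False
    then have "?I t = 0 \<or> \<bar>t\<bar> = \<beta>" by (auto simp: indicator_def)
    moreover have "\<bar>t\<bar> = \<beta> \<Longrightarrow> ?B t * p t - ?G' t = 0"
      using \<beta> by (auto simp: abs_if split: if_splits)
    ultimately have "(?B t * p t - ?G' t) * ?I t = 0" by auto
    then show ?thesis using R bump_nonneg[OF \<beta>] by (metis mult_nonneg_nonneg)
  qed
  have "integrable lborel (\<lambda>t. ?B t * p t * ?I t - ?G' t * ?I t)"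
    by (intro Bochner_Integration.integrable_diff intB intG)
  then have int: "integrable lborel (\<lambda>t. (?B t * p t - ?G' t) * ?I t)"
    by (simp only: left_diff_distrib)
  have int_max: "integrable lborel (\<lambda>t. max 0 ((?B t * p t - ?G' t) * ?I t))"
    by (intro integrable_max int) auto
  have "(\<integral>\<^sup>+t. ennreal (p t) \<partial>bump_prior \<beta>) = (\<integral>\<^sup>+t. ennreal (?B t * p t * ?I t) \<partial>lborel)"
    unfolding nn_integral_bump_prior[OF \<beta>, of "\<lambda>t. ennreal (p t)", simplified]
    by (intro nn_integral_cong) (use \<beta> p in \<open>auto simp: bump_def indicator_def ennreal_mult[symmetric]\<close>)
  also have "\<dots> = ennreal (\<integral>t. ?B t * p t * ?I t \<partial>lborel)"
    using \<beta> p by (intro nn_integral_eq_integral intB) auto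
  also have "(\<integral>t. ?B t * p t * ?I t \<partial>lborel) = (\<integral>t. ?B t * p t * ?I t - ?G' t * ?I t \<partial>lborel)"
    using intB intG G0 by (subst Bochner_Integration.integral_diff) auto
  also have "\<dots> = (\<integral>t. (?B t * p t - ?G' t) * ?I t \<partial>lborel)"
    by (intro Bochner_Integration.integral_cong) (auto simp: algebra_simps)
  also have "ennreal \<dots> \<le> ennreal (\<integral>t. max 0 ((?B t * p t - ?G' t) * ?I t) \<partial>lborel)"
    by (intro ennreal_leI integral_mono int int_max) auto
  also have "\<dots> = (\<integral>\<^sup>+t. ennreal (max 0 ((?B t * p t - ?G' t) * ?I t)) \<partial>lborel)"
    by (rule nn_integral_eq_integral[symmetric, OF int_max]) auto
  also have "\<dots> \<le> (\<integral>\<^sup>+t. ennreal (bump \<beta> t) * ennreal (?R t) \<partial>lborel)"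
    using key R bump_nonneg[OF \<beta>] by (intro nn_integral_mono) (simp add: ennreal_mult[symmetric] ennreal_leI)
  also have "\<dots> = (\<integral>\<^sup>+t. ennreal (?R t) \<partial>bump_prior \<beta>)"
    by (rule nn_integral_bump_prior[OF \<beta>, symmetric]) measurable
  finally show ?thesis .
qed

text \<open>
  The prior is symmetric, so the exponential may be replaced by a hyperbolic cosine and the
  term linear in \<open>u\<close> disappears.
\<close>

lemma symmetric_exp_bump_prior:
  assumes \<beta>: "\<beta> > 0" and u: "\<bar>u\<bar> \<le> \<beta>"
  shows "(\<integral>\<^sup>+t. ennreal (exp (t * u)) \<partial>bump_prior \<beta>) \<le> ennreal (1 + \<beta> ^ 4 * exp (\<beta>\<^sup>2))"
proof -
  interpret prob_space "bump_prior \<beta>" by (rule prob_space_bump_prior[OF \<beta>])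
  let ?f = "\<lambda>t. ennreal (bump \<beta> t) * ennreal (exp (t * u))"
  have reflect: "(\<integral>\<^sup>+t. ?f t \<partial>lborel) = (\<integral>\<^sup>+t. ennreal (bump \<beta> t) * ennreal (exp (- (t * u))) \<partial>lborel)"
    by (subst nn_integral_real_affine[where c="-1" and t=0]) (simp_all add: bump_def power_divide cong: if_cong)
  have bound: "exp (t * u) + exp (- (t * u)) \<le> 2 * (1 + \<beta> ^ 4 * exp (\<beta>\<^sup>2))" if t: "\<bar>t\<bar> \<le> \<beta>" for t
  proof -
    have tu: "\<bar>t * u\<bar> \<le> \<beta> * \<beta>" unfolding abs_mult using t u \<beta> by (intro mult_mono) auto
    have "(t * u)\<^sup>2 \<le> (\<beta> * \<beta>)\<^sup>2" using tu \<beta> by (metis abs_ge_zero power2_abs power_mono)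
    moreover have "exp \<bar>t * u\<bar> \<le> exp (\<beta>\<^sup>2)" using tu by (simp add: power2_eq_square)
    ultimately have "(t * u)\<^sup>2 * exp \<bar>t * u\<bar> \<le> (\<beta> * \<beta>)\<^sup>2 * exp (\<beta>\<^sup>2)"
      by (intro mult_mono) auto
    also have "(\<beta> * \<beta>)\<^sup>2 = \<beta> ^ 4" by (simp add: power2_eq_square power4_eq_xxxx)
    finally show ?thesis
      using exp_taylor_bound[of "t * u"] exp_taylor_bound[of "- (t * u)"] by simp
  qed
  have "2 * (\<integral>\<^sup>+t. ennreal (exp (t * u)) \<partial>bump_prior \<beta>)
     = (\<integral>\<^sup>+t. ?f t \<partial>lborel) + (\<integral>\<^sup>+t. ennreal (bump \<beta> t) * ennreal (exp (- (t * u))) \<partial>lborel)"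
    unfolding reflect[symmetric] by (subst nn_integral_bump_prior[OF \<beta>]) (auto simp: mult_2)
  also have "\<dots> = (\<integral>\<^sup>+t. ennreal (bump \<beta> t) * ennreal (exp (t * u) + exp (- (t * u))) \<partial>lborel)"
    by (subst nn_integral_add[symmetric]) (auto simp: distrib_left ennreal_plus intro!: nn_integral_cong)
  also have "\<dots> = (\<integral>\<^sup>+t. ennreal (exp (t * u) + exp (- (t * u))) \<partial>bump_prior \<beta>)"
    by (rule nn_integral_bump_prior[OF \<beta>, symmetric]) measurable
  also have "\<dots> \<le> (\<integral>\<^sup>+t. ennreal (2 * (1 + \<beta> ^ 4 * exp (\<beta>\<^sup>2))) \<partial>bump_prior \<beta>)"
    by (rule nn_integral_mono_AE, use AE_bump_prior[OF \<beta>] in eventually_elim) (intro ennreal_leI bound)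
  also have "\<dots> = 2 * ennreal (1 + \<beta> ^ 4 * exp (\<beta>\<^sup>2))"
    using emeasure_space_1 by (simp add: ennreal_mult)
  finally show ?thesis
    by (subst (asm) ennreal_mult_le_mult_iff) auto
qed

definition cube_prior :: "'k set \<Rightarrow> real \<Rightarrow> ('k \<Rightarrow> real) measure" where
  "cube_prior I \<beta> = (\<Pi>\<^sub>M k\<in>I. bump_prior \<beta>)"

lemma sets_cube_prior [measurable_cong]: "sets (cube_prior I \<beta>) = sets (\<Pi>\<^sub>M k\<in>I. borel)"
  unfolding cube_prior_def by (intro sets_PiM_cong) auto

lemma component_cube_prior [measurable]: "k \<in> I \<Longrightarrow> (\<lambda>a. a k) \<in> borel_measurable (cube_prior I \<beta>)"
  by (simp add: measurable_cong_sets[OF sets_cube_prior refl])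

lemma prob_space_cube_prior: "\<beta> > 0 \<Longrightarrow> prob_space (cube_prior I \<beta>)"
  unfolding cube_prior_def by (intro prob_space_PiM prob_space_bump_prior)

lemma AE_cube_prior:
  assumes "\<beta> > 0" "finite I"
  shows "AE a in cube_prior I \<beta>. \<forall>k\<in>I. \<bar>a k\<bar> \<le> \<beta>"
  unfolding cube_prior_def using assms
  by (intro AE_finite_allI AE_PiM_component[where P="\<lambda>t. \<bar>t\<bar> \<le> \<beta>"] prob_space_bump_prior AE_bump_prior)

lemma product_prob_space_bump_prior: "\<beta> > 0 \<Longrightarrow> product_prob_space (\<lambda>_. bump_prior \<beta>)"
  by (simp add: product_prob_space_def product_prob_space_axioms_def product_sigma_finite_def
        prob_space_imp_sigma_finite prob_space_bump_prior)

lemma nn_integral_cube_prior_split: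
  assumes \<beta>: "\<beta> > 0" and I: "finite I" "k \<in> I" and [measurable]: "f \<in> borel_measurable (cube_prior I \<beta>)"
  shows "(\<integral>\<^sup>+a. f a \<partial>cube_prior I \<beta>)
       = (\<integral>\<^sup>+a. (\<integral>\<^sup>+t. f (a(k := t)) \<partial>bump_prior \<beta>) \<partial>cube_prior (I - {k}) \<beta>)"
proof -
  interpret product_prob_space "\<lambda>_. bump_prior \<beta>" by (rule product_prob_space_bump_prior[OF \<beta>])
  have "insert k (I - {k}) = I" using I by auto
  then show ?thesis
    using product_nn_integral_insert[of "I - {k}" k f] I assms(4)
    by (simp add: cube_prior_def)
qed

lemma nn_integral_cube_prior_component:
  assumes \<beta>: "\<beta> > 0" and I: "finite I" "k \<in> I" and f [measurable]: "f \<in> borel_measurable borel"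
  shows "(\<integral>\<^sup>+a. f (a k) \<partial>cube_prior I \<beta>) = (\<integral>\<^sup>+t. f t \<partial>bump_prior \<beta>)"
proof -
  interpret prob_space "cube_prior (I - {k}) \<beta>" by (rule prob_space_cube_prior[OF \<beta>])
  have "(\<lambda>a. f (a k)) \<in> borel_measurable (cube_prior I \<beta>)" using I by measurable
  from nn_integral_cube_prior_split[OF \<beta> I this] show ?thesis
    using emeasure_space_1 by simp
qed

text \<open>
  The one-dimensional inequality for the coordinate \<open>k\<close>, with the other coordinates fixed and then
  averaged.
\<close>

lemma van_trees_coordinate:
  fixes p S :: "('k \<Rightarrow> real) \<Rightarrow> real" and p' :: "('k \<Rightarrow> real) \<Rightarrow> real"
  assumes \<beta>: "\<beta> > 0" and c: "c > 0" and I: "finite I" "k \<in> I"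
    and p: "\<And>a. p a \<ge> 0"
    and p': "\<And>a t. ((\<lambda>t. p (a(k := t))) has_real_derivative p' (a(k := t))) (at t)"
    and cont: "\<And>a. continuous_on UNIV (\<lambda>t. p' (a(k := t)))"
    and S: "\<And>a. p' a = S a * p a"
    and meas: "p \<in> borel_measurable (cube_prior I \<beta>)" "S \<in> borel_measurable (cube_prior I \<beta>)"
  shows "(\<integral>\<^sup>+a. ennreal (p a) \<partial>cube_prior I \<beta>)
    \<le> (\<integral>\<^sup>+a. ennreal ((c / 2 * (T - a k)\<^sup>2 + (bump_score \<beta> (a k))\<^sup>2 / c + (S a)\<^sup>2 / c) * p a) \<partial>cube_prior I \<beta>)"
proof -
  have ak: "(\<lambda>a. a k) \<in> borel_measurable (cube_prior I \<beta>)"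
    by (rule component_cube_prior[OF I(2)])
  have meas_R: "(\<lambda>a. (c / 2 * (T - a k)\<^sup>2 + (bump_score \<beta> (a k))\<^sup>2 / c + (S a)\<^sup>2 / c) * p a)
      \<in> borel_measurable (cube_prior I \<beta>)"
    by (intro borel_measurable_times borel_measurable_add borel_measurable_divide
        borel_measurable_power borel_measurable_diff borel_measurable_const meas ak
        measurable_compose[OF ak bump_score_measurable])
  have upd: "(\<lambda>t. S (a(k := t))) \<in> borel_measurable borel" if a: "a \<in> space (cube_prior (I - {k}) \<beta>)" for a
  proof -
    have "insert k (I - {k}) = I" using I by auto
    then have "(\<lambda>t. a(k := t)) \<in> bump_prior \<beta> \<rightarrow>\<^sub>M cube_prior I \<beta>"
      using measurable_component_update[of a "I - {k}" "\<lambda>_. bump_prior \<beta>" k] a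
      by (simp add: cube_prior_def)
    from measurable_compose[OF this meas(2)] show ?thesis
      by (subst (asm) measurable_cong_sets[OF sets_bump_prior refl])
  qed
  have "(\<integral>\<^sup>+a. ennreal (p a) \<partial>cube_prior I \<beta>)
     = (\<integral>\<^sup>+a. (\<integral>\<^sup>+t. ennreal (p (a(k := t))) \<partial>bump_prior \<beta>) \<partial>cube_prior (I - {k}) \<beta>)"
    by (rule nn_integral_cube_prior_split[OF \<beta> I measurable_compose[OF meas(1) measurable_ennreal]])
  also have "\<dots> \<le> (\<integral>\<^sup>+a. (\<integral>\<^sup>+t. ennreal ((c / 2 * (T - (a(k := t)) k)\<^sup>2 + (bump_score \<beta> ((a(k := t)) k))\<^sup>2 / c
      + (S (a(k := t)))\<^sup>2 / c) * p (a(k := t))) \<partial>bump_prior \<beta>) \<partial>cube_prior (I - {k}) \<beta>)"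
    unfolding fun_upd_same
  proof (rule nn_integral_mono)
    fix a assume a: "a \<in> space (cube_prior (I - {k}) \<beta>)"
    show "(\<integral>\<^sup>+t. ennreal (p (a(k := t))) \<partial>bump_prior \<beta>) \<le> (\<integral>\<^sup>+t. ennreal ((c / 2 * (T - t)\<^sup>2
       + (bump_score \<beta> t)\<^sup>2 / c + (S (a(k := t)))\<^sup>2 / c) * p (a(k := t))) \<partial>bump_prior \<beta>)"
      by (rule van_trees_1d[where p="\<lambda>t. p (a(k := t))" and p'="\<lambda>t. p' (a(k := t))"
            and S="\<lambda>t. S (a(k := t))", OF \<beta> c p p' cont S upd[OF a]])
  qed
  also have "\<dots> = (\<integral>\<^sup>+a. ennreal ((c / 2 * (T - a k)\<^sup>2 + (bump_score \<beta> (a k))\<^sup>2 / c + (S a)\<^sup>2 / c) * p a) \<partial>cube_prior I \<beta>)"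
    by (rule nn_integral_cube_prior_split[OF \<beta> I measurable_compose[OF meas_R measurable_ennreal], symmetric])
  finally show ?thesis .
qed

section \<open>Information from several machines\<close>

lemma countable_finitely_supported:
  fixes d :: "'z :: countable"
  assumes "finite J"
  shows "countable {z :: 'i \<Rightarrow> 'z. \<forall>i. i \<notin> J \<longrightarrow> z i = d}"
proof (rule countable_subset)
  show "{z. \<forall>i. i \<notin> J \<longrightarrow> z i = d} \<subseteq> (\<lambda>f i. if i \<in> J then f i else d) ` (\<Pi>\<^sub>E i\<in>J. UNIV)"
  proof
    fix z :: "'i \<Rightarrow> 'z" assume "z \<in> {z. \<forall>i. i \<notin> J \<longrightarrow> z i = d}"
    then have "z = (\<lambda>i. if i \<in> J then restrict z J i else d)" by (auto simp: fun_eq_iff)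
    moreover have "restrict z J \<in> (\<Pi>\<^sub>E i\<in>J. UNIV)" by simp
    ultimately show "z \<in> (\<lambda>f i. if i \<in> J then f i else d) ` (\<Pi>\<^sub>E i\<in>J. UNIV)"
      by (rule image_eqI)
  qed
  show "countable ((\<lambda>f i. if i \<in> J then f i else d) ` (\<Pi>\<^sub>E i\<in>J. UNIV))"
    using assms by (intro countable_image countable_PiE) auto
qed

lemma nn_integral_Pi_pmf:
  assumes "finite J"
  shows "(\<integral>\<^sup>+z. f z \<partial>measure_pmf (Pi_pmf J d p))
       = (\<integral>\<^sup>+z. ennreal (\<Prod>i\<in>J. pmf (p i) (z i)) * f z \<partial>count_space {z. \<forall>i. i \<notin> J \<longrightarrow> z i = d})"
  unfolding nn_integral_measure_pmf nn_integral_count_space_indicator[of "{z. _ z}"]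
  by (subst nn_integral_count_space_indicator) (auto simp: pmf_Pi[OF assms] indicator_def intro!: nn_integral_cong)

text \<open>
  Additivity of variances; applied to scores it is the additivity of Fisher information over
  machines.
\<close>

lemma second_moment_sum_Pi_pmf:
  fixes F :: "'i \<Rightarrow> 'z \<Rightarrow> real"
  assumes J: "finite J"
    and int2: "\<And>i. i \<in> J \<Longrightarrow> integrable (measure_pmf (p i)) (\<lambda>z. (F i z)\<^sup>2)"
    and mean: "\<And>i. i \<in> J \<Longrightarrow> measure_pmf.expectation (p i) (F i) = 0"
  shows "(\<integral>\<^sup>+z. ennreal ((\<Sum>i\<in>J. F i (z i))\<^sup>2) \<partial>measure_pmf (Pi_pmf J d p))
       = (\<Sum>i\<in>J. \<integral>\<^sup>+z. ennreal ((F i z)\<^sup>2) \<partial>measure_pmf (p i))"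
proof -
  let ?M = "measure_pmf (Pi_pmf J d p)"
  have comp: "map_pmf (\<lambda>f. f i) (Pi_pmf J d p) = p i" if "i \<in> J" for i
    using that J by (simp add: Pi_pmf_component)
  have int1: "integrable (measure_pmf (p i)) (F i)" if "i \<in> J" for i
    by (rule measure_pmf.square_integrable_imp_integrable[OF _ int2[OF that]]) simp
  have I1: "integrable ?M (\<lambda>z. F i (z i))" and I2: "integrable ?M (\<lambda>z. (F i (z i))\<^sup>2)"
    and E1: "(\<integral>z. F i (z i) \<partial>?M) = 0" and E2: "(\<integral>z. (F i (z i))\<^sup>2 \<partial>?M) = (\<integral>z. (F i z)\<^sup>2 \<partial>p i)"
    if i: "i \<in> J" for i
    using int1[OF i] int2[OF i] mean[OF i] unfolding comp[OF i, symmetric] by simp_all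
  have cross: "integrable ?M (\<lambda>z. F i (z i) * F j (z j))"
      "(\<integral>z. F i (z i) * F j (z j) \<partial>?M) = (if i = j then \<integral>z. (F i z)\<^sup>2 \<partial>p i else 0)"
    if ij: "i \<in> J" "j \<in> J" for i j
  proof -
    have "integrable ?M (\<lambda>z. F i (z i) * F j (z j)) \<and>
      (\<integral>z. F i (z i) * F j (z j) \<partial>?M) = (if i = j then \<integral>z. (F i z)\<^sup>2 \<partial>p i else 0)"
    proof (cases "i = j")
      case True
      then show ?thesis using I2[OF ij(1)] E2[OF ij(1)] by (simp add: power2_eq_square)
    next
      case False
      have "prob_space.indep_vars (measure_pmf (Pi_pmf J d p)) (\<lambda>_. borel) (\<lambda>i z. F i (z i)) J"
        by (rule prob_space.indep_vars_compose2[OF measure_pmf.prob_space_axioms indep_vars_Pi_pmf[OF J]]) auto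
      then have indep: "prob_space.indep_vars (measure_pmf (Pi_pmf J d p)) (\<lambda>_. borel) (\<lambda>i z. F i (z i)) {i, j}"
        by (rule prob_space.indep_vars_subset[OF measure_pmf.prob_space_axioms]) (use ij in auto)
      have "integrable ?M (\<lambda>z. \<Prod>l\<in>{i, j}. F l (z l))"
        by (rule prob_space.indep_vars_integrable[OF measure_pmf.prob_space_axioms _ indep]) (use ij I1 in auto)
      moreover have "(\<integral>z. (\<Prod>l\<in>{i, j}. F l (z l)) \<partial>?M) = (\<Prod>l\<in>{i, j}. \<integral>z. F l (z l) \<partial>?M)"
        by (rule prob_space.indep_vars_lebesgue_integral[OF measure_pmf.prob_space_axioms _ indep]) (use ij I1 in auto)
      ultimately show ?thesis using False E1 ij by simp
    qed
    then show "integrable ?M (\<lambda>z. F i (z i) * F j (z j))"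
      "(\<integral>z. F i (z i) * F j (z j) \<partial>?M) = (if i = j then \<integral>z. (F i z)\<^sup>2 \<partial>p i else 0)" by auto
  qed
  have sq: "(\<Sum>i\<in>J. F i (z i))\<^sup>2 = (\<Sum>i\<in>J. \<Sum>j\<in>J. F i (z i) * F j (z j))" for z
    by (simp add: power2_eq_square sum_product)
  have "(\<integral>\<^sup>+z. ennreal ((\<Sum>i\<in>J. F i (z i))\<^sup>2) \<partial>?M) = ennreal (\<integral>z. (\<Sum>i\<in>J. F i (z i))\<^sup>2 \<partial>?M)"
  proof (rule nn_integral_eq_integral)
    show "integrable ?M (\<lambda>z. (\<Sum>i\<in>J. F i (z i))\<^sup>2)"
      unfolding sq by (intro Bochner_Integration.integrable_sum cross)
  qed simp
  also have "(\<integral>z. (\<Sum>i\<in>J. F i (z i))\<^sup>2 \<partial>?M) = (\<Sum>i\<in>J. \<Sum>j\<in>J. if i = j then \<integral>z. (F i z)\<^sup>2 \<partial>p i else 0)"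
    unfolding sq
    by (subst Bochner_Integration.integral_sum, intro Bochner_Integration.integrable_sum cross, assumption+)
       (intro sum.cong refl, subst Bochner_Integration.integral_sum, auto intro!: cross sum.cong)
  also have "\<dots> = (\<Sum>i\<in>J. \<integral>z. (F i z)\<^sup>2 \<partial>p i)"
    using J by (intro sum.cong) auto
  also have "ennreal \<dots> = (\<Sum>i\<in>J. ennreal (\<integral>z. (F i z)\<^sup>2 \<partial>p i))"
    by (intro sum_ennreal[symmetric] Bochner_Integration.integral_nonneg) auto
  also have "\<dots> = (\<Sum>i\<in>J. \<integral>\<^sup>+z. ennreal ((F i z)\<^sup>2) \<partial>p i)"
    by (intro sum.cong refl nn_integral_eq_integral[symmetric] int2) auto
  finally show ?thesis .
qed

context gaussian_experiment begin

lemma lik_joint_measurable: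
  "(\<lambda>p. lik (fst p) (snd p)) \<in> borel_measurable (cube_prior I \<beta> \<Otimes>\<^sub>M P0)"
proof -
  have 1: "(\<lambda>p. fst p k) \<in> borel_measurable (cube_prior I \<beta> \<Otimes>\<^sub>M P0)" if "k \<in> I" for k
    by (rule measurable_compose[OF measurable_fst component_cube_prior[OF that]])
  have 2: "(\<lambda>p. Y k (snd p)) \<in> borel_measurable (cube_prior I \<beta> \<Otimes>\<^sub>M P0)" if "k \<in> I" for k
    by (rule measurable_compose[OF measurable_snd Y_measurable[OF that]])
  show ?thesis
    unfolding lik_def
    by (intro measurable_compose[OF _ borel_measurable_exp] borel_measurable_sum borel_measurable_diff
        borel_measurable_times borel_measurable_divide borel_measurable_power 1 2 borel_measurable_const)
qed

lemma weight_lik_joint_measurable: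
  assumes "weight w"
  shows "(\<lambda>p. w (snd p) * lik (fst p) (snd p)) \<in> borel_measurable (cube_prior I \<beta> \<Otimes>\<^sub>M P0)"
  by (rule borel_measurable_times[OF measurable_compose[OF measurable_snd weightD(1)[OF assms]]
        lik_joint_measurable])

lemma prob_of_measurable:
  assumes w: "weight w"
  shows "prob_of w \<in> borel_measurable (cube_prior I \<beta>)"
proof -
  have "case_prod (\<lambda>a x. w x * lik a x) \<in> borel_measurable (cube_prior I \<beta> \<Otimes>\<^sub>M P0)"
    unfolding case_prod_unfold by (rule weight_lik_joint_measurable[OF w])
  from borel_measurable_lebesgue_integral[OF this] show ?thesis
    unfolding prob_of_def[abs_def] .
qed

lemma dprob_of_measurable:
  assumes w: "weight w" and k: "k \<in> I"
  shows "(\<lambda>a. dprob_of w a k) \<in> borel_measurable (cube_prior I \<beta>)"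
proof -
  have "case_prod (\<lambda>a x. w x * (Y k x - a k) * lik a x)
      \<in> borel_measurable (cube_prior I \<beta> \<Otimes>\<^sub>M P0)"
    unfolding case_prod_unfold
    by (intro borel_measurable_times borel_measurable_diff lik_joint_measurable
        measurable_compose[OF measurable_snd Y_measurable[OF k]]
        measurable_compose[OF measurable_snd weightD(1)[OF w]]
        measurable_compose[OF measurable_fst component_cube_prior[OF k]])
  from borel_measurable_lebesgue_integral[OF this] show ?thesis
    unfolding dprob_of_def[abs_def] .
qed

lemma pmf_law_measurable:
  "kernel \<kappa> \<Longrightarrow> (\<lambda>a. pmf (law \<kappa> a) z) \<in> borel_measurable (cube_prior I \<beta>)"
  unfolding pmf_law by (rule prob_of_measurable[OF weight_pmf])

lemma score_measurable:
  "kernel \<kappa> \<Longrightarrow> k \<in> I \<Longrightarrow> (\<lambda>a. score \<kappa> a k z) \<in> borel_measurable (cube_prior I \<beta>)"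
  unfolding score_def
  by (intro borel_measurable_divide pmf_law_measurable dprob_of_measurable weight_pmf)

text \<open>
  Summation of \<open>van_trees_coordinate\<close> over all coordinates and all joint transcripts.  For one joint
  transcript the probability is a product over machines, with score the sum of their scores.
\<close>

lemma van_trees_transcripts:
  fixes \<kappa> :: "'i \<Rightarrow> 'x \<Rightarrow> 'z :: countable pmf" and T :: "'k \<Rightarrow> ('i \<Rightarrow> 'z) \<Rightarrow> real"
  assumes \<beta>: "\<beta> > 0" and c: "c > 0" and J: "finite J" and \<kappa>: "\<And>i. i \<in> J \<Longrightarrow> kernel (\<kappa> i)"
  shows "of_nat (card I) \<le> (\<integral>\<^sup>+a. (\<integral>\<^sup>+z. ennreal (\<Sum>k\<in>I. c / 2 * (T k z - a k)\<^sup>2 + (bump_score \<beta> (a k))\<^sup>2 / c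
      + (\<Sum>i\<in>J. score (\<kappa> i) a k (z i))\<^sup>2 / c) \<partial>measure_pmf (Pi_pmf J d (\<lambda>i. law (\<kappa> i) a))) \<partial>cube_prior I \<beta>)"
proof -
  interpret prior: prob_space "cube_prior I \<beta>" by (rule prob_space_cube_prior[OF \<beta>])
  define Z where "Z = {z :: 'i \<Rightarrow> 'z. \<forall>i. i \<notin> J \<longrightarrow> z i = d}"
  have Z: "countable Z" unfolding Z_def by (rule countable_finitely_supported[OF J])
  define p where "p z a = (\<Prod>i\<in>J. pmf (law (\<kappa> i) a) (z i))" for z a
  define S where "S k z a = (\<Sum>i\<in>J. score (\<kappa> i) a k (z i))" for k z a
  define g where "g k z a = c / 2 * (T k z - a k)\<^sup>2 + (bump_score \<beta> (a k))\<^sup>2 / c + (S k z a)\<^sup>2 / c" for k z a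
  have p_nonneg: "p z a \<ge> 0" for z a unfolding p_def by (intro prod_nonneg) auto
  have g_nonneg: "g k z a \<ge> 0" for k z a unfolding g_def using c by auto
  have p_meas: "p z \<in> borel_measurable (cube_prior I \<beta>)" for z
    unfolding p_def[abs_def] by (intro borel_measurable_prod pmf_law_measurable \<kappa>)
  have S_meas: "S k z \<in> borel_measurable (cube_prior I \<beta>)" if "k \<in> I" for k z
    unfolding S_def[abs_def] by (intro borel_measurable_sum score_measurable \<kappa> that)
  have g_meas: "g k z \<in> borel_measurable (cube_prior I \<beta>)" if "k \<in> I" for k z
    unfolding g_def[abs_def]
    by (intro borel_measurable_times borel_measurable_add borel_measurable_divide
        borel_measurable_power borel_measurable_diff borel_measurable_const S_meas that
        measurable_compose[OF _ bump_score_measurable] component_cube_prior)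
  have vt: "(\<integral>\<^sup>+a. ennreal (p z a) \<partial>cube_prior I \<beta>) \<le> (\<integral>\<^sup>+a. ennreal (g k z a * p z a) \<partial>cube_prior I \<beta>)"
    if k: "k \<in> I" for k z
    unfolding g_def
  proof (rule van_trees_coordinate[where p'="\<lambda>a. \<Sum>i\<in>J. dprob_of (\<lambda>x. pmf (\<kappa> i x) (z i)) a k * (\<Prod>j\<in>J-{i}. pmf (law (\<kappa> j) a) (z j))"
        and S="S k z", OF \<beta> c finite_I k p_nonneg])
    fix a :: "'k \<Rightarrow> real"
    have law_upd: "pmf (law (\<kappa> i) b) (z i) = prob_of (\<lambda>x. pmf (\<kappa> i x) (z i)) b" if "i \<in> J" for i b
      by (rule pmf_law[OF \<kappa>[OF that]])
    show deriv: "((\<lambda>t. p z (a(k := t))) has_real_derivative (\<Sum>i\<in>J. dprob_of (\<lambda>x. pmf (\<kappa> i x) (z i)) (a(k := t)) k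
        * (\<Prod>j\<in>J-{i}. pmf (law (\<kappa> j) (a(k := t))) (z j)))) (at t)" for t
      unfolding p_def
      by (rule has_field_derivative_prod)
         (simp add: law_upd, rule prob_of_has_derivative(1)[OF weight_pmf[OF \<kappa>] k], assumption)
    have cont: "continuous_on UNIV (\<lambda>t. pmf (law (\<kappa> i) (a(k := t))) (z i))" if i: "i \<in> J" for i
      unfolding law_upd[OF i]
      by (intro continuous_at_imp_continuous_on ballI
          DERIV_isCont[OF prob_of_has_derivative(1)[OF weight_pmf[OF \<kappa>[OF i]] k]])
    show "continuous_on UNIV (\<lambda>t. \<Sum>i\<in>J. dprob_of (\<lambda>x. pmf (\<kappa> i x) (z i)) (a(k := t)) k
        * (\<Prod>j\<in>J-{i}. pmf (law (\<kappa> j) (a(k := t))) (z j)))"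
      by (intro continuous_on_sum continuous_on_mult continuous_on_prod cont
          prob_of_has_derivative(2)[OF weight_pmf[OF \<kappa>] k]) auto
    show "(\<Sum>i\<in>J. dprob_of (\<lambda>x. pmf (\<kappa> i x) (z i)) a k * (\<Prod>j\<in>J-{i}. pmf (law (\<kappa> j) a) (z j))) = S k z a * p z a"
      unfolding S_def p_def sum_distrib_right
    proof (intro sum.cong refl)
      fix i assume i: "i \<in> J"
      show "dprob_of (\<lambda>x. pmf (\<kappa> i x) (z i)) a k * (\<Prod>j\<in>J-{i}. pmf (law (\<kappa> j) a) (z j))
        = score (\<kappa> i) a k (z i) * (\<Prod>i\<in>J. pmf (law (\<kappa> i) a) (z i))"
        unfolding prod.remove[OF J i] pmf_law_score[OF \<kappa>[OF i], symmetric] by (simp add: mult_ac)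
    qed
  qed (rule p_meas S_meas[OF k])+
  have total: "(\<integral>\<^sup>+z. ennreal (p z a) \<partial>count_space Z) = 1" for a
  proof -
    have "(\<integral>\<^sup>+z. 1 \<partial>measure_pmf (Pi_pmf J d (\<lambda>i. law (\<kappa> i) a))) = (\<integral>\<^sup>+z. ennreal (p z a) * 1 \<partial>count_space Z)"
      unfolding nn_integral_Pi_pmf[OF J] p_def Z_def ..
    then show ?thesis by simp
  qed
  have "(of_nat (card I) :: ennreal) = (\<Sum>k\<in>I. \<integral>\<^sup>+a. (\<integral>\<^sup>+z. ennreal (p z a) \<partial>count_space Z) \<partial>cube_prior I \<beta>)"
    unfolding total using prior.emeasure_space_1 by simp
  also have "\<dots> = (\<Sum>k\<in>I. \<integral>\<^sup>+z. (\<integral>\<^sup>+a. ennreal (p z a) \<partial>cube_prior I \<beta>) \<partial>count_space Z)"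
    by (intro sum.cong refl nn_integral_count_space_nn_integral Z measurable_compose[OF p_meas measurable_ennreal])
  also have "\<dots> \<le> (\<Sum>k\<in>I. \<integral>\<^sup>+z. (\<integral>\<^sup>+a. ennreal (g k z a * p z a) \<partial>cube_prior I \<beta>) \<partial>count_space Z)"
    by (intro sum_mono nn_integral_mono vt)
  also have "\<dots> = (\<integral>\<^sup>+z. (\<Sum>k\<in>I. \<integral>\<^sup>+a. ennreal (g k z a * p z a) \<partial>cube_prior I \<beta>) \<partial>count_space Z)"
    by (rule nn_integral_sum[symmetric]) simp
  also have "\<dots> = (\<integral>\<^sup>+z. (\<integral>\<^sup>+a. (\<Sum>k\<in>I. ennreal (g k z a * p z a)) \<partial>cube_prior I \<beta>) \<partial>count_space Z)"
    by (intro nn_integral_cong nn_integral_sum[symmetric] measurable_compose[OF _ measurable_ennreal]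
        borel_measurable_times g_meas p_meas)
  also have "\<dots> = (\<integral>\<^sup>+a. (\<integral>\<^sup>+z. (\<Sum>k\<in>I. ennreal (g k z a * p z a)) \<partial>count_space Z) \<partial>cube_prior I \<beta>)"
    by (intro nn_integral_count_space_nn_integral[symmetric] Z borel_measurable_sum
        measurable_compose[OF _ measurable_ennreal] borel_measurable_times g_meas p_meas)
  also have "\<dots> = (\<integral>\<^sup>+a. (\<integral>\<^sup>+z. ennreal (\<Sum>k\<in>I. g k z a) \<partial>measure_pmf (Pi_pmf J d (\<lambda>i. law (\<kappa> i) a))) \<partial>cube_prior I \<beta>)"
  proof (intro nn_integral_cong)
    fix a
    have "(\<integral>\<^sup>+z. (\<Sum>k\<in>I. ennreal (g k z a * p z a)) \<partial>count_space Z)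
        = (\<integral>\<^sup>+z. ennreal (p z a) * ennreal (\<Sum>k\<in>I. g k z a) \<partial>count_space Z)"
      by (intro nn_integral_cong)
         (simp add: sum_ennreal g_nonneg p_nonneg ennreal_mult[symmetric] sum_nonneg sum_distrib_left mult.commute)
    also have "\<dots> = (\<integral>\<^sup>+z. ennreal (\<Sum>k\<in>I. g k z a) \<partial>measure_pmf (Pi_pmf J d (\<lambda>i. law (\<kappa> i) a)))"
      unfolding nn_integral_Pi_pmf[OF J] p_def Z_def ..
    finally show "(\<integral>\<^sup>+z. (\<Sum>k\<in>I. ennreal (g k z a * p z a)) \<partial>count_space Z)
      = (\<integral>\<^sup>+z. ennreal (\<Sum>k\<in>I. g k z a) \<partial>measure_pmf (Pi_pmf J d (\<lambda>i. law (\<kappa> i) a)))" .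
  qed
  finally show ?thesis unfolding g_def S_def .
qed

end

section \<open>One machine cannot distinguish the prior from the zero signal\<close>

lemma ennreal_weighted_AM_GM:
  fixes L :: ennreal
  assumes g: "\<gamma> > 0" and w: "0 \<le> w" "w \<le> 1"
  shows "ennreal w * L \<le> ennreal (\<gamma> / 2) * (L * L) + ennreal (1 / (2 * \<gamma>)) * ennreal w"
proof (cases L)
  case (real l)
  have "w * w \<le> w * 1" using w by (intro mult_left_mono) auto
  moreover have "0 \<le> (\<gamma> * l - w)\<^sup>2" by simp
  ultimately have "2 * \<gamma> * (w * l) \<le> \<gamma> * \<gamma> * (l * l) + w"
    by (simp add: power2_eq_square algebra_simps)
  then have "w * l \<le> (\<gamma> * \<gamma> * (l * l) + w) / (2 * \<gamma>)"
    using g by (simp add: field_simps)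
  also have "\<dots> = \<gamma> / 2 * (l * l) + 1 / (2 * \<gamma>) * w"
    using g by (simp add: field_simps)
  finally have "ennreal (w * l) \<le> ennreal (\<gamma> / 2 * (l * l) + 1 / (2 * \<gamma>) * w)"
    by (rule ennreal_leI)
  also have "\<dots> = ennreal (\<gamma> / 2) * (L * L) + ennreal (1 / (2 * \<gamma>)) * ennreal w"
    using g w real by (subst ennreal_plus) (auto simp: ennreal_mult[symmetric])
  finally show ?thesis using real w by (simp add: ennreal_mult)
next
  case top
  then show ?thesis using g by (simp add: ennreal_mult_top)
qed

context gaussian_experiment begin

lemma nn_integral_lik: "(\<integral>\<^sup>+x. ennreal (lik a x) \<partial>P0) = 1"
  using lik_total[of a] by (simp add: lik_def)

lemma nn_integral_lik_mult:
  "(\<integral>\<^sup>+x. ennreal (lik a x) * ennreal (lik b x) \<partial>P0) = ennreal (exp (\<Sum>k\<in>I. a k * b k))"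
proof -
  have "(\<integral>\<^sup>+x. ennreal (lik a x) * ennreal (lik b x) \<partial>P0)
      = (\<integral>\<^sup>+x. ennreal (exp (\<Sum>k\<in>I. a k * b k)) * ennreal (lik (\<lambda>k. a k + b k) x) \<partial>P0)"
    by (intro nn_integral_cong) (simp add: ennreal_mult[symmetric] lik_mult)
  then show ?thesis
    unfolding nn_integral_cmult[OF measurable_compose[OF lik_measurable measurable_ennreal]]
      nn_integral_lik by simp
qed

text \<open>
  The inner product of \<open>a\<close> with an independent draw \<open>b\<close> from the prior has independent symmetric
  summands of size at most \<open>\<beta>\<^sup>2\<close>, so that its exponential moment is of order
  \<open>exp (card I * \<beta> ^ 4)\<close> and not \<open>exp (card I * \<beta>\<^sup>2)\<close>.
\<close>

lemma exp_inner_cube_prior_le: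
  assumes \<beta>: "\<beta> > 0" and a: "\<forall>k\<in>I. \<bar>a k\<bar> \<le> \<beta>"
  shows "(\<integral>\<^sup>+b. ennreal (exp (\<Sum>k\<in>I. a k * b k)) \<partial>cube_prior I \<beta>)
     \<le> ennreal (exp (card I * (\<beta> ^ 4 * exp (\<beta>\<^sup>2))))"
proof -
  interpret bp: product_prob_space "\<lambda>_ :: 'k. bump_prior \<beta>" by (rule product_prob_space_bump_prior[OF \<beta>])
  have "(\<integral>\<^sup>+b. ennreal (exp (\<Sum>k\<in>I. a k * b k)) \<partial>cube_prior I \<beta>)
     = (\<integral>\<^sup>+b. (\<Prod>k\<in>I. ennreal (exp (b k * a k))) \<partial>(\<Pi>\<^sub>M k\<in>I. bump_prior \<beta>))"
  proof -
    have "ennreal (exp (\<Sum>k\<in>I. a k * b k)) = (\<Prod>k\<in>I. ennreal (exp (b k * a k)))" for b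
      unfolding exp_sum[OF finite_I] by (subst prod_ennreal) (simp_all add: mult.commute)
    then show ?thesis unfolding cube_prior_def by (simp only:)
  qed
  also have "\<dots> = (\<Prod>k\<in>I. \<integral>\<^sup>+t. ennreal (exp (t * a k)) \<partial>bump_prior \<beta>)"
  proof (rule bp.product_nn_integral_prod[OF finite_I])
    fix k
    have "(\<lambda>t. ennreal (exp (t * a k))) \<in> borel_measurable borel" by measurable
    then show "(\<lambda>t. ennreal (exp (t * a k))) \<in> borel_measurable (bump_prior \<beta>)"
      by (subst measurable_cong_sets[OF sets_bump_prior refl])
  qed
  also have "\<dots> \<le> (\<Prod>k\<in>I. ennreal (exp (\<beta> ^ 4 * exp (\<beta>\<^sup>2))))"
  proof (rule prod_mono_ennreal)
    fix k assume "k \<in> I"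
    then have "(\<integral>\<^sup>+t. ennreal (exp (t * a k)) \<partial>bump_prior \<beta>) \<le> ennreal (1 + \<beta> ^ 4 * exp (\<beta>\<^sup>2))"
      using a by (intro symmetric_exp_bump_prior \<beta>) auto
    also have "\<dots> \<le> ennreal (exp (\<beta> ^ 4 * exp (\<beta>\<^sup>2)))"
      by (intro ennreal_leI exp_ge_add_one_self)
    finally show "(\<integral>\<^sup>+t. ennreal (exp (t * a k)) \<partial>bump_prior \<beta>) \<le> ennreal (exp (\<beta> ^ 4 * exp (\<beta>\<^sup>2)))" .
  qed
  also have "\<dots> = ennreal (exp (card I * (\<beta> ^ 4 * exp (\<beta>\<^sup>2))))"
    by (simp add: ennreal_power exp_of_nat_mult)
  finally show ?thesis .
qed

text \<open>
  Second moment method: the likelihood ratio \<open>m\<close> of the mixture has second moment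
  \<open>\<integral> \<integral> exp (\<Sum>k. a k * b k)\<close> over independent \<open>a\<close>, \<open>b\<close>, because the product of two likelihoods is an
  exponential of the inner product times a likelihood.  As before, the Cauchy-Schwarz
  inequality is used in a form that is linear in the probability at 0, so that it can be summed over
  machines.
\<close>

lemma mixture_prob_le:
  assumes \<beta>: "\<beta> > 0" and w: "weight w" and g: "\<gamma> > 0"
  shows "(\<integral>\<^sup>+a. ennreal (prob_of w a) \<partial>cube_prior I \<beta>)
     \<le> ennreal (\<gamma> / 2 * exp (card I * (\<beta> ^ 4 * exp (\<beta>\<^sup>2)))) + ennreal (1 / (2 * \<gamma>) * prob_of w (\<lambda>_. 0))"
proof -
  let ?\<pi> = "cube_prior I \<beta>" and ?G = "exp (card I * (\<beta> ^ 4 * exp (\<beta>\<^sup>2)))"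
  interpret prior: prob_space ?\<pi> by (rule prob_space_cube_prior[OF \<beta>])
  interpret pair_sigma_finite ?\<pi> P0
    by (simp add: pair_sigma_finite_def prob_space_imp_sigma_finite prior.prob_space_axioms prob_space_axioms)
  define m where "m x = (\<integral>\<^sup>+a. ennreal (lik a x) \<partial>?\<pi>)" for x
  have ejoint: "(\<lambda>p. ennreal (lik (fst p) (snd p))) \<in> borel_measurable (?\<pi> \<Otimes>\<^sub>M P0)"
    by (rule measurable_compose[OF lik_joint_measurable measurable_ennreal])
  have lik_a: "(\<lambda>a. ennreal (lik a x)) \<in> borel_measurable ?\<pi>" if "x \<in> space P0" for x
    using measurable_compose[OF measurable_Pair2'[OF that] ejoint] unfolding fst_conv snd_conv .
  have lik_x: "(\<lambda>x. ennreal (lik a x)) \<in> borel_measurable P0" for a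
    by (rule measurable_compose[OF lik_measurable measurable_ennreal])
  have swap_joint: "(\<lambda>p. ennreal (lik (snd p) (fst p))) \<in> borel_measurable (P0 \<Otimes>\<^sub>M ?\<pi>)"
    using measurable_compose[OF measurable_pair_swap' ejoint] unfolding case_prod_unfold fst_conv snd_conv .
  have m_meas: "m \<in> borel_measurable P0"
    unfolding m_def[abs_def]
    by (rule prior.borel_measurable_nn_integral) (unfold case_prod_unfold, rule swap_joint)
  have w_meas: "w \<in> borel_measurable P0" and w01: "0 \<le> w x" "w x \<le> 1" for x
    by (rule weightD[OF w])+
  have "(\<integral>\<^sup>+a. ennreal (prob_of w a) \<partial>?\<pi>) = (\<integral>\<^sup>+a. (\<integral>\<^sup>+x. ennreal (w x) * ennreal (lik a x) \<partial>P0) \<partial>?\<pi>)"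
    unfolding ennreal_prob_of[OF w] using w01 by (simp add: ennreal_mult)
  also have "\<dots> = (\<integral>\<^sup>+x. (\<integral>\<^sup>+a. ennreal (w x) * ennreal (lik a x) \<partial>?\<pi>) \<partial>P0)"
    by (rule Fubini'[symmetric], unfold case_prod_unfold)
       (intro borel_measurable_times_ennreal ejoint measurable_compose[OF measurable_snd measurable_compose[OF w_meas measurable_ennreal]])
  also have "\<dots> = (\<integral>\<^sup>+x. ennreal (w x) * m x \<partial>P0)"
    unfolding m_def by (intro nn_integral_cong nn_integral_cmult lik_a)
  also have "\<dots> \<le> (\<integral>\<^sup>+x. ennreal (\<gamma> / 2) * (m x * m x) + ennreal (1 / (2 * \<gamma>)) * ennreal (w x) \<partial>P0)"
    by (intro nn_integral_mono ennreal_weighted_AM_GM g w01)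
  also have "\<dots> = ennreal (\<gamma> / 2) * (\<integral>\<^sup>+x. m x * m x \<partial>P0) + ennreal (1 / (2 * \<gamma>)) * (\<integral>\<^sup>+x. ennreal (w x) \<partial>P0)"
  proof -
    have 1: "(\<lambda>x. m x * m x) \<in> borel_measurable P0"
      by (intro borel_measurable_times_ennreal m_meas)
    have 2: "(\<lambda>x. ennreal (w x)) \<in> borel_measurable P0"
      by (rule measurable_compose[OF w_meas measurable_ennreal])
    show ?thesis
      by (subst nn_integral_add)
         (intro borel_measurable_times_ennreal borel_measurable_const 1 2
           | simp only: nn_integral_cmult[OF 1] nn_integral_cmult[OF 2])+
  qed
  also have "(\<integral>\<^sup>+x. ennreal (w x) \<partial>P0) = ennreal (prob_of w (\<lambda>_. 0))"
    unfolding ennreal_prob_of[OF w] by (simp add: lik_def)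
  also have "(\<integral>\<^sup>+x. m x * m x \<partial>P0) \<le> ennreal ?G"
  proof -
    have "(\<integral>\<^sup>+x. m x * m x \<partial>P0) = (\<integral>\<^sup>+x. (\<integral>\<^sup>+a. m x * ennreal (lik a x) \<partial>?\<pi>) \<partial>P0)"
    proof (rule nn_integral_cong)
      fix x assume x: "x \<in> space P0"
      show "m x * m x = (\<integral>\<^sup>+a. m x * ennreal (lik a x) \<partial>?\<pi>)"
        unfolding nn_integral_cmult[OF lik_a[OF x]] m_def ..
    qed
    also have "\<dots> = (\<integral>\<^sup>+a. (\<integral>\<^sup>+x. m x * ennreal (lik a x) \<partial>P0) \<partial>?\<pi>)"
      by (rule Fubini', unfold case_prod_unfold)
         (intro borel_measurable_times_ennreal ejoint measurable_compose[OF measurable_snd m_meas])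
    also have "\<dots> = (\<integral>\<^sup>+a. (\<integral>\<^sup>+x. (\<integral>\<^sup>+b. ennreal (lik a x) * ennreal (lik b x) \<partial>?\<pi>) \<partial>P0) \<partial>?\<pi>)"
    proof (intro nn_integral_cong)
      fix a x assume x: "x \<in> space P0"
      show "m x * ennreal (lik a x) = (\<integral>\<^sup>+b. ennreal (lik a x) * ennreal (lik b x) \<partial>?\<pi>)"
        unfolding nn_integral_cmult[OF lik_a[OF x]] m_def by (rule mult.commute)
    qed
    also have "\<dots> = (\<integral>\<^sup>+a. (\<integral>\<^sup>+b. (\<integral>\<^sup>+x. ennreal (lik a x) * ennreal (lik b x) \<partial>P0) \<partial>?\<pi>) \<partial>?\<pi>)"
      by (rule nn_integral_cong, rule Fubini', unfold case_prod_unfold)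
         (intro borel_measurable_times_ennreal ejoint measurable_compose[OF measurable_snd lik_x])
    also have "\<dots> = (\<integral>\<^sup>+a. (\<integral>\<^sup>+b. ennreal (exp (\<Sum>k\<in>I. a k * b k)) \<partial>?\<pi>) \<partial>?\<pi>)"
      unfolding nn_integral_lik_mult ..
    also have "\<dots> \<le> (\<integral>\<^sup>+a. ennreal ?G \<partial>?\<pi>)"
      by (rule nn_integral_mono_AE, use AE_cube_prior[OF \<beta> finite_I] in eventually_elim)
         (rule exp_inner_cube_prior_le[OF \<beta>])
    also have "\<dots> = ennreal ?G" using prior.emeasure_space_1 by simp
    finally show ?thesis .
  qed
  finally show ?thesis
    using g prob_of_nonneg[OF w] by (simp add: ennreal_mult[symmetric] mult_left_mono add_right_mono)
qed

section \<open>Accurate estimation needs long transcripts\<close>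

lemma expected_fisher_information_le:
  fixes \<kappa> :: "'i \<Rightarrow> 'x \<Rightarrow> bool list pmf" and t \<epsilon> :: real
  assumes J: "finite J" and \<kappa>: "\<And>i. i \<in> J \<Longrightarrow> kernel (\<kappa> i)"
    and t: "t \<ge> 0" and e: "\<epsilon> > 0" and I: "I \<noteq> {}"
  shows "(\<Sum>k\<in>I. \<integral>\<^sup>+z. ennreal ((\<Sum>i\<in>J. score (\<kappa> i) a k (z i))\<^sup>2) \<partial>measure_pmf (Pi_pmf J d (\<lambda>i. law (\<kappa> i) a)))
      \<le> ennreal (card J * (4 * t + 4 + 48 * \<epsilon> * card I))
        + ennreal (card I / (2 * \<epsilon>)) * (\<Sum>i\<in>J. ennreal (measure_pmf.prob (law (\<kappa> i) a) {z. real (length z) > t}))"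
proof -
  let ?P = "\<lambda>i. measure_pmf.prob (law (\<kappa> i) a) {z. real (length z) > t}"
  have "(\<Sum>k\<in>I. \<integral>\<^sup>+z. ennreal ((\<Sum>i\<in>J. score (\<kappa> i) a k (z i))\<^sup>2) \<partial>measure_pmf (Pi_pmf J d (\<lambda>i. law (\<kappa> i) a)))
      = (\<Sum>k\<in>I. \<Sum>i\<in>J. \<integral>\<^sup>+z. ennreal ((score (\<kappa> i) a k z)\<^sup>2) \<partial>measure_pmf (law (\<kappa> i) a))"
    by (intro sum.cong refl second_moment_sum_Pi_pmf J score_sq_integrable expectation_score \<kappa>)
  also have "\<dots> = (\<Sum>i\<in>J. \<integral>\<^sup>+z. ennreal (\<Sum>k\<in>I. (score (\<kappa> i) a k z)\<^sup>2) \<partial>measure_pmf (law (\<kappa> i) a))"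
    by (subst sum.swap) (simp add: nn_integral_sum[symmetric] sum_ennreal)
  also have "\<dots> \<le> (\<Sum>i\<in>J. ennreal (4 * t + 4 + 48 * \<epsilon> * card I + card I / (2 * \<epsilon>) * ?P i))"
    by (intro sum_mono fisher_information_le \<kappa> t e I)
  also have "\<dots> = (\<Sum>i\<in>J. ennreal (4 * t + 4 + 48 * \<epsilon> * card I) + ennreal (card I / (2 * \<epsilon>)) * ennreal (?P i))"
    using t e by (intro sum.cong refl) (subst ennreal_plus, auto simp: ennreal_mult[symmetric])
  also have "\<dots> = ennreal (card J * (4 * t + 4 + 48 * \<epsilon> * card I))
        + ennreal (card I / (2 * \<epsilon>)) * (\<Sum>i\<in>J. ennreal (?P i))"
    unfolding sum.distrib sum_distrib_left[symmetric] sum_constant ennreal_of_nat_eq_real_of_nat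
    using t e by (subst ennreal_mult) auto
  finally show ?thesis .
qed

text \<open>
  The van Trees inequality with all its terms estimated: the risk, the information of the prior, the
  information in short strings and the information in long strings.
\<close>

lemma dimension_le_risk_plus_information:
  fixes \<kappa> :: "'i \<Rightarrow> 'x \<Rightarrow> bool list pmf" and t \<epsilon> :: real
  assumes \<beta>: "\<beta> > 0" and c: "c > 0" and J: "finite J" and \<kappa>: "\<And>i. i \<in> J \<Longrightarrow> kernel (\<kappa> i)"
    and t: "t \<ge> 0" and e: "\<epsilon> > 0" and I: "I \<noteq> {}" and R: "R \<ge> 0"
    and risk: "\<And>a. \<forall>k\<in>I. \<bar>a k\<bar> \<le> \<beta> \<Longrightarrow>
      (\<integral>\<^sup>+z. ennreal (\<Sum>k\<in>I. (T k z - a k)\<^sup>2) \<partial>measure_pmf (Pi_pmf J d (\<lambda>i. law (\<kappa> i) a))) \<le> ennreal R"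
  shows "ennreal (card I) \<le> ennreal (c / 2 * R + 10 * card I / (c * \<beta>\<^sup>2) + card J * (4 * t + 4 + 48 * \<epsilon> * card I) / c)
     + ennreal (card I / (2 * \<epsilon> * c)) *
        (\<Sum>i\<in>J. \<integral>\<^sup>+a. ennreal (measure_pmf.prob (law (\<kappa> i) a) {z. real (length z) > t}) \<partial>cube_prior I \<beta>)"
proof -
  let ?\<pi> = "cube_prior I \<beta>" and ?A = "{z :: bool list. real (length z) > t}"
  let ?P = "\<lambda>i a. ennreal (measure_pmf.prob (law (\<kappa> i) a) ?A)"
  let ?F = "ennreal (card J * (4 * t + 4 + 48 * \<epsilon> * card I))"
  let ?h = "ennreal (card I / (2 * \<epsilon>))"
  interpret prior: prob_space ?\<pi> by (rule prob_space_cube_prior[OF \<beta>])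
  have P_meas: "?P i \<in> borel_measurable ?\<pi>" if "i \<in> J" for i
    unfolding prob_law[OF \<kappa>[OF that]]
    by (intro measurable_compose[OF prob_of_measurable measurable_ennreal] weight_event \<kappa> that)
  have bs_meas: "(\<lambda>a. ennreal ((bump_score \<beta> (a k))\<^sup>2)) \<in> borel_measurable ?\<pi>" if "k \<in> I" for k
    by (rule measurable_compose[OF component_cube_prior[OF that]]) measurable
  have "ennreal (card I) \<le> (\<integral>\<^sup>+a. (\<integral>\<^sup>+z. ennreal (\<Sum>k\<in>I. c / 2 * (T k z - a k)\<^sup>2 + (bump_score \<beta> (a k))\<^sup>2 / c
      + (\<Sum>i\<in>J. score (\<kappa> i) a k (z i))\<^sup>2 / c) \<partial>measure_pmf (Pi_pmf J d (\<lambda>i. law (\<kappa> i) a))) \<partial>?\<pi>)"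
    using van_trees_transcripts[OF \<beta> c J \<kappa>, where T=T and d=d] by (simp add: ennreal_of_nat_eq_real_of_nat)
  also have "\<dots> \<le> (\<integral>\<^sup>+a. (ennreal (c / 2 * R) + ennreal (1 / c) * (\<Sum>k\<in>I. ennreal ((bump_score \<beta> (a k))\<^sup>2)))
      + ennreal (1 / c) * (?F + ?h * (\<Sum>i\<in>J. ?P i a)) \<partial>?\<pi>)"
  proof (rule nn_integral_mono_AE, use AE_cube_prior[OF \<beta> finite_I] in eventually_elim)
    fix a :: "'k \<Rightarrow> real" assume a: "\<forall>k\<in>I. \<bar>a k\<bar> \<le> \<beta>"
    let ?M = "measure_pmf (Pi_pmf J d (\<lambda>i. law (\<kappa> i) a))"
    interpret M: prob_space ?M by (rule measure_pmf.prob_space_axioms)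
    let ?x = "\<lambda>z. \<Sum>k\<in>I. (T k z - a k)\<^sup>2" and ?y = "\<Sum>k\<in>I. (bump_score \<beta> (a k))\<^sup>2"
      and ?s = "\<lambda>z. \<Sum>k\<in>I. (\<Sum>i\<in>J. score (\<kappa> i) a k (z i))\<^sup>2"
    have nn: "?x z \<ge> 0" "?y \<ge> 0" "?s z \<ge> 0" for z by (auto intro!: sum_nonneg)
    have "(\<integral>\<^sup>+z. ennreal (\<Sum>k\<in>I. c / 2 * (T k z - a k)\<^sup>2 + (bump_score \<beta> (a k))\<^sup>2 / c
      + (\<Sum>i\<in>J. score (\<kappa> i) a k (z i))\<^sup>2 / c) \<partial>?M)
      = (\<integral>\<^sup>+z. (ennreal (c / 2) * ennreal (?x z) + ennreal (1 / c) * ennreal ?y) + ennreal (1 / c) * ennreal (?s z) \<partial>?M)"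
    proof (intro nn_integral_cong)
      fix z
      have "(\<Sum>k\<in>I. c / 2 * (T k z - a k)\<^sup>2 + (bump_score \<beta> (a k))\<^sup>2 / c + (\<Sum>i\<in>J. score (\<kappa> i) a k (z i))\<^sup>2 / c)
         = (c / 2 * ?x z + 1 / c * ?y) + 1 / c * ?s z"
        by (simp add: sum.distrib sum_distrib_left sum_divide_distrib)
      also have "ennreal \<dots> = (ennreal (c / 2) * ennreal (?x z) + ennreal (1 / c) * ennreal ?y) + ennreal (1 / c) * ennreal (?s z)"
        using c nn by (subst ennreal_plus; (subst ennreal_plus)?) (auto simp: ennreal_mult[symmetric] simp del: ennreal_plus)
      finally show "ennreal (\<Sum>k\<in>I. c / 2 * (T k z - a k)\<^sup>2 + (bump_score \<beta> (a k))\<^sup>2 / c + (\<Sum>i\<in>J. score (\<kappa> i) a k (z i))\<^sup>2 / c)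
        = (ennreal (c / 2) * ennreal (?x z) + ennreal (1 / c) * ennreal ?y) + ennreal (1 / c) * ennreal (?s z)" .
    qed
    also have "\<dots> = (ennreal (c / 2) * (\<integral>\<^sup>+z. ennreal (?x z) \<partial>?M) + ennreal (1 / c) * ennreal ?y)
        + ennreal (1 / c) * (\<integral>\<^sup>+z. ennreal (?s z) \<partial>?M)"
      by (simp add: nn_integral_add nn_integral_cmult)
    also have "(\<integral>\<^sup>+z. ennreal (?s z) \<partial>?M) = (\<Sum>k\<in>I. \<integral>\<^sup>+z. ennreal ((\<Sum>i\<in>J. score (\<kappa> i) a k (z i))\<^sup>2) \<partial>?M)"
      by (simp add: nn_integral_sum[symmetric] sum_ennreal)
    also have "(ennreal (c / 2) * (\<integral>\<^sup>+z. ennreal (?x z) \<partial>?M) + ennreal (1 / c) * ennreal ?y) + ennreal (1 / c) * \<dots>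
       \<le> (ennreal (c / 2) * ennreal R + ennreal (1 / c) * ennreal ?y) + ennreal (1 / c) * (?F + ?h * (\<Sum>i\<in>J. ?P i a))"
      by (intro add_mono mult_left_mono risk a order_refl expected_fisher_information_le J \<kappa> t e I) auto
    also have "\<dots> = (ennreal (c / 2 * R) + ennreal (1 / c) * (\<Sum>k\<in>I. ennreal ((bump_score \<beta> (a k))\<^sup>2)))
      + ennreal (1 / c) * (?F + ?h * (\<Sum>i\<in>J. ?P i a))"
    proof -
      have "ennreal ?y = (\<Sum>k\<in>I. ennreal ((bump_score \<beta> (a k))\<^sup>2))"
        by (rule sum_ennreal[symmetric]) simp
      moreover have "ennreal (c / 2) * ennreal R = ennreal (c / 2 * R)"
        using c R by (intro ennreal_mult[symmetric]) auto
      ultimately show ?thesis by (simp only:)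
    qed
    finally show "(\<integral>\<^sup>+z. ennreal (\<Sum>k\<in>I. c / 2 * (T k z - a k)\<^sup>2 + (bump_score \<beta> (a k))\<^sup>2 / c
      + (\<Sum>i\<in>J. score (\<kappa> i) a k (z i))\<^sup>2 / c) \<partial>?M)
      \<le> (ennreal (c / 2 * R) + ennreal (1 / c) * (\<Sum>k\<in>I. ennreal ((bump_score \<beta> (a k))\<^sup>2)))
      + ennreal (1 / c) * (?F + ?h * (\<Sum>i\<in>J. ?P i a))" .
  qed
  also have "\<dots> = (ennreal (c / 2 * R) + ennreal (1 / c) * (\<Sum>k\<in>I. \<integral>\<^sup>+a. ennreal ((bump_score \<beta> (a k))\<^sup>2) \<partial>?\<pi>))
      + ennreal (1 / c) * (?F + ?h * (\<Sum>i\<in>J. \<integral>\<^sup>+a. ?P i a \<partial>?\<pi>))"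
  proof -
    have 1: "(\<lambda>a. \<Sum>k\<in>I. ennreal ((bump_score \<beta> (a k))\<^sup>2)) \<in> borel_measurable ?\<pi>"
      by (intro borel_measurable_sum bs_meas)
    have 2: "(\<lambda>a. \<Sum>i\<in>J. ?P i a) \<in> borel_measurable ?\<pi>"
      by (intro borel_measurable_sum P_meas)
    have 3: "(\<lambda>a. ?F + ?h * (\<Sum>i\<in>J. ?P i a)) \<in> borel_measurable ?\<pi>"
      by (intro borel_measurable_add borel_measurable_times_ennreal 2 borel_measurable_const)
    show ?thesis
      apply (subst nn_integral_add)
        apply (intro borel_measurable_add borel_measurable_times_ennreal 1 borel_measurable_const)
       apply (intro borel_measurable_times_ennreal 3 borel_measurable_const)
      apply (subst nn_integral_add)
        apply (rule borel_measurable_const)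
       apply (intro borel_measurable_times_ennreal 1 borel_measurable_const)
      apply (subst nn_integral_cmult[OF 1], subst nn_integral_cmult[OF 3])
      apply (subst nn_integral_add)
        apply (rule borel_measurable_const)
       apply (intro borel_measurable_times_ennreal 2 borel_measurable_const)
      apply (subst nn_integral_cmult[OF 2])
      apply (subst nn_integral_sum, erule bs_meas)
      apply (subst nn_integral_sum, erule P_meas)
      using prior.emeasure_space_1 apply (simp only: nn_integral_const mult_1_right)
      done
  qed
  also have "\<dots> \<le> (ennreal (c / 2 * R) + ennreal (1 / c) * (\<Sum>k\<in>I. ennreal (10 / \<beta>\<^sup>2)))
      + ennreal (1 / c) * (?F + ?h * (\<Sum>i\<in>J. \<integral>\<^sup>+a. ?P i a \<partial>?\<pi>))"
  proof (intro add_mono order_refl mult_left_mono sum_mono)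
    fix k assume k: "k \<in> I"
    have "(\<integral>\<^sup>+a. ennreal ((bump_score \<beta> (a k))\<^sup>2) \<partial>?\<pi>) = (\<integral>\<^sup>+t. ennreal ((bump_score \<beta> t)\<^sup>2) \<partial>bump_prior \<beta>)"
      by (rule nn_integral_cube_prior_component[OF \<beta> finite_I k, where f="\<lambda>t. ennreal ((bump_score \<beta> t)\<^sup>2)"]) measurable
    also have "\<dots> \<le> ennreal (10 / \<beta>\<^sup>2)" by (rule bump_prior_information[OF \<beta>])
    finally show "(\<integral>\<^sup>+a. ennreal ((bump_score \<beta> (a k))\<^sup>2) \<partial>?\<pi>) \<le> ennreal (10 / \<beta>\<^sup>2)" .
  qed auto
  also have "\<dots> = ennreal (c / 2 * R + 10 * card I / (c * \<beta>\<^sup>2) + card J * (4 * t + 4 + 48 * \<epsilon> * card I) / c)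
     + ennreal (card I / (2 * \<epsilon> * c)) * (\<Sum>i\<in>J. \<integral>\<^sup>+a. ?P i a \<partial>?\<pi>)"
  proof -
    have a: "ennreal (1 / c) * (\<Sum>k\<in>I. ennreal (10 / \<beta>\<^sup>2)) = ennreal (10 * card I / (c * \<beta>\<^sup>2))"
      using c by (simp add: ennreal_of_nat_eq_real_of_nat ennreal_mult[symmetric])
    have b: "ennreal (1 / c) * ?F = ennreal (card J * (4 * t + 4 + 48 * \<epsilon> * card I) / c)"
      using c t e by (simp add: ennreal_mult[symmetric])
    have c': "ennreal (1 / c) * ?h = ennreal (card I / (2 * \<epsilon> * c))"
      using c t e by (simp add: ennreal_mult[symmetric] mult_ac)
    have nn: "0 \<le> c / 2 * R" "0 \<le> 10 * card I / (c * \<beta>\<^sup>2)" "0 \<le> card J * (4 * t + 4 + 48 * \<epsilon> * card I) / c"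
      using c R t e by auto
    have expand: "u * (F + h * S) = u * F + (u * h) * S" for u F h S :: ennreal
      by (simp add: distrib_left mult.assoc)
    show ?thesis
      unfolding expand a b c'
      using nn by (simp only: ennreal_plus add_nonneg_nonneg add.assoc)
  qed
  finally show ?thesis .
qed

text \<open>
  If the risk per coordinate on the cube is at most \<open>1 / (2 \<rho> m)\<close> and the cube is wide on the scale
  \<open>1 / sqrt (\<rho> m)\<close>, then on average over prior and machines a transcript exceeds the length
  \<open>\<rho> d / 64\<close> with probability at least \<open>\<rho>\<^sup>2 / 768\<close>.
\<close>

lemma accuracy_needs_long_transcripts:
  fixes \<kappa> :: "'i \<Rightarrow> 'x \<Rightarrow> bool list pmf" and \<rho> R :: real
  assumes \<beta>: "\<beta> > 0" and J: "finite J" "J \<noteq> {}" and \<kappa>: "\<And>i. i \<in> J \<Longrightarrow> kernel (\<kappa> i)"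
    and nonempty: "\<And>i x. i \<in> J \<Longrightarrow> x \<in> space P0 \<Longrightarrow> set_pmf (\<kappa> i x) \<subseteq> {z. length z \<ge> 1}"
    and I: "I \<noteq> {}" and R: "R \<ge> 0" and \<rho>: "0 < \<rho>" "\<rho> \<le> 1"
    and small_risk: "\<rho> * card J * R \<le> card I / 2"
    and wide: "40 \<le> \<rho> * card J * \<beta>\<^sup>2"
    and risk: "\<And>a. \<forall>k\<in>I. \<bar>a k\<bar> \<le> \<beta> \<Longrightarrow>
      (\<integral>\<^sup>+z. ennreal (\<Sum>k\<in>I. (T k z - a k)\<^sup>2) \<partial>measure_pmf (Pi_pmf J d (\<lambda>i. law (\<kappa> i) a))) \<le> ennreal R"
  shows "ennreal (\<rho>\<^sup>2 * card J / 768) \<le>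
    (\<Sum>i\<in>J. \<integral>\<^sup>+a. ennreal (measure_pmf.prob (law (\<kappa> i) a) {z. real (length z) > \<rho> * card I / 64}) \<partial>cube_prior I \<beta>)"
    (is "_ \<le> ?S")
proof (cases "\<rho> * card I / 64 < 1")
  \<comment> \<open>The threshold is below 1, and every string has length at least 1.\<close>
  case True
  interpret prior: prob_space "cube_prior I \<beta>" by (rule prob_space_cube_prior[OF \<beta>])
  have one: "measure_pmf.prob (law (\<kappa> i) a) {z. real (length z) > \<rho> * card I / 64} = 1" if i: "i \<in> J" for i a
  proof -
    have "prob_of (\<lambda>x. measure_pmf.prob (\<kappa> i x) {z. real (length z) > \<rho> * card I / 64}) a
        = prob_of (\<lambda>_. 1) a"
      unfolding prob_of_def
    proof (intro Bochner_Integration.integral_cong refl)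
      fix x assume x: "x \<in> space P0"
      have "AE z in measure_pmf (\<kappa> i x). real (length z) > \<rho> * card I / 64"
        using nonempty[OF i x] True by (intro AE_pmfI) fastforce
      then have "measure_pmf.prob (\<kappa> i x) {z. real (length z) > \<rho> * card I / 64} = 1"
        by (subst measure_pmf.prob_eq_1) auto
      then show "measure_pmf.prob (\<kappa> i x) {z. real (length z) > \<rho> * card I / 64} * lik a x = 1 * lik a x"
        by simp
    qed
    then show ?thesis by (simp add: prob_law[OF \<kappa>[OF i]] prob_of_1)
  qed
  have "?S = (\<Sum>i\<in>J. 1)"
  proof (intro sum.cong refl)
    fix i assume i: "i \<in> J"
    show "(\<integral>\<^sup>+a. ennreal (measure_pmf.prob (law (\<kappa> i) a) {z. real (length z) > \<rho> * card I / 64}) \<partial>cube_prior I \<beta>) = 1"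
      unfolding one[OF i] using prior.emeasure_space_1 by simp
  qed
  then have S: "?S = ennreal (card J)" by (simp add: ennreal_of_nat_eq_real_of_nat)
  have "\<rho>\<^sup>2 \<le> 1" using \<rho> by (simp add: power_le_one)
  then have "\<rho>\<^sup>2 * card J \<le> 1 * real (card J)" by (intro mult_right_mono) auto
  then show ?thesis unfolding S by (intro ennreal_leI) simp
next
  case False
  \<comment> \<open>In the van Trees bound, the risk and the prior contribute at most \<open>d / 4\<close> each by assumption; \<open>t\<close> and \<open>\<epsilon>\<close> are chosen such that
    all terms of the Fisher information without long strings add up to another \<open>d / 4\<close>.\<close>
  define c where "c = \<rho> * card J"
  define t where "t = \<rho> * card I / 64"
  define \<epsilon> where "\<epsilon> = \<rho> / 384"
  have m: "real (card J) > 0" using J by (simp add: card_gt_0_iff)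
  have dpos: "real (card I) > 0" using I finite_I by (simp add: card_gt_0_iff)
  have c: "c > 0" using \<rho> m by (simp add: c_def)
  have t: "t \<ge> 1" using False by (simp add: t_def)
  have e: "\<epsilon> > 0" using \<rho> by (simp add: \<epsilon>_def)
  have x1: "c / 2 * R \<le> card I / 4" using small_risk by (simp add: c_def mult_ac)
  have x2: "10 * card I / (c * \<beta>\<^sup>2) \<le> card I / 4"
    using wide c \<beta> dpos by (simp add: c_def field_simps)
  have "card J * (4 * t + 4 + 48 * \<epsilon> * card I) / c \<le> card J * (8 * t + 48 * \<epsilon> * card I) / c"
    using t c by (intro divide_right_mono mult_left_mono) auto
  also have "\<dots> = card I / 4"
    using \<rho> m by (simp add: t_def \<epsilon>_def c_def field_simps)
  finally have x: "c / 2 * R + 10 * card I / (c * \<beta>\<^sup>2) + card J * (4 * t + 4 + 48 * \<epsilon> * card I) / c \<le> 3 / 4 * card I"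
    using x1 x2 by simp
  have "ennreal (card I) \<le> ennreal (c / 2 * R + 10 * card I / (c * \<beta>\<^sup>2) + card J * (4 * t + 4 + 48 * \<epsilon> * card I) / c)
     + ennreal (card I / (2 * \<epsilon> * c)) * ?S"
    using dimension_le_risk_plus_information[OF \<beta> c J(1) \<kappa> _ e I R risk, of t] t by (simp add: t_def)
  also have "\<dots> \<le> ennreal (3 / 4 * card I) + ennreal (card I / (2 * \<epsilon> * c)) * ?S"
    by (intro add_right_mono ennreal_leI x)
  finally have main: "ennreal (card I) \<le> ennreal (3 / 4 * card I) + ennreal (card I / (2 * \<epsilon> * c)) * ?S" .
  show ?thesis
  proof (cases ?S)
    case (real s)
    have "ennreal (card I) \<le> ennreal (3 / 4 * card I) + ennreal (card I / (2 * \<epsilon> * c)) * ennreal s"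
      using main unfolding real(2) .
    also have "\<dots> = ennreal (3 / 4 * card I + card I / (2 * \<epsilon> * c) * s)"
      using real(1) e c by (subst ennreal_plus) (auto simp: ennreal_mult[symmetric])
    finally have "card I \<le> 3 / 4 * card I + card I / (2 * \<epsilon> * c) * s"
      using real e c by (subst (asm) ennreal_le_iff) auto
    moreover have "card I / (2 * \<epsilon> * c) * s = card I * (s / (2 * \<epsilon> * c))" by simp
    ultimately have "card I * (1 / 4) \<le> card I * (s / (2 * \<epsilon> * c))" by linarith
    then have "1 / 4 \<le> s / (2 * \<epsilon> * c)"
      using dpos by (rule mult_left_le_imp_le)
    then have "\<epsilon> * c / 2 \<le> s" using e c by (simp add: field_simps)
    moreover have "\<epsilon> * c / 2 = \<rho>\<^sup>2 * card J / 768" by (simp add: \<epsilon>_def c_def power2_eq_square)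
    ultimately show ?thesis using real by simp
  qed simp
qed

lemma expected_length_ge:
  assumes J: "finite J" and t: "t \<ge> 0"
  shows "ennreal t * (\<Sum>i\<in>J. ennreal (measure_pmf.prob (p i) {z :: bool list. real (length z) > t}))
     \<le> (\<integral>\<^sup>+z. of_nat (\<Sum>i\<in>J. length (z i)) \<partial>measure_pmf (Pi_pmf J d p))"
proof -
  let ?A = "{z :: bool list. real (length z) > t}"
  have "ennreal t * (\<Sum>i\<in>J. ennreal (measure_pmf.prob (p i) ?A))
      = (\<Sum>i\<in>J. \<integral>\<^sup>+z. ennreal t * indicator ?A z \<partial>measure_pmf (p i))"
    unfolding sum_distrib_left
    by (intro sum.cong refl) (simp add: nn_integral_cmult measure_pmf.emeasure_eq_measure)
  also have "\<dots> \<le> (\<Sum>i\<in>J. \<integral>\<^sup>+z. of_nat (length z) \<partial>measure_pmf (p i))"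
    by (intro sum_mono nn_integral_mono)
       (auto simp: indicator_def ennreal_of_nat_eq_real_of_nat intro!: ennreal_leI)
  also have "\<dots> = (\<Sum>i\<in>J. \<integral>\<^sup>+z. of_nat (length (z i)) \<partial>measure_pmf (Pi_pmf J d p))"
  proof (intro sum.cong refl)
    fix i assume "i \<in> J"
    then have "p i = map_pmf (\<lambda>f. f i) (Pi_pmf J d p)"
      using J by (simp add: Pi_pmf_component)
    then show "(\<integral>\<^sup>+z. of_nat (length z) \<partial>measure_pmf (p i)) = (\<integral>\<^sup>+z. of_nat (length (z i)) \<partial>measure_pmf (Pi_pmf J d p))"
      by (metis (no_types, lifting) nn_integral_cong nn_integral_map_pmf)
  qed
  also have "\<dots> = (\<integral>\<^sup>+z. of_nat (\<Sum>i\<in>J. length (z i)) \<partial>measure_pmf (Pi_pmf J d p))"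
    by (simp add: nn_integral_sum[symmetric])
  finally show ?thesis .
qed

lemma max_cost_on_cube_ge:
  fixes \<kappa> :: "'i \<Rightarrow> 'x \<Rightarrow> bool list pmf" and t r :: real
  assumes \<beta>: "\<beta> > 0" and J: "finite J" and \<kappa>: "\<And>i. i \<in> J \<Longrightarrow> kernel (\<kappa> i)" and t: "t \<ge> 0"
    and r: "r \<ge> 0" and long: "ennreal r \<le> (\<Sum>i\<in>J. \<integral>\<^sup>+a. ennreal (measure_pmf.prob (law (\<kappa> i) a)
        {z. real (length z) > t}) \<partial>cube_prior I \<beta>)"
    and cost: "\<And>a. \<forall>k\<in>I. \<bar>a k\<bar> \<le> \<beta> \<Longrightarrow>
      (\<integral>\<^sup>+z. of_nat (\<Sum>i\<in>J. length (z i)) \<partial>measure_pmf (Pi_pmf J d (\<lambda>i. law (\<kappa> i) a))) \<le> L"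
  shows "ennreal (t * r) \<le> L"
proof -
  let ?\<pi> = "cube_prior I \<beta>"
  let ?P = "\<lambda>i a. ennreal (measure_pmf.prob (law (\<kappa> i) a) {z. real (length z) > t})"
  interpret prior: prob_space ?\<pi> by (rule prob_space_cube_prior[OF \<beta>])
  have P_meas: "?P i \<in> borel_measurable ?\<pi>" if "i \<in> J" for i
    unfolding prob_law[OF \<kappa>[OF that]]
    by (intro measurable_compose[OF prob_of_measurable measurable_ennreal] weight_event \<kappa> that)
  have sum_meas: "(\<lambda>a. \<Sum>i\<in>J. ?P i a) \<in> borel_measurable ?\<pi>"
    by (intro borel_measurable_sum P_meas)
  have "ennreal (t * r) = ennreal t * ennreal r" using t r by (simp add: ennreal_mult)
  also have "\<dots> \<le> ennreal t * (\<Sum>i\<in>J. \<integral>\<^sup>+a. ?P i a \<partial>?\<pi>)"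
    by (intro mult_left_mono long) simp
  also have "\<dots> = (\<integral>\<^sup>+a. ennreal t * (\<Sum>i\<in>J. ?P i a) \<partial>?\<pi>)"
    unfolding nn_integral_cmult[OF sum_meas] by (subst nn_integral_sum[OF P_meas]) auto
  also have "\<dots> \<le> (\<integral>\<^sup>+a. L \<partial>?\<pi>)"
  proof (rule nn_integral_mono_AE, use AE_cube_prior[OF \<beta> finite_I] in eventually_elim)
    fix a :: "'k \<Rightarrow> real" assume "\<forall>k\<in>I. \<bar>a k\<bar> \<le> \<beta>"
    then show "ennreal t * (\<Sum>i\<in>J. ?P i a) \<le> L"
      by (rule order_trans[OF expected_length_ge[OF J t] cost])
  qed
  also have "\<dots> = L" using prior.emeasure_space_1 by simp
  finally show ?thesis .
qed

text \<open>
  With \<open>\<gamma> = r / G\<close> the first term of \<open>mixture_prob_le\<close> is half of the lower bound \<open>r\<close> per machine, so that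
  the other half must come from long strings at the zero signal.
\<close>

lemma cost_at_zero_ge:
  fixes \<kappa> :: "'i \<Rightarrow> 'x \<Rightarrow> bool list pmf" and t r :: real
  assumes \<beta>: "\<beta> > 0" and J: "finite J" and \<kappa>: "\<And>i. i \<in> J \<Longrightarrow> kernel (\<kappa> i)" and t: "t \<ge> 0"
    and r: "r > 0" and long: "ennreal (r * card J) \<le> (\<Sum>i\<in>J. \<integral>\<^sup>+a. ennreal (measure_pmf.prob (law (\<kappa> i) a)
        {z. real (length z) > t}) \<partial>cube_prior I \<beta>)"
    and G: "exp (card I * (\<beta> ^ 4 * exp (\<beta>\<^sup>2))) \<le> G"
  shows "ennreal (t * (r\<^sup>2 / G * card J))
     \<le> (\<integral>\<^sup>+z. of_nat (\<Sum>i\<in>J. length (z i)) \<partial>measure_pmf (Pi_pmf J d (\<lambda>i. law (\<kappa> i) (\<lambda>_. 0))))"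
proof -
  let ?P = "\<lambda>i a. measure_pmf.prob (law (\<kappa> i) a) {z. real (length z) > t}"
  have Gpos: "G > 0" using G by (meson exp_gt_zero less_le_trans)
  define \<gamma> where "\<gamma> = r / G"
  have \<gamma>: "\<gamma> > 0" using r Gpos by (simp add: \<gamma>_def)
  let ?s = "\<Sum>i\<in>J. ?P i (\<lambda>_. 0)"
  have "ennreal (r * card J) \<le> (\<Sum>i\<in>J. \<integral>\<^sup>+a. ennreal (?P i a) \<partial>cube_prior I \<beta>)" by (rule long)
  also have "\<dots> \<le> (\<Sum>i\<in>J. ennreal (\<gamma> / 2 * G + 1 / (2 * \<gamma>) * ?P i (\<lambda>_. 0)))"
  proof (rule sum_mono)
    fix i assume i: "i \<in> J"
    have "(\<integral>\<^sup>+a. ennreal (?P i a) \<partial>cube_prior I \<beta>)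
       \<le> ennreal (\<gamma> / 2 * exp (card I * (\<beta> ^ 4 * exp (\<beta>\<^sup>2)))) + ennreal (1 / (2 * \<gamma>) * ?P i (\<lambda>_. 0))"
      unfolding prob_law[OF \<kappa>[OF i]] by (rule mixture_prob_le[OF \<beta> weight_event[OF \<kappa>[OF i]] \<gamma>])
    also have "\<dots> \<le> ennreal (\<gamma> / 2 * G) + ennreal (1 / (2 * \<gamma>) * ?P i (\<lambda>_. 0))"
      using \<gamma> G by (intro add_right_mono ennreal_leI mult_left_mono) auto
    also have "\<dots> = ennreal (\<gamma> / 2 * G + 1 / (2 * \<gamma>) * ?P i (\<lambda>_. 0))"
      using \<gamma> Gpos by (intro ennreal_plus[symmetric]) auto
    finally show "(\<integral>\<^sup>+a. ennreal (?P i a) \<partial>cube_prior I \<beta>)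
       \<le> ennreal (\<gamma> / 2 * G + 1 / (2 * \<gamma>) * ?P i (\<lambda>_. 0))" .
  qed
  also have "\<dots> = ennreal (\<Sum>i\<in>J. \<gamma> / 2 * G + 1 / (2 * \<gamma>) * ?P i (\<lambda>_. 0))"
    using \<gamma> Gpos by (intro sum_ennreal) auto
  also have "(\<Sum>i\<in>J. \<gamma> / 2 * G + 1 / (2 * \<gamma>) * ?P i (\<lambda>_. 0)) = r * card J / 2 + G / (2 * r) * ?s"
    using r Gpos by (simp add: sum.distrib sum_distrib_left \<gamma>_def)
  finally have "r * card J \<le> r * card J / 2 + G / (2 * r) * ?s"
    using r Gpos by (subst (asm) ennreal_le_iff) (auto intro!: add_nonneg_nonneg divide_nonneg_pos mult_nonneg_nonneg sum_nonneg)
  then have "r\<^sup>2 / G * card J \<le> ?s"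
    using r Gpos by (simp add: field_simps power2_eq_square)
  then have "ennreal (t * (r\<^sup>2 / G * card J)) \<le> ennreal (t * ?s)"
    using t by (intro ennreal_leI mult_left_mono)
  also have "\<dots> = ennreal t * (\<Sum>i\<in>J. ennreal (?P i (\<lambda>_. 0)))"
    using t by (simp add: ennreal_mult sum_ennreal sum_nonneg)
  also have "\<dots> \<le> (\<integral>\<^sup>+z. of_nat (\<Sum>i\<in>J. length (z i)) \<partial>measure_pmf (Pi_pmf J d (\<lambda>i. law (\<kappa> i) (\<lambda>_. 0))))"
    by (rule expected_length_ge[OF J t])
  finally show ?thesis .
qed

end

section \<open>The Gaussian sequence model as a shift experiment\<close>

text \<open>
  Coefficients are measured in units of the noise level.
\<close>

definition block_signal :: "(nat \<times> nat) set \<Rightarrow> real \<Rightarrow> (nat \<times> nat \<Rightarrow> real) \<Rightarrow> nat \<Rightarrow> nat \<Rightarrow> real" where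
  "block_signal S \<sigma> a = (\<lambda>j k. if (j, k) \<in> S then \<sigma> * a (j, k) else 0)"

abbreviation noise_only :: "real \<Rightarrow> (nat \<times> nat \<Rightarrow> real) measure" where
  "noise_only \<sigma> \<equiv> obs_dist \<sigma> (\<lambda>_ _. 0)"

lemma gaussian_experiment_obs:
  assumes S: "finite S" "S \<subseteq> coef_index" and \<sigma>: "\<sigma> > 0"
  shows "gaussian_experiment (noise_only \<sigma>) S (\<lambda>jk x. x jk / \<sigma>)"
proof -
  interpret prob_space "noise_only \<sigma>" by (rule prob_space_obs_dist)
  have Y: "(\<lambda>x. x k / \<sigma>) \<in> borel_measurable (noise_only \<sigma>)" if "k \<in> S" for k
    unfolding measurable_cong_sets[OF sets_obs_dist refl]
    using S that by (intro borel_measurable_divide component_obs_space borel_measurable_const) auto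
  show ?thesis
  proof
    fix a :: "nat \<times> nat \<Rightarrow> real"
    let ?L = "\<lambda>x. ennreal (\<Prod>s\<in>S. exp (a s * (x s / \<sigma>) - (a s)\<^sup>2 / 2))"
    have L: "?L \<in> borel_measurable (noise_only \<sigma>)"
      by (intro measurable_compose[OF _ measurable_ennreal] borel_measurable_prod
          measurable_compose[OF _ borel_measurable_exp] borel_measurable_diff borel_measurable_times
          borel_measurable_const Y)
    interpret signal: prob_space "density (noise_only \<sigma>) ?L"
      unfolding obs_dist_density[OF S \<sigma>, of a, symmetric] by (rule prob_space_obs_dist)
    have "(\<integral>\<^sup>+x. ?L x \<partial>noise_only \<sigma>) = (\<integral>\<^sup>+x. ?L x * indicator (space (noise_only \<sigma>)) x \<partial>noise_only \<sigma>)"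
      by (rule nn_integral_cong) (simp only: indicator_simps mult_1_right)
    also have "\<dots> = emeasure (density (noise_only \<sigma>) ?L) (space (noise_only \<sigma>))"
      by (rule emeasure_density[OF L sets.top, symmetric])
    also have "\<dots> = 1" using signal.emeasure_space_1 by (simp only: space_density)
    finally show "(\<integral>\<^sup>+x. ennreal (exp (\<Sum>k\<in>S. a k * (x k / \<sigma>) - (a k)\<^sup>2 / 2)) \<partial>noise_only \<sigma>) = 1"
      by (simp add: exp_sum[OF S(1)])
  qed (rule S(1), erule Y)
qed

text \<open>
  Machines see independent data, so the joint probability of the transcripts, a product of
  kernels integrated over a product measure, is a product of marginal probabilities.
\<close>

lemma transcript_expectation_law:
  assumes S: "finite S" "S \<subseteq> coef_index" and \<sigma>: "\<sigma> > 0"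
    and K: "transcript_scheme m K"
  shows "transcript_expectation m \<sigma> (block_signal S \<sigma> a) K f
       = (\<integral>\<^sup>+z. f z \<partial>measure_pmf (Pi_pmf {1..m} []
            (\<lambda>i. gaussian_experiment.law (noise_only \<sigma>) S (\<lambda>jk x. x jk / \<sigma>) (K i) a)))"
proof -
  interpret gaussian_experiment "noise_only \<sigma>" S "\<lambda>jk x. x jk / \<sigma>"
    by (rule gaussian_experiment_obs[OF S \<sigma>])
  let ?P = "obs_dist \<sigma> (block_signal S \<sigma> a)"
  have P: "?P = density (noise_only \<sigma>) (\<lambda>x. ennreal (lik a x))"
    unfolding block_signal_def lik_def by (subst obs_dist_density[OF S \<sigma>]) (simp add: exp_sum[OF S(1)])
  interpret P: prob_space ?P by (rule prob_space_obs_dist)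
  interpret prod: product_sigma_finite "\<lambda>_ :: nat. ?P"
    by (simp add: product_sigma_finite_def prob_space_imp_sigma_finite P.prob_space_axioms)
  have kern: "kernel (K i)" if "i \<in> {1..m}" for i
    using K that unfolding transcript_scheme_def kernel_def measurable_cong_sets[OF sets_obs_dist refl]
    by (auto intro: measurable_prob_algebraD)
  have pmf_meas: "(\<lambda>x. ennreal (pmf (K i x) z)) \<in> borel_measurable (noise_only \<sigma>)" if "i \<in> {1..m}" for i z
    by (rule measurable_compose[OF weightD(1)[OF weight_pmf[OF kern[OF that]]] measurable_ennreal])
  have pmf_meas': "(\<lambda>x. ennreal (pmf (K i x) z)) \<in> borel_measurable ?P" if "i \<in> {1..m}" for i z
    using pmf_meas[OF that] unfolding measurable_cong_sets[OF sets_obs_dist refl] .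
  have lik_meas: "(\<lambda>x. ennreal (lik a x)) \<in> borel_measurable (noise_only \<sigma>)"
    by (rule measurable_compose[OF lik_measurable measurable_ennreal])
  define Z where "Z = {z :: nat \<Rightarrow> bool list. \<forall>i. i \<notin> {1..m} \<longrightarrow> z i = []}"
  have Z: "countable Z" unfolding Z_def by (rule countable_finitely_supported) simp
  have marginal: "(\<integral>\<^sup>+x. ennreal (pmf (K i x) z) \<partial>?P) = ennreal (pmf (law (K i) a) z)" if i: "i \<in> {1..m}" for i z
  proof -
    have "(\<integral>\<^sup>+x. ennreal (pmf (K i x) z) \<partial>?P) = (\<integral>\<^sup>+x. ennreal (lik a x) * ennreal (pmf (K i x) z) \<partial>noise_only \<sigma>)"
      unfolding P by (rule nn_integral_density[OF lik_meas pmf_meas[OF i]])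
    also have "\<dots> = ennreal (pmf (law (K i) a) z)"
      unfolding pmf_law[OF kern[OF i]] ennreal_prob_of[OF weight_pmf[OF kern[OF i]]]
      by (intro nn_integral_cong) (simp add: ennreal_mult[symmetric] mult.commute)
    finally show ?thesis .
  qed
  have prod_meas: "(\<lambda>X. ennreal (\<Prod>i\<in>{1..m}. pmf (K i (X i)) (z i))) \<in> borel_measurable (data_dist m \<sigma> (block_signal S \<sigma> a))" for z
    unfolding prod_ennreal[symmetric, OF pmf_nonneg] data_dist_def
  proof (rule borel_measurable_prod_ennreal)
    fix i assume i: "i \<in> {1..m}"
    show "(\<lambda>X. ennreal (pmf (K i (X i)) (z i))) \<in> borel_measurable (Pi\<^sub>M {1..m} (\<lambda>_. ?P))"
      by (rule measurable_compose[OF measurable_component_singleton[of i "{1..m}" "\<lambda>_. ?P", OF i] pmf_meas'[OF i]])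
  qed
  have "transcript_expectation m \<sigma> (block_signal S \<sigma> a) K f
     = (\<integral>\<^sup>+X. (\<integral>\<^sup>+z. ennreal (\<Prod>i\<in>{1..m}. pmf (K i (X i)) (z i)) * f z \<partial>count_space Z) \<partial>data_dist m \<sigma> (block_signal S \<sigma> a))"
    unfolding transcript_expectation_def Z_def by (subst nn_integral_Pi_pmf) auto
  also have "\<dots> = (\<integral>\<^sup>+z. (\<integral>\<^sup>+X. ennreal (\<Prod>i\<in>{1..m}. pmf (K i (X i)) (z i)) * f z \<partial>data_dist m \<sigma> (block_signal S \<sigma> a)) \<partial>count_space Z)"
    by (intro nn_integral_count_space_nn_integral Z borel_measurable_times_ennreal prod_meas borel_measurable_const)
  also have "\<dots> = (\<integral>\<^sup>+z. ennreal (\<Prod>i\<in>{1..m}. pmf (law (K i) a) (z i)) * f z \<partial>count_space Z)"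
  proof (intro nn_integral_cong)
    fix z
    have "(\<integral>\<^sup>+X. ennreal (\<Prod>i\<in>{1..m}. pmf (K i (X i)) (z i)) * f z \<partial>data_dist m \<sigma> (block_signal S \<sigma> a))
       = (\<integral>\<^sup>+X. ennreal (\<Prod>i\<in>{1..m}. pmf (K i (X i)) (z i)) \<partial>data_dist m \<sigma> (block_signal S \<sigma> a)) * f z"
      by (rule nn_integral_multc[OF prod_meas])
    also have "(\<integral>\<^sup>+X. ennreal (\<Prod>i\<in>{1..m}. pmf (K i (X i)) (z i)) \<partial>data_dist m \<sigma> (block_signal S \<sigma> a))
       = (\<Prod>i\<in>{1..m}. \<integral>\<^sup>+x. ennreal (pmf (K i x) (z i)) \<partial>?P)"
      unfolding prod_ennreal[symmetric, OF pmf_nonneg] data_dist_def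
      by (rule prod.product_nn_integral_prod, rule finite_atLeastAtMost, erule pmf_meas')
    also have "\<dots> = ennreal (\<Prod>i\<in>{1..m}. pmf (law (K i) a) (z i))"
      unfolding prod_ennreal[symmetric, OF pmf_nonneg] by (intro prod.cong refl marginal)
    finally show "(\<integral>\<^sup>+X. ennreal (\<Prod>i\<in>{1..m}. pmf (K i (X i)) (z i)) * f z \<partial>data_dist m \<sigma> (block_signal S \<sigma> a))
       = ennreal (\<Prod>i\<in>{1..m}. pmf (law (K i) a) (z i)) * f z" .
  qed
  also have "\<dots> = (\<integral>\<^sup>+z. f z \<partial>measure_pmf (Pi_pmf {1..m} [] (\<lambda>i. law (K i) a)))"
    unfolding Z_def by (subst nn_integral_Pi_pmf) auto
  finally show ?thesis .
qed

lemma sq_loss_level_le: "ennreal (\<Sum>k = 1..2 ^ j. (\<eta> j k - \<theta> j k)\<^sup>2) \<le> sq_loss \<eta> \<theta>"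
  unfolding sq_loss_def
  using sum_le_suminf[of "\<lambda>j. ennreal (\<Sum>k = 1..2 ^ j. (\<eta> j k - \<theta> j k)\<^sup>2)" "{j}"] by simp

lemma level_norm_zero: "1 \<le> p \<Longrightarrow> (\<And>k. k \<in> {1..2 ^ j} \<Longrightarrow> \<theta> j k = 0) \<Longrightarrow> level_norm p \<theta> j = 0"
  by (auto simp: level_norm_def)

lemma level_norm_le:
  assumes p: "1 \<le> p" and \<delta>: "\<delta> \<ge> 0" and \<theta>: "\<And>k. k \<in> {1..2 ^ j} \<Longrightarrow> \<bar>\<theta> j k\<bar> \<le> \<delta>"
  shows "level_norm p \<theta> j \<le> 2 powr (real j * real_of_ereal (1 / p)) * \<delta>"
proof (cases "p = \<infinity>")
  case True
  then show ?thesis using \<theta> by (auto simp: level_norm_def)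
next
  case False
  with p obtain r where r: "p = ereal r" "r \<ge> 1" by (cases p) auto
  have "(\<Sum>k = 1..2 ^ j. \<bar>\<theta> j k\<bar> powr r) \<le> (\<Sum>k = 1..(2 :: nat) ^ j. \<delta> powr r)"
    using r \<theta> by (intro sum_mono powr_mono2) auto
  also have "\<dots> = 2 ^ j * \<delta> powr r" by simp
  finally have "(\<Sum>k = 1..2 ^ j. \<bar>\<theta> j k\<bar> powr r) powr (1 / r) \<le> (2 ^ j * \<delta> powr r) powr (1 / r)"
    using r by (intro powr_mono2 sum_nonneg) auto
  also have "\<dots> = 2 powr (real j * (1 / r)) * \<delta>"
    using r \<delta> by (simp add: powr_mult powr_powr powr_realpow[symmetric])
  finally show ?thesis
    using r by (simp add: level_norm_def one_ereal_def)
qed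

lemma level_norm_nonneg: "level_norm p \<theta> j \<ge> 0"
proof (cases "p = \<infinity>")
  case True
  have "0 \<le> \<bar>\<theta> j 1\<bar>" by simp
  also have "\<dots> \<le> Max ((\<lambda>k. \<bar>\<theta> j k\<bar>) ` {1..2 ^ j})" by (rule Max_ge) auto
  finally show ?thesis using True by (simp add: level_norm_def)
qed (simp add: level_norm_def)

text \<open>
  On a single level the sum over levels has one term.  The largest value of the inner norm is attained
  by coefficients of equal size, where the factor \<open>2 powr (J / p)\<close> cancels the \<open>- 1 / p\<close> in the
  smoothness index.
\<close>

lemma single_level_in_besov_ball:
  assumes p: "1 \<le> p" and q: "1 \<le> q" and \<delta>: "\<delta> \<ge> 0"
    and on: "\<And>k. k \<in> {1..2 ^ J} \<Longrightarrow> \<bar>\<theta> J k\<bar> \<le> \<delta>" and off: "\<And>j k. j \<noteq> J \<Longrightarrow> \<theta> j k = 0"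
    and M: "2 powr (real J * (\<alpha> + 1 / 2)) * \<delta> \<le> M"
  shows "\<theta> \<in> besov_ball \<alpha> p q M"
proof -
  define a where "a = (\<lambda>j. 2 powr (real j * besov_s \<alpha> p) * level_norm p \<theta> j)"
  have a0: "a j = 0" if "j \<noteq> J" for j
    using level_norm_zero[OF p, of j \<theta>] off[OF that] by (simp add: a_def)
  have aJ0: "a J \<ge> 0" by (simp add: a_def level_norm_nonneg)
  have "a J \<le> 2 powr (real J * besov_s \<alpha> p) * (2 powr (real J * real_of_ereal (1 / p)) * \<delta>)"
    unfolding a_def by (intro mult_left_mono level_norm_le p \<delta> on) auto
  also have "\<dots> = 2 powr (real J * (\<alpha> + 1 / 2)) * \<delta>"
    by (simp add: powr_add[symmetric] besov_s_def algebra_simps)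
  also note M
  finally have aJ: "a J \<le> M" .
  have M0: "M \<ge> 0" using aJ0 aJ by simp
  have "besov_norm \<alpha> p q \<theta> \<le> ennreal M"
  proof (cases "q = \<infinity>")
    case True
    have "ennreal (a j) \<le> ennreal M" for j
      using a0[of j] aJ M0 by (cases "j = J") (auto intro: ennreal_leI)
    then show ?thesis
      using True by (auto simp: besov_norm_def Let_def a_def[symmetric] intro!: SUP_least)
  next
    case False
    with q obtain r where r: "q = ereal r" "r \<ge> 1" by (cases q) auto
    have "(\<lambda>j. a j powr r) sums (\<Sum>j\<in>{J}. a j powr r)"
      using r by (intro sums_finite) (auto simp: a0)
    then have s: "summable (\<lambda>j. a j powr r)" "(\<Sum>j. a j powr r) = a J powr r"
      by (auto simp: sums_iff)
    have "besov_norm \<alpha> p q \<theta> = ennreal ((a J powr r) powr (1 / r))"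
      using r s False by (simp add: besov_norm_def Let_def a_def[symmetric])
    also have "(a J powr r) powr (1 / r) = a J" using r aJ0 by (simp add: powr_powr)
    finally show ?thesis using aJ by (simp add: ennreal_leI)
  qed
  then show ?thesis by (simp add: besov_ball_def)
qed

section \<open>Cost of rate-optimal estimation on one Besov ball\<close>

lemma zero_in_besov_ball:
  assumes "1 \<le> p" "1 \<le> q" "M \<ge> 0"
  shows "(\<lambda>_ _. 0) \<in> besov_ball \<alpha> p q M"
  using assms by (intro single_level_in_besov_ball[where \<delta>=0 and J=0]) auto

lemma expected_cost_ge_machines:
  assumes K: "transcript_scheme m K"
  shows "of_nat m \<le> expected_cost m \<sigma> K \<theta>"
proof -
  interpret D: prob_space "data_dist m \<sigma> \<theta>"
    unfolding data_dist_def by (intro prob_space_PiM prob_space_obs_dist)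
  have "(of_nat m :: ennreal) = (\<integral>\<^sup>+X. of_nat m \<partial>data_dist m \<sigma> \<theta>)"
    using D.emeasure_space_1 by simp
  also have "\<dots> \<le> expected_cost m \<sigma> K \<theta>"
    unfolding expected_cost_def transcript_expectation_def
  proof (rule nn_integral_mono)
    fix X assume X: "X \<in> space (data_dist m \<sigma> \<theta>)"
    have len: "length w \<ge> 1" if "i \<in> {1..m}" "w \<in> set_pmf (K i (X i))" for i w
    proof -
      have "X i \<in> space obs_space" using X that by (auto simp: data_dist_def space_PiM PiE_iff)
      then show ?thesis using K that unfolding transcript_scheme_def by blast
    qed
    have "(of_nat m :: ennreal) = (\<integral>\<^sup>+Z. of_nat m \<partial>measure_pmf (Pi_pmf {1..m} [] (\<lambda>i. K i (X i))))"
      by simp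
    also have "\<dots> \<le> (\<integral>\<^sup>+Z. of_nat (\<Sum>i = 1..m. length (Z i)) \<partial>measure_pmf (Pi_pmf {1..m} [] (\<lambda>i. K i (X i))))"
    proof (rule nn_integral_mono_AE, rule AE_pmfI)
      fix Z assume "Z \<in> set_pmf (Pi_pmf {1..m} [] (\<lambda>i. K i (X i)))"
      then have "(\<Sum>i = 1..m. 1) \<le> (\<Sum>i = 1..m. length (Z i))"
        by (intro sum_mono len) (auto simp: set_Pi_pmf PiE_dflt_def)
      then show "(of_nat m :: ennreal) \<le> of_nat (\<Sum>i = 1..m. length (Z i))"
        by (intro of_nat_mono) simp
    qed
    finally show "(of_nat m :: ennreal) \<le> (\<integral>\<^sup>+Z. of_nat (\<Sum>i = 1..m. length (Z i)) \<partial>measure_pmf (Pi_pmf {1..m} [] (\<lambda>i. K i (X i))))" .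
  qed
  finally show ?thesis .
qed

lemma dyadic_between:
  fixes x :: real
  assumes "x \<ge> 1"
  obtains J where "2 ^ J \<le> x" "x < 2 * 2 ^ J"
proof -
  define n where "n = (LEAST n. x < 2 ^ n)"
  have ex: "\<exists>n. x < 2 ^ n" by (rule real_arch_pow) simp
  have n: "x < 2 ^ n" unfolding n_def using ex by (rule LeastI_ex)
  have "n \<noteq> 0"
  proof
    assume "n = 0" then show False using n assms by simp
  qed
  then obtain J where J: "n = Suc J" by (cases n) auto
  have "\<not> x < 2 ^ J" unfolding not_less_Least using not_less_Least[of J "\<lambda>n. x < 2 ^ n"] J by (simp add: n_def)
  then show ?thesis using that[of J] n J by simp
qed

text \<open>
  The number \<open>D\<close> of coefficients that matter on a ball: up to the level with \<open>D\<close> coefficients, a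
  signal in the ball can have all coefficients of size \<open>\<sigma> / sqrt m\<close>.  The minimax rate is
  \<open>\<sigma>\<^sup>2 D / m\<close>, see \<open>minimax_rate_eq\<close>.
\<close>

definition effective_dim :: "real \<Rightarrow> real \<Rightarrow> nat \<Rightarrow> real \<Rightarrow> real" where
  "effective_dim \<alpha> \<sigma> m M = (M / \<sigma>) powr (2 / (2 * \<alpha> + 1)) * real m powr (1 / (2 * \<alpha> + 1))"

context
  fixes \<alpha> \<sigma> M :: real and m :: nat
  assumes \<alpha>: "\<alpha> > 0" and \<sigma>: "\<sigma> > 0" and M: "M \<ge> \<sigma>" and m: "m \<ge> 1"
begin

lemma effective_dim_pos: "effective_dim \<alpha> \<sigma> m M > 0"
  using \<sigma> M m by (simp add: effective_dim_def)

lemma effective_dim_powr: "effective_dim \<alpha> \<sigma> m M powr (2 * \<alpha> + 1) = (M / \<sigma>)\<^sup>2 * m"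
proof -
  have "effective_dim \<alpha> \<sigma> m M powr (2 * \<alpha> + 1)
      = (M / \<sigma>) powr (2 / (2 * \<alpha> + 1) * (2 * \<alpha> + 1)) * real m powr (1 / (2 * \<alpha> + 1) * (2 * \<alpha> + 1))"
    unfolding effective_dim_def powr_powr[symmetric] by (rule powr_mult)
  also have "2 / (2 * \<alpha> + 1) * (2 * \<alpha> + 1) = 2" using \<alpha> by (simp add: field_simps)
  also have "1 / (2 * \<alpha> + 1) * (2 * \<alpha> + 1) = 1" using \<alpha> by (simp add: field_simps)
  finally show ?thesis using \<sigma> M by simp
qed

lemma effective_dim_times_machines:
  "real m * effective_dim \<alpha> \<sigma> m M
     = (M / \<sigma>) powr (2 / (2 * \<alpha> + 1)) * real m powr ((2 * \<alpha> + 2) / (2 * \<alpha> + 1))"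
proof -
  have "(2 * \<alpha> + 2) / (2 * \<alpha> + 1) = 1 + 1 / (2 * \<alpha> + 1)" using \<alpha> by (simp add: field_simps)
  then show ?thesis using m by (simp add: effective_dim_def powr_add mult_ac)
qed

lemma minimax_rate_eq:
  "M powr (2 / (2 * \<alpha> + 1)) * (\<sigma>\<^sup>2 / real m) powr (2 * \<alpha> / (2 * \<alpha> + 1))
     = \<sigma>\<^sup>2 * effective_dim \<alpha> \<sigma> m M / m"
proof -
  have s: "2 * \<alpha> / (2 * \<alpha> + 1) = 1 - 1 / (2 * \<alpha> + 1)" using \<alpha> by (simp add: field_simps)
  have "(\<sigma>\<^sup>2 / real m) powr (2 * \<alpha> / (2 * \<alpha> + 1)) = (\<sigma>\<^sup>2 / m) / (\<sigma>\<^sup>2 / m) powr (1 / (2 * \<alpha> + 1))"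
    unfolding s using \<sigma> m by (simp add: powr_diff)
  also have "(\<sigma>\<^sup>2 / m) powr (1 / (2 * \<alpha> + 1)) = \<sigma> powr (2 / (2 * \<alpha> + 1)) / m powr (1 / (2 * \<alpha> + 1))"
  proof -
    have "\<sigma>\<^sup>2 powr (1 / (2 * \<alpha> + 1)) = (\<sigma> powr 2) powr (1 / (2 * \<alpha> + 1))" using \<sigma> by simp
    also have "\<dots> = \<sigma> powr (2 / (2 * \<alpha> + 1))" unfolding powr_powr by simp
    finally show ?thesis by (simp add: powr_divide)
  qed
  finally show ?thesis
    using \<sigma> M m by (simp add: effective_dim_def powr_divide mult_ac)
qed

lemma effective_dim_le_machines_sq:
  assumes C: "C > 0" and MC: "M \<le> C * \<sigma> * real m powr (2 * \<alpha> + 1 / 2)"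
  shows "effective_dim \<alpha> \<sigma> m M \<le> C powr (2 / (2 * \<alpha> + 1)) * (real m)\<^sup>2"
proof -
  have "M / \<sigma> \<le> C * real m powr (2 * \<alpha> + 1 / 2)" using MC \<sigma> by (simp add: field_simps)
  then have "(M / \<sigma>) powr (2 / (2 * \<alpha> + 1)) \<le> (C * real m powr (2 * \<alpha> + 1 / 2)) powr (2 / (2 * \<alpha> + 1))"
    using \<alpha> \<sigma> M by (intro powr_mono2) auto
  then have "effective_dim \<alpha> \<sigma> m M \<le> (C * real m powr (2 * \<alpha> + 1 / 2)) powr (2 / (2 * \<alpha> + 1)) * real m powr (1 / (2 * \<alpha> + 1))"
    unfolding effective_dim_def by (intro mult_right_mono) auto
  also have "\<dots> = C powr (2 / (2 * \<alpha> + 1)) * real m powr ((2 * \<alpha> + 1 / 2) * (2 / (2 * \<alpha> + 1)) + 1 / (2 * \<alpha> + 1))"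
  proof -
    have "(C * x powr a) powr b * x powr c = C powr b * x powr (a * b + c)" for x a b c :: real
      by (simp add: powr_mult powr_powr powr_add)
    then show ?thesis .
  qed
  also have "(2 * \<alpha> + 1 / 2) * (2 / (2 * \<alpha> + 1)) + 1 / (2 * \<alpha> + 1) = 2"
  proof -
    have y: "2 * \<alpha> + 1 \<noteq> 0" using \<alpha> by simp
    have "(2 * \<alpha> + 1 / 2) * (2 / (2 * \<alpha> + 1)) + 1 / (2 * \<alpha> + 1) = ((2 * \<alpha> + 1 / 2) * 2 + 1) / (2 * \<alpha> + 1)"
      by (simp only: add_divide_distrib times_divide_eq_right)
    also have "(2 * \<alpha> + 1 / 2) * 2 + 1 = 2 * (2 * \<alpha> + 1)" by simp
    finally show ?thesis using nonzero_mult_div_cancel_right[OF y, of 2] by (rule trans)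
  qed
  finally show ?thesis using m by simp
qed

end

text \<open>
  The level \<open>J\<close> carries between \<open>e D / 2\<close> and \<open>e D\<close> coefficients.  As \<open>e\<close> decreases, a cube of half
  width \<open>\<sigma> \<beta>\<close> with \<open>\<beta>\<^sup>2\<close> up to \<open>e powr (- 2 * \<alpha> - 1) / m\<close> fits into the ball, while only
  \<open>\<beta>\<^sup>2 = 160 C / (e m)\<close> is needed for the risk \<open>C \<sigma>\<^sup>2 D / m\<close> to be small compared with the size of
  the cube; hence the condition on \<open>e\<close>.
\<close>

lemma single_level_cost_lower_bound:
  fixes \<alpha> C e B \<rho> \<beta> :: real and p q :: ereal
  assumes \<alpha>: "\<alpha> > 0" and p: "1 \<le> p" and q: "1 \<le> q" and C: "C > 0"
    and e: "e > 0" "e \<le> 4 * C" and e\<alpha>: "160 * C * e powr (2 * \<alpha>) \<le> 1"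
    and \<sigma>: "\<sigma> > 0" and M: "M \<ge> \<sigma>" and m: "m \<ge> 1" and K: "transcript_scheme m K"
    and risk: "\<And>\<theta>. \<theta> \<in> besov_ball \<alpha> p q M \<Longrightarrow>
      risk m \<sigma> K \<theta>hat \<theta> \<le> ennreal (C * (\<sigma>\<^sup>2 * effective_dim \<alpha> \<sigma> m M / m))"
    and J: "2 ^ J \<le> e * effective_dim \<alpha> \<sigma> m M" "e * effective_dim \<alpha> \<sigma> m M < 2 * 2 ^ J"
  defines "\<rho> \<equiv> e / (4 * C)" and "\<beta> \<equiv> sqrt (160 * C / e / m)"
  shows "ennreal (\<rho> * 2 ^ J / 64 * (\<rho>\<^sup>2 / 768 * m)) \<le> (SUP \<theta>\<in>besov_ball \<alpha> p q M. expected_cost m \<sigma> K \<theta>)"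
    and "exp (2 ^ J * (\<beta> ^ 4 * exp (\<beta>\<^sup>2))) \<le> G \<Longrightarrow>
      ennreal (\<rho> * 2 ^ J / 64 * ((\<rho>\<^sup>2 / 768)\<^sup>2 / G * m)) \<le> expected_cost m \<sigma> K (\<lambda>_ _. 0)"
proof -
  define D where "D = effective_dim \<alpha> \<sigma> m M"
  define S where "S = {J} \<times> {1..(2 :: nat) ^ J}"
  have S: "finite S" "S \<subseteq> coef_index" "S \<noteq> {}" and cardS: "card S = 2 ^ J"
    by (auto simp: S_def coef_index_def)
  have D: "D > 0" unfolding D_def by (rule effective_dim_pos[OF \<alpha> \<sigma> M m])
  have mpos: "real m > 0" using m by simp
  have \<rho>: "0 < \<rho>" "\<rho> \<le> 1" using e C by (auto simp: \<rho>_def)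
  have \<beta>: "\<beta> > 0" using e C mpos by (simp add: \<beta>_def)
  have \<beta>2: "\<beta>\<^sup>2 = 160 * C / e / m" using e C by (simp add: \<beta>_def)
  interpret gaussian_experiment "noise_only \<sigma>" S "\<lambda>jk x. x jk / \<sigma>"
    by (rule gaussian_experiment_obs[OF S(1,2) \<sigma>])
  have kern: "kernel (K i)" if "i \<in> {1..m}" for i
    using K that unfolding transcript_scheme_def kernel_def measurable_cong_sets[OF sets_obs_dist refl]
    by (auto intro: measurable_prob_algebraD)
  have nonempty: "set_pmf (K i x) \<subseteq> {z. length z \<ge> 1}" if "i \<in> {1..m}" "x \<in> space (noise_only \<sigma>)" for i x
    using K that unfolding transcript_scheme_def space_obs_dist by blast
  have ball: "block_signal S \<sigma> a \<in> besov_ball \<alpha> p q M" if a: "\<forall>k\<in>S. \<bar>a k\<bar> \<le> \<beta>" for a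
  proof (rule single_level_in_besov_ball[OF p q, where J=J and \<delta>="\<sigma> * \<beta>"])
    show "\<sigma> * \<beta> \<ge> 0" using \<sigma> \<beta> by simp
    show "\<bar>block_signal S \<sigma> a J k\<bar> \<le> \<sigma> * \<beta>" if "k \<in> {1..2 ^ J}" for k
      using a that \<sigma> by (auto simp: block_signal_def S_def abs_mult)
    show "block_signal S \<sigma> a j k = 0" if "j \<noteq> J" for j k
      using that by (simp add: block_signal_def S_def)
    have "(2 ^ J) powr (2 * \<alpha> + 1) * \<beta>\<^sup>2 \<le> (e * D) powr (2 * \<alpha> + 1) * \<beta>\<^sup>2"
      using J \<alpha> by (intro mult_right_mono powr_mono2) (auto simp: D_def)
    also have "\<dots> = (e * e powr (2 * \<alpha>)) * D powr (2 * \<alpha> + 1) * (160 * C / e / m)"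
      using e D by (simp add: \<beta>2 powr_mult powr_add mult_ac)
    also have "\<dots> = (160 * C * e powr (2 * \<alpha>)) * (M / \<sigma>)\<^sup>2"
      using e mpos by (simp add: D_def effective_dim_powr[OF \<alpha> \<sigma> M m])
    also have "\<dots> \<le> 1 * (M / \<sigma>)\<^sup>2" by (intro mult_right_mono e\<alpha>) auto
    finally have sq: "(2 ^ J) powr (2 * \<alpha> + 1) * \<beta>\<^sup>2 \<le> (M / \<sigma>)\<^sup>2" by simp
    have "(2 powr (real J * (\<alpha> + 1 / 2)) * \<beta>)\<^sup>2 = 2 powr (real J * (\<alpha> + 1 / 2) * 2) * \<beta>\<^sup>2"
      by (simp add: power_mult_distrib powr_powr[symmetric])
    also have "\<dots> = (2 ^ J) powr (2 * \<alpha> + 1) * \<beta>\<^sup>2"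
      by (simp add: powr_realpow[symmetric] powr_powr algebra_simps)
    finally have "(2 powr (real J * (\<alpha> + 1 / 2)) * \<beta>)\<^sup>2 \<le> (M / \<sigma>)\<^sup>2" using sq by simp
    then have "2 powr (real J * (\<alpha> + 1 / 2)) * \<beta> \<le> M / \<sigma>"
      by (rule power2_le_imp_le) (use \<sigma> M in simp)
    then show "2 powr (real J * (\<alpha> + 1 / 2)) * (\<sigma> * \<beta>) \<le> M" using \<sigma> by (simp add: field_simps)
  qed
  have cost: "(\<integral>\<^sup>+z. of_nat (\<Sum>i\<in>{1..m}. length (z i)) \<partial>measure_pmf (Pi_pmf {1..m} [] (\<lambda>i. law (K i) a)))
      = expected_cost m \<sigma> K (block_signal S \<sigma> a)" for a
    unfolding expected_cost_def by (rule transcript_expectation_law[OF S(1,2) \<sigma> K, symmetric])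
  define R where "R = C * D / m"
  have risk_a: "(\<integral>\<^sup>+z. ennreal (\<Sum>k\<in>S. (\<theta>hat z (fst k) (snd k) / \<sigma> - a k)\<^sup>2)
      \<partial>measure_pmf (Pi_pmf {1..m} [] (\<lambda>i. law (K i) a))) \<le> ennreal R"
    if a: "\<forall>k\<in>S. \<bar>a k\<bar> \<le> \<beta>" for a
  proof -
    have "ennreal (\<Sum>k\<in>S. (\<theta>hat z (fst k) (snd k) / \<sigma> - a k)\<^sup>2) \<le> ennreal (1 / \<sigma>\<^sup>2) * sq_loss (\<theta>hat z) (block_signal S \<sigma> a)" for z
    proof -
      have "(\<Sum>k\<in>S. (\<theta>hat z (fst k) (snd k) / \<sigma> - a k)\<^sup>2) = (\<Sum>k = 1..2 ^ J. (\<theta>hat z J k / \<sigma> - a (J, k))\<^sup>2)"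
        unfolding S_def sum.cartesian_product' by simp
      also have "\<dots> = (\<Sum>k = 1..2 ^ J. 1 / \<sigma>\<^sup>2 * (\<theta>hat z J k - block_signal S \<sigma> a J k)\<^sup>2)"
        using \<sigma> by (intro sum.cong refl) (auto simp: block_signal_def S_def power2_eq_square field_simps)
      also have "\<dots> = 1 / \<sigma>\<^sup>2 * (\<Sum>k = 1..2 ^ J. (\<theta>hat z J k - block_signal S \<sigma> a J k)\<^sup>2)"
        by (rule sum_distrib_left[symmetric])
      also have "ennreal \<dots> = ennreal (1 / \<sigma>\<^sup>2) * ennreal (\<Sum>k = 1..2 ^ J. (\<theta>hat z J k - block_signal S \<sigma> a J k)\<^sup>2)"
        by (rule ennreal_mult) (auto intro: sum_nonneg)
      also have "\<dots> \<le> ennreal (1 / \<sigma>\<^sup>2) * sq_loss (\<theta>hat z) (block_signal S \<sigma> a)"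
        by (intro mult_left_mono sq_loss_level_le) simp
      finally show ?thesis .
    qed
    then have "(\<integral>\<^sup>+z. ennreal (\<Sum>k\<in>S. (\<theta>hat z (fst k) (snd k) / \<sigma> - a k)\<^sup>2)
      \<partial>measure_pmf (Pi_pmf {1..m} [] (\<lambda>i. law (K i) a)))
      \<le> (\<integral>\<^sup>+z. ennreal (1 / \<sigma>\<^sup>2) * sq_loss (\<theta>hat z) (block_signal S \<sigma> a) \<partial>measure_pmf (Pi_pmf {1..m} [] (\<lambda>i. law (K i) a)))"
      by (intro nn_integral_mono)
    also have "\<dots> = ennreal (1 / \<sigma>\<^sup>2) * risk m \<sigma> K \<theta>hat (block_signal S \<sigma> a)"
      unfolding risk_def transcript_expectation_law[OF S(1,2) \<sigma> K] by (rule nn_integral_cmult) simp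
    also have "\<dots> \<le> ennreal (1 / \<sigma>\<^sup>2) * ennreal (C * (\<sigma>\<^sup>2 * D / m))"
      unfolding D_def by (intro mult_left_mono risk ball a) simp
    also have "\<dots> = ennreal R"
      using \<sigma> C D mpos by (simp add: ennreal_mult[symmetric] R_def)
    finally show ?thesis .
  qed
  have "\<rho> * card {1..m} * R = \<rho> * C * D" using mpos by (simp add: R_def)
  also have "\<dots> = e * D / 4" using C by (simp add: \<rho>_def)
  also have "\<dots> \<le> card S / 2" using J by (simp add: cardS D_def)
  finally have small: "\<rho> * card {1..m} * R \<le> card S / 2" .
  have wide: "40 \<le> \<rho> * card {1..m} * \<beta>\<^sup>2" using e C mpos by (simp add: \<beta>2 \<rho>_def)
  have R0: "R \<ge> 0" using C D by (simp add: R_def)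
  have mne: "{1..m} \<noteq> {}" using m by auto
  have long: "ennreal (\<rho>\<^sup>2 * card {1..m} / 768) \<le>
    (\<Sum>i\<in>{1..m}. \<integral>\<^sup>+a. ennreal (measure_pmf.prob (law (K i) a) {z. real (length z) > \<rho> * card S / 64}) \<partial>cube_prior S \<beta>)"
    by (rule accuracy_needs_long_transcripts[OF \<beta> finite_atLeastAtMost mne kern nonempty S(3) R0 \<rho> small wide risk_a])
  have t: "\<rho> * card S / 64 \<ge> 0" using \<rho> by simp
  have "ennreal (\<rho> * card S / 64 * (\<rho>\<^sup>2 * card {1..m} / 768)) \<le> (SUP \<theta>\<in>besov_ball \<alpha> p q M. expected_cost m \<sigma> K \<theta>)"
  proof (rule max_cost_on_cube_ge[OF \<beta> finite_atLeastAtMost kern t _ long])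
    show "0 \<le> \<rho>\<^sup>2 * card {1..m} / 768" by simp
    show "(\<integral>\<^sup>+z. of_nat (\<Sum>i\<in>{1..m}. length (z i)) \<partial>measure_pmf (Pi_pmf {1..m} [] (\<lambda>i. law (K i) a)))
       \<le> (SUP \<theta>\<in>besov_ball \<alpha> p q M. expected_cost m \<sigma> K \<theta>)" if "\<forall>k\<in>S. \<bar>a k\<bar> \<le> \<beta>" for a
      unfolding cost by (intro SUP_upper ball that)
  qed
  then show "ennreal (\<rho> * 2 ^ J / 64 * (\<rho>\<^sup>2 / 768 * m)) \<le> (SUP \<theta>\<in>besov_ball \<alpha> p q M. expected_cost m \<sigma> K \<theta>)"
    by (simp add: cardS)
  assume G: "exp (2 ^ J * (\<beta> ^ 4 * exp (\<beta>\<^sup>2))) \<le> G"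
  have "ennreal (\<rho> * card S / 64 * ((\<rho>\<^sup>2 / 768)\<^sup>2 / G * card {1..m}))
     \<le> (\<integral>\<^sup>+z. of_nat (\<Sum>i\<in>{1..m}. length (z i)) \<partial>measure_pmf (Pi_pmf {1..m} [] (\<lambda>i. law (K i) (\<lambda>_. 0))))"
    by (rule cost_at_zero_ge[OF \<beta> finite_atLeastAtMost kern t])
       (use \<rho> long G in \<open>auto simp: cardS\<close>)
  also have "\<dots> = expected_cost m \<sigma> K (\<lambda>_ _. 0)"
    unfolding cost by (simp add: block_signal_def cong: if_cong)
  finally show "ennreal (\<rho> * 2 ^ J / 64 * ((\<rho>\<^sup>2 / 768)\<^sup>2 / G * m)) \<le> expected_cost m \<sigma> K (\<lambda>_ _. 0)"
    by (simp add: cardS)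
qed

text \<open>
  Rate-optimality on a ball costs \<open>m D\<close> bits somewhere on that ball, and even at the zero signal if the
  ball is not too large compared with \<open>m\<close>.  If \<open>D\<close> is so small that no level with the required number
  of coefficients exists, the cost of one bit per machine suffices.
\<close>

lemma communication_lower_bound:
  fixes \<alpha> C :: real and p q :: ereal
  assumes \<alpha>: "\<alpha> > 0" and p: "1 \<le> p" and q: "1 \<le> q" and C: "C > 0"
  shows "\<exists>c::real. c > 0 \<and> (\<forall>m \<sigma> M K \<theta>hat.
    m \<ge> 1 \<longrightarrow> \<sigma> > 0 \<longrightarrow> M \<ge> \<sigma> \<longrightarrow> transcript_scheme m K \<longrightarrow>
    (SUP \<theta>\<in>besov_ball \<alpha> p q M. risk m \<sigma> K \<theta>hat \<theta>)
       \<le> ennreal (C * M powr (2 / (2 * \<alpha> + 1)) * (\<sigma>\<^sup>2 / real m) powr (2 * \<alpha> / (2 * \<alpha> + 1))) \<longrightarrow>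
    ennreal (c * (real m * effective_dim \<alpha> \<sigma> m M)) \<le> (SUP \<theta>\<in>besov_ball \<alpha> p q M. expected_cost m \<sigma> K \<theta>) \<and>
    (M \<le> C * \<sigma> * real m powr (2 * \<alpha> + 1 / 2) \<longrightarrow>
       ennreal (c * (real m * effective_dim \<alpha> \<sigma> m M)) \<le> expected_cost m \<sigma> K (\<lambda>_ _. 0)))"
proof -
  define e where "e = min (4 * C) (min 1 ((1 / (160 * C)) powr (1 / (2 * \<alpha>))))"
  have e: "e > 0" "e \<le> 4 * C" "e \<le> 1" using C by (auto simp: e_def)
  have "e powr (2 * \<alpha>) \<le> ((1 / (160 * C)) powr (1 / (2 * \<alpha>))) powr (2 * \<alpha>)"
    using e \<alpha> by (intro powr_mono2) (auto simp: e_def)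
  also have "\<dots> = 1 / (160 * C)" using \<alpha> C by (simp add: powr_powr)
  finally have e\<alpha>: "160 * C * e powr (2 * \<alpha>) \<le> 1" using C by (simp add: field_simps)
  define B where "B = 160 * C / e"
  define \<rho> where "\<rho> = e / (4 * C)"
  define G where "G = exp (C powr (2 / (2 * \<alpha> + 1)) * (B\<^sup>2 * exp B))"
  define c1 where "c1 = \<rho> * e / 128 * (\<rho>\<^sup>2 / 768)"
  define c2 where "c2 = \<rho> * e / 128 * ((\<rho>\<^sup>2 / 768)\<^sup>2 / G)"
  define c where "c = min e (min c1 c2)"
  have B: "B > 0" using C e by (simp add: B_def)
  have \<rho>: "\<rho> > 0" using C e by (simp add: \<rho>_def)
  have G: "G > 0" by (simp add: G_def)
  have c1: "c1 > 0" using \<rho> e by (simp add: c1_def)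
  have c2: "c2 > 0" using \<rho> e G by (simp add: c2_def)
  have c: "c > 0" "c \<le> e" "c \<le> c1" "c \<le> c2" using e c1 c2 by (auto simp: c_def)
  show ?thesis
  proof (intro exI[of _ c] conjI allI impI c(1))
    fix m :: nat and \<sigma> M :: real and K :: "nat \<Rightarrow> (nat \<times> nat \<Rightarrow> real) \<Rightarrow> bool list pmf"
      and \<theta>hat :: "(nat \<Rightarrow> bool list) \<Rightarrow> nat \<Rightarrow> nat \<Rightarrow> real"
    assume m: "m \<ge> 1" and \<sigma>: "\<sigma> > 0" and M: "M \<ge> \<sigma>" and K: "transcript_scheme m K"
      and sup: "(SUP \<theta>\<in>besov_ball \<alpha> p q M. risk m \<sigma> K \<theta>hat \<theta>)
       \<le> ennreal (C * M powr (2 / (2 * \<alpha> + 1)) * (\<sigma>\<^sup>2 / real m) powr (2 * \<alpha> / (2 * \<alpha> + 1)))"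
    define D where "D = effective_dim \<alpha> \<sigma> m M"
    have D: "D > 0" unfolding D_def by (rule effective_dim_pos[OF \<alpha> \<sigma> M m])
    have mpos: "real m > 0" using m by simp
    have mD: "real m * D \<ge> 0" using D by simp
    have risk: "risk m \<sigma> K \<theta>hat \<theta> \<le> ennreal (C * (\<sigma>\<^sup>2 * effective_dim \<alpha> \<sigma> m M / m))"
      if "\<theta> \<in> besov_ball \<alpha> p q M" for \<theta>
      using order_trans[OF SUP_upper[OF that] sup]
      unfolding mult.assoc minimax_rate_eq[OF \<alpha> \<sigma> M m] .
    have zero: "(\<lambda>_ _. 0) \<in> besov_ball \<alpha> p q M"
      using \<sigma> M by (intro zero_in_besov_ball p q) auto
    have "ennreal (c * (m * D)) \<le> (SUP \<theta>\<in>besov_ball \<alpha> p q M. expected_cost m \<sigma> K \<theta>) \<and>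
      (M \<le> C * \<sigma> * real m powr (2 * \<alpha> + 1 / 2) \<longrightarrow> ennreal (c * (m * D)) \<le> expected_cost m \<sigma> K (\<lambda>_ _. 0))"
    proof (cases "e * D < 1")
      case True
      \<comment> \<open>Every machine sends at least one bit.\<close>
      have "c * (m * D) \<le> e * (m * D)" using c mD by (intro mult_right_mono) auto
      also have "\<dots> = m * (e * D)" by simp
      also have "\<dots> \<le> real m * 1" using True by (intro mult_left_mono) auto
      finally have "ennreal (c * (m * D)) \<le> of_nat m"
        by (simp add: ennreal_of_nat_eq_real_of_nat ennreal_leI)
      also have "\<dots> \<le> expected_cost m \<sigma> K (\<lambda>_ _. 0)" by (rule expected_cost_ge_machines[OF K])
      finally have at0: "ennreal (c * (m * D)) \<le> expected_cost m \<sigma> K (\<lambda>_ _. 0)" .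
      have "ennreal (c * (m * D)) \<le> (SUP \<theta>\<in>besov_ball \<alpha> p q M. expected_cost m \<sigma> K \<theta>)"
        using zero by (rule SUP_upper2) (rule at0)
      with at0 show ?thesis by simp
    next
      case False
      then obtain J where J: "2 ^ J \<le> e * D" "e * D < 2 * 2 ^ J"
        using dyadic_between[of "e * D"] by auto
      have lower1: "ennreal (\<rho> * 2 ^ J / 64 * (\<rho>\<^sup>2 / 768 * m)) \<le> (SUP \<theta>\<in>besov_ball \<alpha> p q M. expected_cost m \<sigma> K \<theta>)"
        unfolding \<rho>_def
        by (rule single_level_cost_lower_bound(1)[OF \<alpha> p q C e(1,2) e\<alpha> \<sigma> M m K risk J[unfolded D_def]])
      have lower2: "ennreal (\<rho> * 2 ^ J / 64 * ((\<rho>\<^sup>2 / 768)\<^sup>2 / G * m)) \<le> expected_cost m \<sigma> K (\<lambda>_ _. 0)"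
        if "exp (2 ^ J * ((sqrt (B / m)) ^ 4 * exp ((sqrt (B / m))\<^sup>2))) \<le> G"
        unfolding \<rho>_def
        by (rule single_level_cost_lower_bound(2)[OF \<alpha> p q C e(1,2) e\<alpha> \<sigma> M m K risk J[unfolded D_def]
              that[unfolded B_def]])
      have half: "\<rho> * e / 128 * D \<le> \<rho> * 2 ^ J / 64"
        using J \<rho> mult_left_mono[of "e * D" "2 * 2 ^ J" "\<rho> / 128"] by (simp add: field_simps)
      have "c * (m * D) \<le> c1 * (m * D)" using c mD by (intro mult_right_mono) auto
      also have "\<dots> = (\<rho> * e / 128 * D) * (\<rho>\<^sup>2 / 768 * m)" by (simp add: c1_def)
      also have "\<dots> \<le> \<rho> * 2 ^ J / 64 * (\<rho>\<^sup>2 / 768 * m)" by (rule mult_right_mono[OF half]) simp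
      finally have "ennreal (c * (m * D)) \<le> ennreal (\<rho> * 2 ^ J / 64 * (\<rho>\<^sup>2 / 768 * m))" by (rule ennreal_leI)
      also note lower1
      finally have first: "ennreal (c * (m * D)) \<le> (SUP \<theta>\<in>besov_ball \<alpha> p q M. expected_cost m \<sigma> K \<theta>)" .
      have second: "ennreal (c * (m * D)) \<le> expected_cost m \<sigma> K (\<lambda>_ _. 0)"
        if MC: "M \<le> C * \<sigma> * real m powr (2 * \<alpha> + 1 / 2)"
      proof -
        \<comment> \<open>Here \<open>d\<close> is of order at most \<open>m\<^sup>2\<close>, which bounds the second moment of the likelihood ratio.\<close>
        have "2 ^ J \<le> 1 * D" using J(1) e(3) D by (meson mult_right_mono less_imp_le order_trans)
        also have "1 * D \<le> C powr (2 / (2 * \<alpha> + 1)) * (real m)\<^sup>2"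
          using effective_dim_le_machines_sq[OF \<alpha> \<sigma> M m C MC] by (simp add: D_def)
        finally have J2: "2 ^ J \<le> C powr (2 / (2 * \<alpha> + 1)) * (real m)\<^sup>2" .
        have b2: "(sqrt (B / m))\<^sup>2 = B / m" using B by simp
        have b4: "(sqrt (B / m)) ^ 4 = B\<^sup>2 / (real m)\<^sup>2"
        proof -
          have "(sqrt (B / m)) ^ 4 = ((sqrt (B / m))\<^sup>2)\<^sup>2"
            by (simp only: power4_eq_xxxx power2_eq_square mult.assoc)
          then show ?thesis unfolding b2 power_divide .
        qed
        have "exp (B / m) \<le> exp B" using B m by (simp add: field_simps)
        then have "2 ^ J * (B\<^sup>2 / (real m)\<^sup>2 * exp (B / m))
            \<le> (C powr (2 / (2 * \<alpha> + 1)) * (real m)\<^sup>2) * (B\<^sup>2 / (real m)\<^sup>2 * exp B)"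
          by (intro mult_mono J2 mult_left_mono) auto
        also have "\<dots> = C powr (2 / (2 * \<alpha> + 1)) * (B\<^sup>2 * exp B)" using mpos by simp
        finally have "exp (2 ^ J * ((sqrt (B / m)) ^ 4 * exp ((sqrt (B / m))\<^sup>2))) \<le> G"
          unfolding G_def b2 b4 by simp
        note low2 = lower2[OF this]
        have "c * (m * D) \<le> c2 * (m * D)" using c mD by (intro mult_right_mono) auto
        also have "\<dots> = (\<rho> * e / 128 * D) * ((\<rho>\<^sup>2 / 768)\<^sup>2 / G * m)" by (simp add: c2_def)
        also have "\<dots> \<le> \<rho> * 2 ^ J / 64 * ((\<rho>\<^sup>2 / 768)\<^sup>2 / G * m)"
          using G by (intro mult_right_mono[OF half]) simp
        finally have "ennreal (c * (m * D)) \<le> ennreal (\<rho> * 2 ^ J / 64 * ((\<rho>\<^sup>2 / 768)\<^sup>2 / G * m))"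
          by (rule ennreal_leI)
        also note low2
        finally show ?thesis .
      qed
      from first second show ?thesis by blast
    qed
    then show "ennreal (c * (real m * effective_dim \<alpha> \<sigma> m M)) \<le> (SUP \<theta>\<in>besov_ball \<alpha> p q M. expected_cost m \<sigma> K \<theta>)"
      "M \<le> C * \<sigma> * real m powr (2 * \<alpha> + 1 / 2) \<Longrightarrow>
         ennreal (c * (real m * effective_dim \<alpha> \<sigma> m M)) \<le> expected_cost m \<sigma> K (\<lambda>_ _. 0)"
      unfolding D_def by blast+
  qed
qed

section \<open>Adaptation to two Besov balls\<close>

text \<open>
  The first term is paid at the zero signal, which lies in the second ball, and the second term somewhere
  on the second ball.
\<close>

theorem theorem4:
  fixes \<alpha>1 \<alpha>2 C :: real and p1 q1 p2 q2 :: ereal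
  assumes "\<alpha>1 > 0" and "\<alpha>2 > 0"
    and "1 \<le> p1" and "1 \<le> q1" and "1 \<le> p2" and "1 \<le> q2"
    and "besov_s \<alpha>1 p1 > 0" and "besov_s \<alpha>2 p2 > 0"
    and "C > 0"
  shows "\<exists>c::real. c > 0 \<and>
    (\<forall>(m::nat) (\<sigma>::real) (M1::real) (M2::real)
       (K :: nat \<Rightarrow> (nat \<times> nat \<Rightarrow> real) \<Rightarrow> bool list pmf)
       (\<theta>hat :: (nat \<Rightarrow> bool list) \<Rightarrow> nat \<Rightarrow> nat \<Rightarrow> real).
       m \<ge> 1 \<longrightarrow> \<sigma> > 0 \<longrightarrow> M1 \<ge> \<sigma> \<longrightarrow> M2 \<ge> \<sigma> \<longrightarrow>
       M1 \<le> C * \<sigma> * real m powr (2 * \<alpha>1 + 1 / 2) \<longrightarrow>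
       transcript_scheme m K \<longrightarrow>
       (SUP \<theta>\<in>besov_ball \<alpha>1 p1 q1 M1. risk m \<sigma> K \<theta>hat \<theta>)
         \<le> ennreal (C * M1 powr (2 / (2 * \<alpha>1 + 1))
                      * (\<sigma>\<^sup>2 / real m) powr (2 * \<alpha>1 / (2 * \<alpha>1 + 1))) \<longrightarrow>
       (SUP \<theta>\<in>besov_ball \<alpha>2 p2 q2 M2. risk m \<sigma> K \<theta>hat \<theta>)
         \<le> ennreal (C * M2 powr (2 / (2 * \<alpha>2 + 1))
                      * (\<sigma>\<^sup>2 / real m) powr (2 * \<alpha>2 / (2 * \<alpha>2 + 1))) \<longrightarrow>
       ennreal (c * ((M1 / \<sigma>) powr (2 / (2 * \<alpha>1 + 1))
                       * real m powr ((2 * \<alpha>1 + 2) / (2 * \<alpha>1 + 1))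
                     + (M2 / \<sigma>) powr (2 / (2 * \<alpha>2 + 1))
                       * real m powr ((2 * \<alpha>2 + 2) / (2 * \<alpha>2 + 1))))
         \<le> (SUP \<theta>\<in>besov_ball \<alpha>2 p2 q2 M2. expected_cost m \<sigma> K \<theta>))"
proof -
  obtain c1 where c1: "c1 > 0" and lower1: "\<And>m \<sigma> M K \<theta>hat.
    m \<ge> 1 \<Longrightarrow> \<sigma> > 0 \<Longrightarrow> M \<ge> \<sigma> \<Longrightarrow> transcript_scheme m K \<Longrightarrow>
    (SUP \<theta>\<in>besov_ball \<alpha>1 p1 q1 M. risk m \<sigma> K \<theta>hat \<theta>)
       \<le> ennreal (C * M powr (2 / (2 * \<alpha>1 + 1)) * (\<sigma>\<^sup>2 / real m) powr (2 * \<alpha>1 / (2 * \<alpha>1 + 1))) \<Longrightarrow>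
    M \<le> C * \<sigma> * real m powr (2 * \<alpha>1 + 1 / 2) \<Longrightarrow>
    ennreal (c1 * (real m * effective_dim \<alpha>1 \<sigma> m M)) \<le> expected_cost m \<sigma> K (\<lambda>_ _. 0)"
    using communication_lower_bound[OF assms(1,3,4,9)] by blast
  obtain c2 where c2: "c2 > 0" and lower2: "\<And>m \<sigma> M K \<theta>hat.
    m \<ge> 1 \<Longrightarrow> \<sigma> > 0 \<Longrightarrow> M \<ge> \<sigma> \<Longrightarrow> transcript_scheme m K \<Longrightarrow>
    (SUP \<theta>\<in>besov_ball \<alpha>2 p2 q2 M. risk m \<sigma> K \<theta>hat \<theta>)
       \<le> ennreal (C * M powr (2 / (2 * \<alpha>2 + 1)) * (\<sigma>\<^sup>2 / real m) powr (2 * \<alpha>2 / (2 * \<alpha>2 + 1))) \<Longrightarrow>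
    ennreal (c2 * (real m * effective_dim \<alpha>2 \<sigma> m M)) \<le> (SUP \<theta>\<in>besov_ball \<alpha>2 p2 q2 M. expected_cost m \<sigma> K \<theta>)"
    using communication_lower_bound[OF assms(2,5,6,9)] by blast
  define c where "c = min c1 c2 / 2"
  have c: "c > 0" "2 * c \<le> c1" "2 * c \<le> c2" using c1 c2 by (auto simp: c_def)
  show ?thesis
  proof (intro exI[of _ c] conjI allI impI c(1))
    fix m :: nat and \<sigma> M1 M2 :: real and K :: "nat \<Rightarrow> (nat \<times> nat \<Rightarrow> real) \<Rightarrow> bool list pmf"
      and \<theta>hat :: "(nat \<Rightarrow> bool list) \<Rightarrow> nat \<Rightarrow> nat \<Rightarrow> real"
    assume m: "m \<ge> 1" and \<sigma>: "\<sigma> > 0" and M: "M1 \<ge> \<sigma>" "M2 \<ge> \<sigma>"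
      and M1C: "M1 \<le> C * \<sigma> * real m powr (2 * \<alpha>1 + 1 / 2)" and K: "transcript_scheme m K"
      and risk1: "(SUP \<theta>\<in>besov_ball \<alpha>1 p1 q1 M1. risk m \<sigma> K \<theta>hat \<theta>)
         \<le> ennreal (C * M1 powr (2 / (2 * \<alpha>1 + 1)) * (\<sigma>\<^sup>2 / real m) powr (2 * \<alpha>1 / (2 * \<alpha>1 + 1)))"
      and risk2: "(SUP \<theta>\<in>besov_ball \<alpha>2 p2 q2 M2. risk m \<sigma> K \<theta>hat \<theta>)
         \<le> ennreal (C * M2 powr (2 / (2 * \<alpha>2 + 1)) * (\<sigma>\<^sup>2 / real m) powr (2 * \<alpha>2 / (2 * \<alpha>2 + 1)))"
    let ?L = "SUP \<theta>\<in>besov_ball \<alpha>2 p2 q2 M2. expected_cost m \<sigma> K \<theta>"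
    define D1 where "D1 = real m * effective_dim \<alpha>1 \<sigma> m M1"
    define D2 where "D2 = real m * effective_dim \<alpha>2 \<sigma> m M2"
    have D: "D1 > 0" "D2 > 0"
      using effective_dim_pos[OF assms(1) \<sigma> M(1) m] effective_dim_pos[OF assms(2) \<sigma> M(2) m] m
      by (simp_all add: D1_def D2_def)
    have "(\<lambda>_ _. 0) \<in> besov_ball \<alpha>2 p2 q2 M2"
      using \<sigma> M(2) by (intro zero_in_besov_ball assms) auto
    then have L1: "ennreal (c1 * D1) \<le> ?L"
      unfolding D1_def by (rule SUP_upper2) (rule lower1[OF m \<sigma> M(1) K risk1 M1C])
    have L2: "ennreal (c2 * D2) \<le> ?L"
      unfolding D2_def by (rule lower2[OF m \<sigma> M(2) K risk2])
    have "2 * c * D1 \<le> c1 * D1" "2 * c * D2 \<le> c2 * D2"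
      using c D by (auto intro: mult_right_mono)
    then have "c * (D1 + D2) \<le> max (c1 * D1) (c2 * D2)"
      by (simp add: distrib_left max_def)
    then have "ennreal (c * (D1 + D2)) \<le> ennreal (max (c1 * D1) (c2 * D2))"
      by (rule ennreal_leI)
    also have "\<dots> \<le> ?L" using L1 L2 by (simp add: max_def)
    finally show "ennreal (c * ((M1 / \<sigma>) powr (2 / (2 * \<alpha>1 + 1))
                       * real m powr ((2 * \<alpha>1 + 2) / (2 * \<alpha>1 + 1))
                     + (M2 / \<sigma>) powr (2 / (2 * \<alpha>2 + 1))
                       * real m powr ((2 * \<alpha>2 + 2) / (2 * \<alpha>2 + 1)))) \<le> ?L"
      unfolding D1_def D2_def effective_dim_times_machines[OF assms(1) \<sigma> M(1) m]
        effective_dim_times_machines[OF assms(2) \<sigma> M(2) m] .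
  qed
qed

end
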